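(* Let $N\ge1$ and $M\ge0$ be integers and let $\lambda,\mu$ be partitions with $\lambda'_1+\lambda'_2\le N+M$ and $\mu'_1+\mu'_2\le M$. Then there is an embedding (injective linear map) of the vector space $$\mathrm{Hom}_{O_M}(W_\mu,W_\lambda)$$ into the vector space $$\mathrm{Hom}_{\mathfrak{gl}_M}(V_\mu,V_\lambda)$$ compatible with the action of the orthogonal group $O_N$ in these two vector spaces.
   Context: For a partition $\nu$, $\nu'$ denotes the conjugate partition. All groups are complex. For a partition $\nu$ with $\nu'_1\le L$, $V_\nu$ is the irreducible polynomial representation of $GL_L$ (equivalently of $\mathfrak{gl}_L$) of highest weight $(\nu_1,\dots,\nu_L)$. For a partition $\nu$ of $n$ with $\nu'_1+\nu'_2\le L$, $W_\nu$ is the irreducible representation of $O_L$ labelled by $\nu$ following Weyl: embedding $V_\nu$ in $(\mathbb C^L)^{\otimes n}$, $W_\nu$ is the intersection of $V_\nu$ with the space of traceless tensors, i.e. those annihilated by contraction of any two distinct tensor factors with the standard symmetric bilinear form on $\mathbb C^L$; $O_L\subset GL_L$ is the subgroup preserving this form. In the claim, $V_\lambda$ and $W_\lambda$ are representations of $GL_{N+M}$ and $O_{N+M}$ (i.e. $L=N+M$), while $V_\mu$ and $W_\mu$ are representations of $GL_M$ and $O_M$ (i.e. $L=M$). The embeddings $GL_N\times GL_M\subset GL_{N+M}$ and $O_N\times O_M\subset O_{N+M}$ are block diagonal, the first factor acting on the first $N$ coordinates and the second on the last $M$ coordinates. The group $O_N$ acts on $\mathrm{Hom}_{O_M}(W_\mu,W_\lambda)$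 through its action on $W_\lambda$ as a subgroup of $O_{N+M}$, and on $\mathrm{Hom}_{\mathfrak{gl}_M}(V_\mu,V_\lambda)$ through its action on $V_\lambda$ as a subgroup of $GL_N\subset GL_{N+M}$. *)

theory Defs
  imports Complex_Main "HOL-Library.Function_Algebras" "Jordan_Normal_Form.Matrix"
begin

text \<open>Rows and columns are numbered from 0: the value \<open>\<nu> i\<close> is the part usually written
  \<open>\<nu>\<^sub>i\<^sub>+\<^sub>1\<close>, and \<open>conj_partition \<nu> j\<close> is the length of the column usually numbered \<open>j + 1\<close>.\<close>

definition is_partition :: "(nat \<Rightarrow> nat) \<Rightarrow> bool" where
  "is_partition \<nu> \<longleftrightarrow> antimono \<nu> \<and> finite {i. \<nu> i \<noteq> 0}"

definition psize :: "(nat \<Rightarrow> nat) \<Rightarrow> nat" where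
  "psize \<nu> = (\<Sum>i | \<nu> i \<noteq> 0. \<nu> i)"

definition conj_partition :: "(nat \<Rightarrow> nat) \<Rightarrow> nat \<Rightarrow> nat" where
  "conj_partition \<nu> j = card {i. j < \<nu> i}"

definition GL :: "nat \<Rightarrow> complex mat set" where
  "GL L = {A \<in> carrier_mat L L. invertible_mat A}"

text \<open>\<open>\<bullet>\<close> is bilinear (no complex conjugation), so this is the complex orthogonal group.\<close>

definition OG :: "nat \<Rightarrow> complex mat set" where
  "OG L = {A \<in> GL L. \<forall>x \<in> carrier_vec L. \<forall>y \<in> carrier_vec L. (A *\<^sub>v x) \<bullet> (A *\<^sub>v y) = x \<bullet> y}"

definition block_diag :: "complex mat \<Rightarrow> complex mat \<Rightarrow> complex mat" where
  "block_diag A B =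
    four_block_mat A (0\<^sub>m (dim_row A) (dim_col B)) (0\<^sub>m (dim_row B) (dim_col A)) B"

text \<open>A tensor of degree \<open>n\<close> over the standard \<open>L\<close>-dimensional space is given by its coordinates:
  \<open>t [w\<^sub>1, \<dots>, w\<^sub>n]\<close> is the coefficient of the product of the standard basis vectors numbered
  \<open>w\<^sub>1, \<dots>, w\<^sub>n < L\<close>; all other values are 0.\<close>

type_synonym tensor = "nat list \<Rightarrow> complex"

definition words :: "nat \<Rightarrow> nat \<Rightarrow> nat list set" where
  "words L n = {w. set w \<subseteq> {..<L} \<and> length w = n}"

definition tensor_space :: "nat \<Rightarrow> nat \<Rightarrow> tensor set" where
  "tensor_space L n = {t. \<forall>w. w \<notin> words L n \<longrightarrow> t w = 0}"

definition tscale :: "complex \<Rightarrow> tensor \<Rightarrow> tensor" where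
  "tscale c t = (\<lambda>w. c * t w)"

interpretation tensor: vector_space tscale
  by unfold_locales (auto simp: tscale_def fun_eq_iff algebra_simps)

definition grp_act :: "complex mat \<Rightarrow> tensor \<Rightarrow> tensor" where
  "grp_act A t = (\<lambda>w. if set w \<subseteq> {..<dim_row A}
     then \<Sum>v \<in> words (dim_col A) (length w). (\<Prod>i<length w. A $$ (w ! i, v ! i)) * t v
     else 0)"

text \<open>The differential of \<open>grp_act\<close>, i.e. the action of the general linear Lie algebra: the sum over \<open>i\<close> of the
  action of the matrix on the \<open>i\<close>-th tensor factor alone.\<close>

definition lie_act :: "complex mat \<Rightarrow> tensor \<Rightarrow> tensor" where
  "lie_act X t = (\<lambda>w. if set w \<subseteq> {..<dim_row X}
     then \<Sum>i<length w. \<Sum>a<dim_col X. X $$ (w ! i, a) * t (w[i := a])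
     else 0)"

text \<open>Contraction of the factors \<open>i\<close> and \<open>j\<close> does not depend on the entries of \<open>w\<close> at these
  two positions, which only serve as placeholders.\<close>

definition traceless :: "nat \<Rightarrow> nat \<Rightarrow> tensor set" where
  "traceless L n = {t \<in> tensor_space L n.
     \<forall>i<n. \<forall>j<n. i \<noteq> j \<longrightarrow> (\<forall>w \<in> words L n. (\<Sum>a<L. t (w[i := a, j := a])) = 0)}"

definition GL_submodule :: "nat \<Rightarrow> tensor set \<Rightarrow> bool" where
  "GL_submodule L V \<longleftrightarrow> tensor.subspace V \<and> (\<forall>A \<in> GL L. \<forall>t \<in> V. grp_act A t \<in> V)"

definition GL_irreducible :: "nat \<Rightarrow> tensor set \<Rightarrow> bool" where
  "GL_irreducible L V \<longleftrightarrow> GL_submodule L V \<and> V \<noteq> {0} \<and>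
     (\<forall>U. U \<subseteq> V \<and> GL_submodule L U \<longrightarrow> U = {0} \<or> U = V)"

text \<open>Highest weights are taken with respect to the Borel subgroup of upper triangular matrices.\<close>

definition highest_weight_vector :: "nat \<Rightarrow> (nat \<Rightarrow> nat) \<Rightarrow> tensor \<Rightarrow> bool" where
  "highest_weight_vector L \<nu> t \<longleftrightarrow> t \<noteq> 0 \<and>
     (\<forall>A \<in> GL L. upper_triangular A \<longrightarrow>
        grp_act A t = tscale (\<Prod>i<L. (A $$ (i, i)) ^ \<nu> i) t)"

text \<open>\<open>V\<close> is an embedded copy, in tensors of degree \<open>|\<nu>|\<close>, of the irreducible polynomial
  representation of highest weight \<open>\<nu>\<close>. Such copies are in general not unique as subspaces.\<close>

definition is_V :: "nat \<Rightarrow> (nat \<Rightarrow> nat) \<Rightarrow> tensor set \<Rightarrow> bool" where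
  "is_V L \<nu> V \<longleftrightarrow> V \<subseteq> tensor_space L (psize \<nu>) \<and> GL_irreducible L V \<and>
     (\<exists>t \<in> V. highest_weight_vector L \<nu> t)"

definition W_of :: "nat \<Rightarrow> (nat \<Rightarrow> nat) \<Rightarrow> tensor set \<Rightarrow> tensor set" where
  "W_of L \<nu> V = V \<inter> traceless L (psize \<nu>)"

definition linear_map_on ::
  "(complex \<Rightarrow> 'a \<Rightarrow> 'a) \<Rightarrow> (complex \<Rightarrow> 'b \<Rightarrow> 'b) \<Rightarrow> 'a::plus set \<Rightarrow> 'b::plus set \<Rightarrow> ('a \<Rightarrow> 'b) \<Rightarrow> bool"
where
  "linear_map_on s1 s2 V W f \<longleftrightarrow> f ` V \<subseteq> W \<and>
     (\<forall>x\<in>V. \<forall>y\<in>V. f (x + y) = f x + f y) \<and> (\<forall>c. \<forall>x\<in>V. f (s1 c x) = s2 c (f x))"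

text \<open>Linear maps \<open>V \<rightarrow> W\<close> commuting with the actions \<open>\<rho>\<close> on \<open>V\<close> and \<open>\<sigma>\<close> on \<open>W\<close> of the elements
  of \<open>G\<close>. A map is represented by its extension by 0 outside \<open>V\<close>, so that distinct functions are
  distinct maps and the vector space operations are pointwise.\<close>

definition Hom :: "'g set \<Rightarrow> ('g \<Rightarrow> tensor \<Rightarrow> tensor) \<Rightarrow> ('g \<Rightarrow> tensor \<Rightarrow> tensor) \<Rightarrow>
    tensor set \<Rightarrow> tensor set \<Rightarrow> (tensor \<Rightarrow> tensor) set" where
  "Hom G \<rho> \<sigma> V W = {f. linear_map_on tscale tscale V W f \<and> (\<forall>t. t \<notin> V \<longrightarrow> f t = 0) \<and>
     (\<forall>g \<in> G. \<forall>t \<in> V. f (\<rho> g t) = \<sigma> g (f t))}"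

definition hscale :: "complex \<Rightarrow> (tensor \<Rightarrow> tensor) \<Rightarrow> (tensor \<Rightarrow> tensor)" where
  "hscale c f = (\<lambda>t. tscale c (f t))"

definition Hom_OG :: "nat \<Rightarrow> nat \<Rightarrow> tensor set \<Rightarrow> tensor set \<Rightarrow> (tensor \<Rightarrow> tensor) set" where
  "Hom_OG N M = Hom (OG M) grp_act (\<lambda>B. grp_act (block_diag (1\<^sub>m N) B))"

definition Hom_gl :: "nat \<Rightarrow> nat \<Rightarrow> tensor set \<Rightarrow> tensor set \<Rightarrow> (tensor \<Rightarrow> tensor) set" where
  "Hom_gl N M = Hom (carrier_mat M M) lie_act (\<lambda>X. lie_act (block_diag (0\<^sub>m N N) X))"

definition hom_act :: "nat \<Rightarrow> complex mat \<Rightarrow> (tensor \<Rightarrow> tensor) \<Rightarrow> (tensor \<Rightarrow> tensor)" where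
  "hom_act M A f = (\<lambda>t. grp_act (block_diag A (1\<^sub>m M)) (f t))"

end

theory Submission
  imports Defs "HOL-Combinatorics.Permutations" "Jordan_Normal_Form.Determinant"
begin

text \<open>Split a tensor over \<open>N + M\<close> letters by the number of its letters \<open>\<ge> N\<close>, and let \<open>n = |\<lambda>|\<close>,
  \<open>m = |\<mu>|\<close>. For \<open>f \<in> Hom(W\<^sub>\<mu>, W\<^sub>\<lambda>)\<close> the components of \<open>f\<close> with \<open>k\<close> letters \<open>\<ge> N\<close> are \<open>O\<^sub>M\<close>-maps from
  \<open>W\<^sub>\<mu>\<close> to tensors of degree \<open>k\<close>. By the first fundamental theorem for \<open>O\<^sub>M\<close> such a map vanishes if \<open>k < m\<close>
  or if \<open>k > m\<close> and its values are traceless, and is a combination of permutations of the factors if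
  \<open>k = m\<close>. So the component with \<open>k = m\<close> extends to a \<open>GL\<^sub>M\<close>-map \<open>V\<^sub>\<mu> \<rightarrow> V\<^sub>\<lambda>\<close>, uniquely since \<open>V\<^sub>\<mu>\<close> is
  irreducible; and it determines \<open>f\<close>, because tracelessness over all \<open>N + M\<close> letters expresses the
  contractions of the component with \<open>k\<close> such letters through the component with \<open>k - 2\<close>.

  The fundamental theorem reduces by induction on the degree to the fact that an \<open>O\<^sub>M\<close>-invariant traceless
  tensor of positive degree is 0, which is seen on a coordinate in which some letter occurs
  as often as possible.\<close>

section \<open>Tensors and orthogonal matrices\<close>

text \<open>The obstacle is to pass from O_M to all of GL_M. A combination of permutations of the
  factors is a formula that makes sense on every tensor and commutes with every matrix, so it can be
  applied to all of \<open>V_mu\<close> although it is found on \<open>W_mu\<close>. That its values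
  stay in \<open>V_lam\<close> is again irreducibility: the tensors of \<open>V_mu\<close> sent into
  \<open>V_lam\<close> form a GL_M-submodule, which contains \<open>W_mu\<close> because
  \<open>V_lam\<close>, being stable under diagonal matrices, contains the components of its
  elements. The coefficients of the permutations are in general not determined by the map, so they
  cannot be used to define a linear embedding. The embedding is defined through uniqueness of the
  extension, and its linearity and O_N-compatibility follow from uniqueness. If \<open>W_mu\<close>
  is zero, uniqueness may fail, but then the source is zero as well. Invariant complements come from
  the Hermitian form on tensors: O_M is closed under conjugate transposes, so the orthogonal
  complement of an O_M-stable subspace is O_M-stable.\<close>

lemma words_0: "words L 0 = {[]}"
  by (auto simp: words_def)

lemma Cons_in_words: "a # v \<in> words L (Suc n) \<longleftrightarrow> a < L \<and> v \<in> words L n"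
  by (auto simp: words_def)

lemma words_Suc: "words L (Suc n) = (\<lambda>(a, v). a # v) ` ({..<L} \<times> words L n)"
proof (rule Set.set_eqI)
  fix w :: "nat list"
  show "w \<in> words L (Suc n) \<longleftrightarrow> w \<in> (\<lambda>(a, v). a # v) ` ({..<L} \<times> words L n)"
    by (cases w) (auto simp: words_def)
qed

lemma finite_words [simp]: "finite (words L n)"
  by (induction n) (auto simp: words_0 words_Suc)

lemma words_length: "w \<in> words L n \<Longrightarrow> length w = n"
  by (simp add: words_def)

lemma words_nth: "w \<in> words L n \<Longrightarrow> i < n \<Longrightarrow> w ! i < L"
  by (auto simp: words_def subset_iff)

lemma words_update: "w \<in> words L n \<Longrightarrow> a < L \<Longrightarrow> w[i := a] \<in> words L n"
  by (auto simp: words_def dest: set_update_subset_insert[THEN subsetD])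

lemma words_append: "w \<in> words L k \<Longrightarrow> v \<in> words L m \<Longrightarrow> w @ v \<in> words L (k + m)"
  by (auto simp: words_def)

lemma words_permute_list:
  assumes "\<sigma> permutes {..<n}"
  shows "permute_list \<sigma> w \<in> words L n \<longleftrightarrow> w \<in> words L n"
  using assms by (auto simp: words_def)

lemma sum_words_Suc: "sum g (words L (Suc n)) = (\<Sum>a<L. \<Sum>v\<in>words L n. g (a # v))"
  unfolding words_Suc
  by (subst sum.reindex) (auto simp: inj_on_def sum.cartesian_product case_prod_unfold)

lemma sum_words_add:
  "sum g (words L (k + m)) = (\<Sum>w\<in>words L k. \<Sum>v\<in>words L m. g (w @ v))"
  by (induction k arbitrary: g) (simp_all add: words_0 sum_words_Suc)

lemma sum_words_permute:
  assumes "\<sigma> permutes {..<n}"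
  shows "(\<Sum>w\<in>words L n. g (permute_list \<sigma> w)) = (\<Sum>w\<in>words L n. g w)"
proof (rule sum.reindex_bij_witness[where j = "permute_list \<sigma>" and i = "permute_list (inv_into UNIV \<sigma>)"])
  fix w assume w: "w \<in> words L n"
  then have p: "\<sigma> permutes {..<length w}" "inv_into UNIV \<sigma> permutes {..<length w}"
    using assms permutes_inv by (auto simp: words_def)
  show "permute_list (inv_into UNIV \<sigma>) (permute_list \<sigma> w) = w"
    using permute_list_compose[of "inv_into UNIV \<sigma>" w \<sigma>] p permutes_inv_o[OF p(1)] by simp
  show "permute_list \<sigma> (permute_list (inv_into UNIV \<sigma>) w) = w"
    using permute_list_compose[of \<sigma> w "inv_into UNIV \<sigma>"] p permutes_inv_o[OF p(1)] by simp
  show "permute_list \<sigma> w \<in> words L n" "permute_list (inv_into UNIV \<sigma>) w \<in> words L n"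
    using w assms permutes_inv[OF assms] by (simp_all add: words_permute_list)
qed auto

text \<open>The entry of the tensor power of \<open>A\<close> in row \<open>w\<close> and column
  \<open>v\<close>, the degree being the length of \<open>w\<close>.\<close>

definition mprod :: "complex mat \<Rightarrow> nat list \<Rightarrow> nat list \<Rightarrow> complex" where
  "mprod A w v = (\<Prod>i<length w. A $$ (w ! i, v ! i))"

lemma mprod_Nil [simp]: "mprod A [] v = 1"
  by (simp add: mprod_def)

lemma mprod_Cons [simp]: "mprod A (a # w) (b # v) = A $$ (a, b) * mprod A w v"
  unfolding mprod_def length_Cons by (subst prod.lessThan_Suc_shift) simp

lemma mprod_append:
  "length w = length v \<Longrightarrow> mprod A (w @ w') (v @ v') = mprod A w v * mprod A w' v'"
  by (induction w v rule: list_induct2) simp_all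

lemma mprod_permute_list:
  assumes "\<sigma> permutes {..<length w}" "length v = length w"
  shows "mprod A (permute_list \<sigma> w) (permute_list \<sigma> v) = mprod A w v"
proof -
  have "mprod A (permute_list \<sigma> w) (permute_list \<sigma> v) = (\<Prod>i<length w. A $$ (w ! \<sigma> i, v ! \<sigma> i))"
    using assms by (simp add: mprod_def permute_list_nth)
  also have "\<dots> = mprod A w v"
    unfolding mprod_def using prod.permute[OF assms(1), of "\<lambda>i. A $$ (w ! i, v ! i)"]
    by (simp add: o_def)
  finally show ?thesis .
qed

lemma mult_mat_entry:
  "A \<in> carrier_mat L L \<Longrightarrow> B \<in> carrier_mat L L \<Longrightarrow> i < L \<Longrightarrow> j < L \<Longrightarrow>
     (A * B) $$ (i, j) = (\<Sum>k<L. A $$ (i, k) * B $$ (k, j))"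
  by (auto simp: scalar_prod_def atLeast0LessThan intro!: sum.cong)

lemma mprod_mult:
  assumes "A \<in> carrier_mat L L" "B \<in> carrier_mat L L"
    and "w \<in> words L n" "u \<in> words L n"
  shows "(\<Sum>v\<in>words L n. mprod A w v * mprod B v u) = mprod (A * B) w u"
  using assms(3,4)
proof (induction n arbitrary: w u)
  case 0
  then show ?case by (simp add: words_0)
next
  case (Suc n)
  then obtain a w' b u' where w: "w = a # w'" "u = b # u'"
    by (metis words_length length_Suc_conv)
  with Suc.prems have ab: "a < L" "b < L" and wu: "w' \<in> words L n" "u' \<in> words L n"
    by (auto simp: Cons_in_words)
  have "(\<Sum>v\<in>words L (Suc n). mprod A w v * mprod B v u) =
      (\<Sum>k<L. \<Sum>v\<in>words L n. (A $$ (a, k) * B $$ (k, b)) * (mprod A w' v * mprod B v u'))"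
    by (simp add: w sum_words_Suc mult_ac)
  also have "\<dots> = (\<Sum>k<L. A $$ (a, k) * B $$ (k, b)) *
      (\<Sum>v\<in>words L n. mprod A w' v * mprod B v u')"
    by (simp add: sum_product)
  also have "\<dots> = mprod (A * B) w u"
    using Suc.IH[OF wu] ab assms(1,2)
    by (simp add: w mult_mat_entry del: index_mult_mat)
  finally show ?case .
qed

lemma mprod_one:
  assumes "w \<in> words L n" "v \<in> words L n"
  shows "mprod (1\<^sub>m L) w v = of_bool (w = v)"
  using assms
proof (induction n arbitrary: w v)
  case 0
  then show ?case by (simp add: words_0)
next
  case (Suc n)
  then obtain a w' b v' where "w = a # w'" "v = b # v'"
    by (metis words_length length_Suc_conv)
  with Suc show ?case by (auto simp: Cons_in_words)
qed

section \<open>The action of matrices on tensors\<close>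

lemma tensor_eqI:
  assumes "s \<in> tensor_space L n" "t \<in> tensor_space L n" "\<And>w. w \<in> words L n \<Longrightarrow> s w = t w"
  shows "s = t"
proof
  show "s w = t w" for w
    using assms by (cases "w \<in> words L n") (auto simp: tensor_space_def)
qed

lemma tensor_subspace_space: "tensor.subspace (tensor_space L n)"
  by (auto simp: tensor.subspace_def tensor_space_def tscale_def)

lemma grp_act_words:
  assumes "A \<in> carrier_mat L L" "w \<in> words L n"
  shows "grp_act A t w = (\<Sum>v\<in>words L n. mprod A w v * t v)"
  using assms by (auto simp: grp_act_def words_def mprod_def)

lemma grp_act_in_space:
  assumes "A \<in> carrier_mat L L" "t \<in> tensor_space L n"
  shows "grp_act A t \<in> tensor_space L n"
proof -
  have "grp_act A t w = 0" if "w \<notin> words L n" for w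
  proof (cases "set w \<subseteq> {..<L}")
    case True
    with that have "length w \<noteq> n" by (auto simp: words_def)
    then have "t v = 0" if "v \<in> words L (length w)" for v
      using that assms(2) by (auto simp: tensor_space_def words_def)
    then show ?thesis using assms(1) by (auto simp: grp_act_def)
  next
    case False
    then show ?thesis using assms(1) by (auto simp: grp_act_def)
  qed
  then show ?thesis by (simp add: tensor_space_def)
qed

lemma grp_act_add: "grp_act A (s + t) = grp_act A s + grp_act A t"
  by (auto simp: grp_act_def fun_eq_iff algebra_simps sum.distrib)

lemma grp_act_scale: "grp_act A (tscale c t) = tscale c (grp_act A t)"
  by (auto simp: grp_act_def fun_eq_iff tscale_def sum_distrib_left mult_ac)

lemma grp_act_diff: "grp_act A (s - t) = grp_act A s - grp_act A t"
  by (auto simp: grp_act_def fun_eq_iff algebra_simps sum_subtractf)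

lemma grp_act_zero: "grp_act A 0 = 0"
  by (auto simp: grp_act_def fun_eq_iff)

lemma grp_act_mult:
  assumes A: "A \<in> carrier_mat L L" and B: "B \<in> carrier_mat L L"
  shows "grp_act (A * B) t = grp_act A (grp_act B t)"
proof
  fix w
  show "grp_act (A * B) t w = grp_act A (grp_act B t) w"
  proof (cases "set w \<subseteq> {..<L}")
    case True
    then have w: "w \<in> words L (length w)" by (simp add: words_def)
    have "grp_act A (grp_act B t) w =
        (\<Sum>v\<in>words L (length w). \<Sum>u\<in>words L (length w). mprod A w v * mprod B v u * t u)"
      using A B w by (simp add: grp_act_words[OF _ w] grp_act_words[of B L _ "length w"]
          sum_distrib_left mult.assoc)
    also have "\<dots> = (\<Sum>u\<in>words L (length w). (\<Sum>v\<in>words L (length w). mprod A w v * mprod B v u) * t u)"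
      by (subst sum.swap) (simp add: sum_distrib_right)
    also have "\<dots> = grp_act (A * B) t w"
      using A B w by (simp add: mprod_mult grp_act_words[OF _ w])
    finally show ?thesis by simp
  next
    case False
    then show ?thesis using A B by (auto simp: grp_act_def)
  qed
qed

lemma grp_act_permute:
  assumes "A \<in> carrier_mat L L" "\<sigma> permutes {..<n}" "w \<in> words L n"
  shows "grp_act A t (permute_list \<sigma> w) = grp_act A (\<lambda>v. t (permute_list \<sigma> v)) w"
proof -
  have "grp_act A t (permute_list \<sigma> w) =
      (\<Sum>v\<in>words L n. mprod A (permute_list \<sigma> w) (permute_list \<sigma> v) * t (permute_list \<sigma> v))"
    using assms sum_words_permute[OF assms(2), where g = "\<lambda>v. mprod A (permute_list \<sigma> w) v * t v"]
    by (simp add: grp_act_words[of A L _ n] words_permute_list)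
  also have "\<dots> = (\<Sum>v\<in>words L n. mprod A w v * t (permute_list \<sigma> v))"
    using assms by (intro sum.cong) (auto simp: mprod_permute_list words_length)
  finally show ?thesis using assms by (simp add: grp_act_words)
qed

lemma permute_in_space:
  assumes "\<sigma> permutes {..<n}" "t \<in> tensor_space L n"
  shows "(\<lambda>w. t (permute_list \<sigma> w)) \<in> tensor_space L n"
  using assms by (auto simp: tensor_space_def words_permute_list)

text \<open>Testing the form on pairs of basis vectors turns its preservation into
  \<open>A\<^sup>T * A = 1\<^sub>m L\<close>. Invertibility follows, because a one-sided inverse of
  a square matrix is two-sided.\<close>

lemma OG_iff: "A \<in> OG L \<longleftrightarrow> A \<in> carrier_mat L L \<and>
    (\<forall>i<L. \<forall>j<L. (\<Sum>k<L. A $$ (k, i) * A $$ (k, j)) = of_bool (i = j))" (is "_ \<longleftrightarrow> _ \<and> ?O")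
proof (cases "A \<in> carrier_mat L L")
  case A: True
  have T: "A\<^sup>T \<in> carrier_mat L L" using A by simp
  have O: "?O \<longleftrightarrow> A\<^sup>T * A = 1\<^sub>m L"
  proof -
    have "(A\<^sup>T * A) $$ (i, j) = (\<Sum>k<L. A $$ (k, i) * A $$ (k, j))" if "i < L" "j < L" for i j
      using that A by (subst mult_mat_entry[OF T A]) auto
    then show ?thesis using A by (auto simp: mat_eq_iff)
  qed
  have inv: "invertible_mat A" if "A\<^sup>T * A = 1\<^sub>m L"
    using mat_mult_left_right_inverse[OF T A that] that A
    unfolding invertible_mat_def inverts_mat_def by (auto intro!: exI[of _ "A\<^sup>T"])
  have form: "(A *\<^sub>v x) \<bullet> (A *\<^sub>v y) = ((A\<^sup>T * A) *\<^sub>v x) \<bullet> y"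
    if "x \<in> carrier_vec L" "y \<in> carrier_vec L" for x y
    using A T that by (subst transpose_vec_mult_scalar[symmetric, of _ L L]) auto
  have "A\<^sup>T * A = 1\<^sub>m L" if a: "A \<in> OG L"
  proof (rule eq_matI)
    fix i j assume ij: "i < dim_row (1\<^sub>m L)" "j < dim_col (1\<^sub>m L :: complex mat)"
    have c: "A *\<^sub>v unit_vec L k = col A k" if "k < L" for k
      using that A by (intro eq_vecI) auto
    have "(A *\<^sub>v unit_vec L i) \<bullet> (A *\<^sub>v unit_vec L j) = unit_vec L i \<bullet> unit_vec L j"
      using a by (auto simp: OG_def)
    then show "(A\<^sup>T * A) $$ (i, j) = 1\<^sub>m L $$ (i, j)" using ij A by (auto simp: c)
  qed (use A in auto)
  moreover have "A \<in> OG L" if "A\<^sup>T * A = 1\<^sub>m L"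
    using inv[OF that] A form that by (simp add: OG_def GL_def)
  ultimately show ?thesis using A O by auto
qed (auto simp: OG_def GL_def)

lemma OG_carrier: "A \<in> OG L \<Longrightarrow> A \<in> carrier_mat L L"
  by (simp add: OG_iff)

lemma OG_GL: "A \<in> OG L \<Longrightarrow> A \<in> GL L"
  by (simp add: OG_def)

lemma OG_transpose_mult: "A \<in> OG L \<Longrightarrow> A\<^sup>T * A = 1\<^sub>m L"
  by (intro eq_matI) (auto simp: OG_iff mult_mat_entry[of _ L] simp del: index_mult_mat(1))

lemma OG_mult_transpose: "A \<in> OG L \<Longrightarrow> A * A\<^sup>T = 1\<^sub>m L"
  using OG_transpose_mult OG_carrier mat_mult_left_right_inverse by (metis transpose_carrier_mat)

lemma OG_rows:
  assumes "A \<in> OG L" "i < L" "j < L"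
  shows "(\<Sum>k<L. A $$ (i, k) * A $$ (j, k)) = of_bool (i = j)"
proof -
  have c: "A \<in> carrier_mat L L" using assms(1) by (rule OG_carrier)
  have "(A * A\<^sup>T) $$ (i, j) = (\<Sum>k<L. A $$ (i, k) * A $$ (j, k))"
    using assms c by (subst mult_mat_entry[of _ L]) auto
  with OG_mult_transpose[OF assms(1)]
  have "(\<Sum>k<L. A $$ (i, k) * A $$ (j, k)) = 1\<^sub>m L $$ (i, j)"
    by (simp del: index_mult_mat index_one_mat)
  with assms show ?thesis by simp
qed

lemma OG_transpose: "A \<in> OG L \<Longrightarrow> A\<^sup>T \<in> OG L"
  using OG_rows[of A L] by (auto simp: OG_iff)

text \<open>The equations defining the group have real coefficients. Together with
  \<open>OG_transpose\<close> this closes the group under adjoints for the Hermitian form.\<close>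

lemma OG_conj:
  assumes "A \<in> OG L"
  shows "map_mat cnj A \<in> OG L"
proof -
  have "(\<Sum>k<L. map_mat cnj A $$ (k, i) * map_mat cnj A $$ (k, j)) =
      cnj (\<Sum>k<L. A $$ (k, i) * A $$ (k, j))" if "i < L" "j < L" for i j
    using that OG_carrier[OF assms] by auto
  with assms show ?thesis by (auto simp: OG_iff)
qed

section \<open>Orthogonal projections and infinitesimal invariance\<close>

text \<open>Hermitian and not bilinear: the bilinear form has isotropic vectors, whereas projections
  and the final vanishing arguments rely on definiteness.\<close>

definition ip :: "nat \<Rightarrow> nat \<Rightarrow> tensor \<Rightarrow> tensor \<Rightarrow> complex" where
  "ip L n x y = (\<Sum>w\<in>words L n. x w * cnj (y w))"

lemma ip_add_left: "ip L n (x + y) z = ip L n x z + ip L n y z"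
  by (simp add: ip_def algebra_simps sum.distrib)

lemma ip_diff_left: "ip L n (x - y) z = ip L n x z - ip L n y z"
  by (simp add: ip_def algebra_simps sum_subtractf)

lemma ip_scale_left: "ip L n (tscale c x) z = c * ip L n x z"
  by (simp add: ip_def tscale_def sum_distrib_left mult_ac)

lemma ip_add_right: "ip L n x (y + z) = ip L n x y + ip L n x z"
  by (simp add: ip_def algebra_simps sum.distrib)

lemma ip_scale_right: "ip L n x (tscale c y) = cnj c * ip L n x y"
  by (simp add: ip_def tscale_def sum_distrib_left mult_ac)

lemma ip_self_eq_0D:
  assumes "x \<in> tensor_space L n" "ip L n x x = 0"
  shows "x = 0"
proof -
  have "complex_of_real (\<Sum>w\<in>words L n. (cmod (x w))\<^sup>2) = 0"
    using assms(2) by (simp add: ip_def flip: complex_norm_square)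
  then have "(\<Sum>w\<in>words L n. (cmod (x w))\<^sup>2) = 0"
    using of_real_eq_0_iff by blast
  then have "\<forall>w\<in>words L n. x w = 0"
    by (subst (asm) sum_nonneg_eq_0_iff) auto
  then show ?thesis
    using assms(1) by (auto intro!: tensor_eqI[of _ L n] simp: tensor_space_def)
qed

text \<open>Gram-Schmidt, one generator at a time.\<close>

lemma orthogonal_decomposition_span:
  assumes "finite B" "B \<subseteq> tensor_space L n"
  shows "\<exists>u\<in>tensor.span B. \<forall>y\<in>tensor.span B. ip L n (x - u) y = 0"
  using assms
proof (induction B arbitrary: x)
  case empty
  show ?case by (simp add: tensor.span_empty ip_def)
next
  case (insert b B)
  let ?S = "tensor.span B" and ?S' = "tensor.span (insert b B)"
  have sub: "?S \<subseteq> ?S'" by (rule tensor.span_mono) auto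
  obtain v where v: "v \<in> ?S" "\<And>y. y \<in> ?S \<Longrightarrow> ip L n (b - v) y = 0"
    using insert.IH[of b] insert.prems by blast
  obtain u where u: "u \<in> ?S" "\<And>y. y \<in> ?S \<Longrightarrow> ip L n (x - u) y = 0"
    using insert.IH[of x] insert.prems by blast
  \<comment> \<open>The part of \<open>b\<close> orthogonal to the span of \<open>B\<close>. It can
    be 0, as \<open>b\<close> may already lie in that span.\<close>
  define d where "d = b - v"
  have S': "\<exists>k. \<exists>z\<in>?S. y = z + tscale k d" if y: "y \<in> ?S'" for y
  proof -
    obtain k where k: "y - tscale k b \<in> ?S"
      using y tensor.span_breakdown_eq by blast
    have "y - tscale k b + tscale k v \<in> ?S"
      using k v(1) by (intro tensor.span_add tensor.span_scale)
    moreover have "y = (y - tscale k b + tscale k v) + tscale k d"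
      by (simp add: d_def tensor.scale_right_diff_distrib)
    ultimately show ?thesis by blast
  qed
  have dS': "d \<in> ?S'"
    unfolding d_def using v(1) sub by (intro tensor.span_diff) (auto intro: tensor.span_base)
  show ?case
  proof (cases "d = 0")
    case True
    have "ip L n (x - u) y = 0" if "y \<in> ?S'" for y
      using S'[OF that] u(2) True by (auto simp: tensor.scale_zero_right)
    with u(1) sub show ?thesis by blast
  next
    case False
    have "v \<in> tensor_space L n"
      using v(1) tensor.span_minimal[OF _ tensor_subspace_space] insert.prems by blast
    then have "d \<in> tensor_space L n"
      unfolding d_def using insert.prems tensor.subspace_diff[OF tensor_subspace_space] by blast
    with False have dd: "ip L n d d \<noteq> 0" using ip_self_eq_0D by blast
    \<comment> \<open>The value for which \<open>(x - u) - tscale c d\<close> becomes orthogonal to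
      \<open>d\<close>.\<close>
    define c where "c = ip L n (x - u) d / ip L n d d"
    have "ip L n (x - (u + tscale c d)) y = 0" if y': "y \<in> ?S'" for y
    proof -
      obtain k z where y: "z \<in> ?S" "y = z + tscale k d" using S'[OF y'] by blast
      have eq: "x - (u + tscale c d) = (x - u) - tscale c d" by simp
      have "ip L n (x - (u + tscale c d)) y =
          ip L n (x - u) z - c * ip L n d z + cnj k * (ip L n (x - u) d - c * ip L n d d)"
        unfolding eq y(2) ip_add_right ip_scale_right
          ip_diff_left[of _ _ "x - u" "tscale c d"] ip_scale_left
        by (simp add: right_diff_distrib)
      also have "\<dots> = 0"
        using u(2)[OF y(1)] v(2)[OF y(1)] dd by (simp add: d_def[symmetric] c_def)
      finally show ?thesis .
    qed
    moreover have "u + tscale c d \<in> ?S'"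
      using u(1) sub dS' by (intro tensor.span_add tensor.span_scale) auto
    ultimately show ?thesis by blast
  qed
qed

definition unit_tensor :: "nat list \<Rightarrow> tensor" where
  "unit_tensor v = (\<lambda>w. of_bool (w = v))"

lemma unit_tensor_in_space: "v \<in> words L n \<Longrightarrow> unit_tensor v \<in> tensor_space L n"
  by (auto simp: unit_tensor_def tensor_space_def)

lemma sum_tensor_apply: "(\<Sum>i\<in>I. f i) w = (\<Sum>i\<in>I. (f i :: tensor) w)"
  by (induction I rule: infinite_finite_induct) auto

lemma tensor_expansion:
  assumes "t \<in> tensor_space L n"
  shows "t = (\<Sum>v\<in>words L n. tscale (t v) (unit_tensor v))"
proof
  fix w
  have "(\<Sum>v\<in>words L n. tscale (t v) (unit_tensor v)) w = (\<Sum>v\<in>words L n. if w = v then t v else 0)"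
    unfolding sum_tensor_apply by (intro sum.cong) (auto simp: tscale_def unit_tensor_def)
  then show "t w = (\<Sum>v\<in>words L n. tscale (t v) (unit_tensor v)) w"
    using assms by (simp add: tensor_space_def)
qed

lemma orthogonal_decomposition:
  assumes U: "tensor.subspace U" "U \<subseteq> tensor_space L n"
  shows "\<exists>u\<in>U. \<forall>y\<in>U. ip L n (x - u) y = 0"
proof -
  obtain B where B: "B \<subseteq> U" "tensor.independent B" "U \<subseteq> tensor.span B"
    using tensor.maximal_independent_subset by metis
  have "tensor_space L n \<subseteq> tensor.span (unit_tensor ` words L n)"
  proof
    fix t assume "t \<in> tensor_space L n"
    then have "t = (\<Sum>v\<in>words L n. tscale (t v) (unit_tensor v))" by (rule tensor_expansion)
    also have "\<dots> \<in> tensor.span (unit_tensor ` words L n)"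
      by (intro tensor.span_sum tensor.span_scale tensor.span_base) auto
    finally show "t \<in> tensor.span (unit_tensor ` words L n)" .
  qed
  then have "finite B"
    using tensor.independent_span_bound[of "unit_tensor ` words L n" B] B U by auto
  moreover have "tensor.span B = U"
    using B U(1) tensor.span_minimal by blast
  ultimately show ?thesis
    using orthogonal_decomposition_span[of B L n x] B U by blast
qed

section \<open>Diagonal matrices, reflections and rotations acting on tensors\<close>

definition diagonal :: "nat \<Rightarrow> (nat \<Rightarrow> complex) \<Rightarrow> complex mat" where
  "diagonal L d = mat L L (\<lambda>(i, j). if i = j then d i else 0)"

lemma diagonal_carrier: "diagonal L d \<in> carrier_mat L L"
  by (simp add: diagonal_def)

lemma grp_act_diagonal:
  assumes "w \<in> words L n"
  shows "grp_act (diagonal L d) t w = (\<Prod>i<n. d (w ! i)) * t w"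
proof -
  have "mprod (diagonal L d) w v = (if v = w then \<Prod>i<n. d (w ! i) else 0)"
    if v: "v \<in> words L n" for v
  proof (cases "v = w")
    case True
    then show ?thesis using assms
      by (auto simp: mprod_def diagonal_def words_length words_nth intro!: prod.cong)
  next
    case False
    then obtain i where "i < n" "w ! i \<noteq> v ! i"
      using assms v by (metis nth_equalityI words_length)
    then have "diagonal L d $$ (w ! i, v ! i) = 0"
      using assms v by (simp add: diagonal_def words_nth)
    then have "mprod (diagonal L d) w v = 0"
      using \<open>i < n\<close> assms unfolding mprod_def by (intro prod_zero) (auto simp: words_length)
    with False show ?thesis by simp
  qed
  then show ?thesis
    using assms by (simp add: grp_act_words[OF diagonal_carrier assms] if_distrib[of "\<lambda>x. x * _"] cong: if_cong)
qed

definition OG_invariant :: "nat \<Rightarrow> nat \<Rightarrow> tensor \<Rightarrow> bool" where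
  "OG_invariant L n t \<longleftrightarrow> t \<in> tensor_space L n \<and> (\<forall>A\<in>OG L. grp_act A t = t)"

lemma OG_invariant_permute:
  assumes "OG_invariant L n t" "\<sigma> permutes {..<n}"
  shows "OG_invariant L n (\<lambda>w. t (permute_list \<sigma> w))"
  unfolding OG_invariant_def
proof (intro conjI ballI)
  show sp: "(\<lambda>w. t (permute_list \<sigma> w)) \<in> tensor_space L n"
    using assms permute_in_space by (auto simp: OG_invariant_def)
  fix A assume A: "A \<in> OG L"
  show "grp_act A (\<lambda>w. t (permute_list \<sigma> w)) = (\<lambda>w. t (permute_list \<sigma> w))"
  proof (rule tensor_eqI[OF _ sp])
    show "grp_act A (\<lambda>w. t (permute_list \<sigma> w)) \<in> tensor_space L n"
      using sp A by (simp add: OG_carrier grp_act_in_space)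
    fix w assume "w \<in> words L n"
    then show "grp_act A (\<lambda>w. t (permute_list \<sigma> w)) w = t (permute_list \<sigma> w)"
      using assms A grp_act_permute[OF OG_carrier[OF A] assms(2), of w t]
      by (simp add: OG_invariant_def)
  qed
qed

lemma OG_invariant_subspace: "tensor.subspace {t. OG_invariant L n t}"
  using tensor_subspace_space[of L n]
  unfolding tensor.subspace_def OG_invariant_def
  by (simp add: grp_act_add grp_act_scale grp_act_zero)

text \<open>The reflection negating coordinate \<open>a\<close> multiplies the coefficient at
  \<open>w\<close> by -1 once for every \<open>a\<close> in \<open>w\<close>.\<close>

lemma OG_invariant_even:
  assumes "OG_invariant L n t" "w \<in> words L n" "t w \<noteq> 0" "a < L"
  shows "even (card {i. i < n \<and> w ! i = a})"
proof -
  let ?d = "\<lambda>i. if i = a then - 1 else 1 :: complex"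
  have "diagonal L ?d \<in> OG L"
    by (auto simp: OG_iff diagonal_carrier diagonal_def if_distrib[of "\<lambda>x. x * _"] cong: if_cong)
  then have "grp_act (diagonal L ?d) t = t"
    using assms(1) by (simp add: OG_invariant_def)
  then have "t w = (\<Prod>i<n. ?d (w ! i)) * t w"
    using grp_act_diagonal[OF assms(2), of ?d t] by simp
  also have "(\<Prod>i<n. ?d (w ! i)) = (- 1) ^ card {i. i < n \<and> w ! i = a}"
    by (simp add: prod.If_cases Collect_conj_eq lessThan_def)
  finally have "(- 1 :: complex) ^ card {i. i < n \<and> w ! i = a} = 1"
    using assms(3) by simp
  then show ?thesis
    by (cases "even (card {i. i < n \<and> w ! i = a})") simp_all
qed

text \<open>The angle is complex: the squares of sine and cosine still add up to 1, and complex
  differentiation at 0 becomes available.\<close>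

definition rotation :: "nat \<Rightarrow> nat \<Rightarrow> nat \<Rightarrow> complex \<Rightarrow> complex mat" where
  "rotation L a b \<theta> = mat L L (\<lambda>(i, j).
     if i = j then if i = a \<or> i = b then cos \<theta> else 1
     else if i = a \<and> j = b then - sin \<theta> else if i = b \<and> j = a then sin \<theta> else 0)"

lemma rotation_OG:
  assumes "a < L" "b < L" "a \<noteq> b"
  shows "rotation L a b \<theta> \<in> OG L"
proof -
  let ?R = "rotation L a b \<theta>"
  have "(\<Sum>k<L. ?R $$ (k, i) * ?R $$ (k, j)) = of_bool (i = j)" if ij: "i < L" "j < L" for i j
  proof -
    let ?g = "\<lambda>k. ?R $$ (k, i) * ?R $$ (k, j)"
    have "sum ?g {..<L} = ?g a + (?g b + sum ?g ({..<L} - {a} - {b}))"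
      using assms by (subst sum.remove[of _ a], simp, simp, subst sum.remove[of _ b]) auto
    also have "sum ?g ({..<L} - {a} - {b}) =
        (\<Sum>k\<in>{..<L} - {a} - {b}. if k = i then of_bool (i = j) else 0)"
      using ij by (intro sum.cong) (auto simp: rotation_def)
    also have "\<dots> = of_bool (i = j \<and> i \<noteq> a \<and> i \<noteq> b)"
      using ij by (simp add: sum.delta)
    finally show ?thesis
      using ij assms sin_cos_squared_add3[of \<theta>] by (auto simp: rotation_def add.commute)
  qed
  then show ?thesis by (simp add: OG_iff rotation_def)
qed

lemma lie_act_words:
  assumes "X \<in> carrier_mat L L" "u \<in> words L n"
  shows "lie_act X t u = (\<Sum>i<n. \<Sum>a<L. X $$ (u ! i, a) * t (u[i := a]))"
  using assms by (auto simp: lie_act_def words_def)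

text \<open>The product rule for the entries of the tensor power. It serves twice: for rotations, to
  differentiate invariance, and for the line through the identity in direction \<open>X\<close>, to
  show that submodules are stable under \<open>lie_act\<close>.\<close>

lemma grp_act_derivative:
  assumes R: "\<And>\<theta>. R \<theta> \<in> carrier_mat L L" and R0: "R 0 = 1\<^sub>m L" and D: "D \<in> carrier_mat L L"
    and deriv: "\<And>i j. i < L \<Longrightarrow> j < L \<Longrightarrow> ((\<lambda>\<theta>. R \<theta> $$ (i, j)) has_field_derivative D $$ (i, j)) (at 0)"
    and u: "u \<in> words L n"
  shows "((\<lambda>\<theta>. grp_act (R \<theta>) t u) has_field_derivative lie_act D t u) (at 0)"
proof -
  let ?h = "\<lambda>i v. D $$ (u ! i, v ! i) * (\<Prod>j\<in>{..<n} - {i}. R 0 $$ (u ! j, v ! j)) * t v"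
  have "((\<lambda>\<theta>. \<Sum>v\<in>words L n. mprod (R \<theta>) u v * t v) has_field_derivative
      (\<Sum>v\<in>words L n. (\<Sum>i<n. D $$ (u ! i, v ! i) * (\<Prod>j\<in>{..<n} - {i}. R 0 $$ (u ! j, v ! j))) * t v)) (at 0)"
    unfolding mprod_def using u
    by (intro DERIV_sum DERIV_cmult_right has_field_derivative_prod)
      (auto simp: words_length words_nth intro!: deriv has_field_derivative_prod)
  moreover have "(\<Sum>v\<in>words L n. (\<Sum>i<n. D $$ (u ! i, v ! i) * (\<Prod>j\<in>{..<n} - {i}. R 0 $$ (u ! j, v ! j))) * t v) =
      (\<Sum>i<n. \<Sum>v\<in>words L n. ?h i v)"
    by (subst sum.swap) (simp add: sum_distrib_right)
  moreover have "(\<Sum>v\<in>words L n. ?h i v) = (\<Sum>a<L. D $$ (u ! i, a) * t (u[i := a]))" if i: "i < n" for i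
  proof -
    \<comment> \<open>As \<open>R 0\<close> is the identity, all factors except the differentiated
      one are Kronecker deltas, and only words differing from \<open>u\<close> at most at position
      \<open>i\<close> survive.\<close>
    have h: "?h i v = (if v = u[i := v ! i] then D $$ (u ! i, v ! i) * t v else 0)" if v: "v \<in> words L n" for v
    proof -
      have "(\<Prod>j\<in>{..<n} - {i}. R 0 $$ (u ! j, v ! j)) = (\<Prod>j\<in>{..<n} - {i}. of_bool (u ! j = v ! j))"
        using u v by (intro prod.cong) (auto simp: R0 words_nth)
      also have "\<dots> = of_bool (\<forall>j\<in>{..<n} - {i}. u ! j = v ! j)"
        by (auto intro!: prod.neutral prod_zero)
      also have "(\<forall>j\<in>{..<n} - {i}. u ! j = v ! j) \<longleftrightarrow> v = u[i := v ! i]"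
        using u v i
        by (auto simp: list_eq_iff_nth_eq words_length nth_list_update)
      finally show ?thesis by simp
    qed
    have "(\<Sum>v\<in>words L n. ?h i v) = (\<Sum>v\<in>(\<lambda>c. u[i := c]) ` {..<L}. D $$ (u ! i, v ! i) * t v)"
    proof (rule sum.mono_neutral_cong_right)
      show "(\<lambda>c. u[i := c]) ` {..<L} \<subseteq> words L n"
        using u by (auto simp: words_update)
      show "\<forall>v\<in>words L n - (\<lambda>c. u[i := c]) ` {..<L}. ?h i v = 0"
      proof
        fix v assume v: "v \<in> words L n - (\<lambda>c. u[i := c]) ` {..<L}"
        then have "v \<noteq> u[i := v ! i]" using i words_nth[of v L n i] by blast
        then show "?h i v = 0" using v h by simp
      qed
      fix v assume "v \<in> (\<lambda>c. u[i := c]) ` {..<L}"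
      then have "v \<in> words L n" "u[i := v ! i] = v"
        using u i by (auto simp: words_update words_length)
      with h show "?h i v = D $$ (u ! i, v ! i) * t v" by presburger
    qed simp
    also have "\<dots> = (\<Sum>a<L. D $$ (u ! i, a) * t (u[i := a]))"
    proof (subst sum.reindex)
      show "inj_on (\<lambda>c. u[i := c]) {..<L}"
        using u i by (intro inj_onI) (metis nth_list_update_eq words_length)
    qed (use u i in \<open>simp add: words_length\<close>)
    finally show ?thesis .
  qed
  ultimately show ?thesis using D u by (simp add: grp_act_words[OF R u] lie_act_words)
qed

text \<open>The derivative at 0 of the rotations in the plane of two basis vectors.\<close>

lemma OG_invariant_so:
  assumes t: "OG_invariant L n t" and ab: "a < L" "b < L" "a \<noteq> b" and u: "u \<in> words L n"
  shows "(\<Sum>i | i < n \<and> u ! i = a. t (u[i := b])) = (\<Sum>i | i < n \<and> u ! i = b. t (u[i := a]))"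
proof -
  let ?R = "rotation L a b"
  define D where "D = mat L L (\<lambda>(i, j). if i = a \<and> j = b then - 1 else if i = b \<and> j = a then 1 else 0 :: complex)"
  have D: "D \<in> carrier_mat L L" by (simp add: D_def)
  have "((\<lambda>\<theta>. grp_act (?R \<theta>) t u) has_field_derivative lie_act D t u) (at 0)"
  proof (rule grp_act_derivative[OF _ _ D _ u])
    show "((\<lambda>\<theta>. ?R \<theta> $$ (i, j)) has_field_derivative D $$ (i, j)) (at 0)" if "i < L" "j < L" for i j
      using that ab unfolding rotation_def D_def
      by (cases "i = j"; cases "i = a"; cases "i = b"; cases "j = a"; cases "j = b")
        (auto intro!: derivative_eq_intros)
  qed (use ab in \<open>auto simp: rotation_def\<close>)
  moreover have "grp_act (?R \<theta>) t = t" for \<theta>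
    using t rotation_OG[OF ab, of \<theta>] by (simp add: OG_invariant_def)
  ultimately have "((\<lambda>\<theta>. t u) has_field_derivative lie_act D t u) (at 0)"
    by simp
  then have "lie_act D t u = 0"
    by (rule DERIV_unique) (rule DERIV_const)
  also have "lie_act D t u = (\<Sum>i<n. (if u ! i = b then t (u[i := a]) else 0) - (if u ! i = a then t (u[i := b]) else 0))"
    unfolding lie_act_words[OF D u]
  proof (intro sum.cong refl)
    fix i assume "i \<in> {..<n}"
    then have "u ! i < L" using u by (simp add: words_nth)
    then have "(\<Sum>c<L. D $$ (u ! i, c) * t (u[i := c])) =
        (\<Sum>c<L. (if c = b then (if u ! i = a then - t (u[i := b]) else 0) else 0) +
          (if c = a then (if u ! i = b then t (u[i := a]) else 0) else 0))"
      using ab by (intro sum.cong) (auto simp: D_def)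
    also have "\<dots> = (if u ! i = b then t (u[i := a]) else 0) - (if u ! i = a then t (u[i := b]) else 0)"
      using ab by (simp add: sum.distrib)
    finally show "(\<Sum>c<L. D $$ (u ! i, c) * t (u[i := c])) = \<dots>" .
  qed
  also have "\<dots> = (\<Sum>i | i < n \<and> u ! i = b. t (u[i := a])) - (\<Sum>i | i < n \<and> u ! i = a. t (u[i := b]))"
    by (simp add: sum_subtractf sum.If_cases lessThan_def Collect_conj_eq)
  finally show ?thesis by simp
qed

section \<open>Invariant tensors are combinations of pairings\<close>

text \<open>Let \<open>t w \<noteq> 0\<close>, the letter \<open>a\<close> occurring in \<open>w\<close> as often as any letter does in any such word.
  Writing \<open>n\<^sub>b\<close> for the number of \<open>b\<close>'s in \<open>w\<close>, infinitesimal invariance shows that the contractions of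
  \<open>t\<close> at all pairs of positions of \<open>a\<close> add up to \<open>(n\<^sub>a (n\<^sub>a - 1) + \<Sum>\<^sub>b (n\<^sub>a - n\<^sub>b)) t w\<close>. The factor is
  positive, since \<open>n\<^sub>a\<close> is even by invariance under the reflection in coordinate \<open>a\<close>.\<close>

lemma traceless_invariant_eq_0:
  assumes t: "OG_invariant L n t" "t \<in> traceless L n" and n: "n > 0"
  shows "t = 0"
proof (rule ccontr)
  assume "t \<noteq> 0"
  then obtain w0 where w0: "t w0 \<noteq> 0" by (auto simp: fun_eq_iff)
  have space: "t \<in> tensor_space L n" using t(2) by (simp add: traceless_def)
  define cnt where "cnt = (\<lambda>(w :: nat list) c. card {i. i < n \<and> w ! i = c})"
  define S where "S = {w \<in> words L n. t w \<noteq> 0} \<times> {..<L}"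
  have "w0 \<in> words L n" using w0 space by (auto simp: tensor_space_def)
  then have "(w0, w0 ! 0) \<in> S" using w0 n by (auto simp: S_def words_nth)
  then have "case_prod cnt ` S \<noteq> {}" by blast
  moreover have fin_S: "finite (case_prod cnt ` S)" by (simp add: S_def)
  ultimately have "Max (case_prod cnt ` S) \<in> case_prod cnt ` S" by (rule Max_in[rotated])
  then obtain w a where wa: "(w, a) \<in> S" "cnt w a = Max (case_prod cnt ` S)" by force
  have mx: "cnt w' c \<le> cnt w a" if "(w', c) \<in> S" for w' c
  proof -
    have "cnt w' c \<in> case_prod cnt ` S" using that by (rule image_eqI[rotated]) simp
    then show ?thesis unfolding wa(2) using fin_S by (rule Max_ge[rotated])
  qed
  have w: "w \<in> words L n" "t w \<noteq> 0" and a: "a < L" using wa(1) by (auto simp: S_def)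
  have len: "length w = n" using w by (simp add: words_length)
  define I where "I = (\<lambda>c. {i. i < n \<and> w ! i = c})"
  have fin: "finite (I c)" for c by (simp add: I_def)
  have card_I: "card (I c) = cnt w c" for c by (simp add: I_def cnt_def)
  have le: "card (I c) \<le> card (I a)" if "c < L" for c
    using mx[of w c] w that by (simp add: S_def card_I)
  have "0 \<in> I (w ! 0)" using n by (simp add: I_def)
  then have "card (I (w ! 0)) \<ge> 1" using fin[of "w ! 0"] card_gt_0_iff[of "I (w ! 0)"] by auto
  then have "card (I a) \<ge> 1" using le[of "w ! 0"] words_nth[OF w(1) n] by simp
  moreover have "even (card (I a))"
    using OG_invariant_even[OF t(1) w a] by (simp add: I_def)
  ultimately have two: "card (I a) \<ge> 2"
    by (cases "card (I a) = 1") auto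
  have vanish: "t (w[j := a, i := a]) = 0" if "b \<noteq> a" "j \<in> I b" "i \<in> I b" "i \<noteq> j" for b i j
  proof (rule ccontr)
    assume nz: "t (w[j := a, i := a]) \<noteq> 0"
    have "insert i (insert j (I a)) \<subseteq> {l. l < n \<and> w[j := a, i := a] ! l = a}"
      using that len by (auto simp: I_def nth_list_update)
    then have "card (insert i (insert j (I a))) \<le> cnt (w[j := a, i := a]) a"
      unfolding cnt_def by (intro card_mono) auto
    also have "\<dots> \<le> card (I a)"
      using mx[of "w[j := a, i := a]" a] nz w a by (simp add: S_def card_I words_update)
    finally show False using that fin by (auto simp: I_def)
  qed
  \<comment> \<open>Infinitesimal invariance at the word \<open>w[j := a]\<close>. On one side every
    term puts two further letters \<open>a\<close> into \<open>w\<close> and vanishes by maximality;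
    on the other side the term at \<open>j\<close> restores \<open>w\<close>.\<close>
  have swap: "(\<Sum>i\<in>I a. t (w[j := a, i := b])) = - t w" if b: "b \<noteq> a" "b < L" and j: "j \<in> I b" for b j
  proof -
    let ?x = "w[j := a]"
    have "{l. l < n \<and> ?x ! l = a} = insert j (I a)" "{l. l < n \<and> ?x ! l = b} = I b - {j}"
      using b j len by (auto simp: I_def nth_list_update split: if_splits)
    then have "(\<Sum>l\<in>insert j (I a). t (?x[l := b])) = (\<Sum>l\<in>I b - {j}. t (?x[l := a]))"
      using OG_invariant_so[OF t(1) a b(2) b(1)[symmetric] words_update[OF w(1) a, of j]] by simp
    also have "\<dots> = 0"
      using vanish b(1) j by (intro sum.neutral) auto
    also have "(\<Sum>l\<in>insert j (I a). t (?x[l := b])) = t w + (\<Sum>i\<in>I a. t (w[j := a, i := b]))"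
      using b j fin len by (subst sum.insert) (auto simp: I_def)
    finally show ?thesis by (simp add: eq_neg_iff_add_eq_0 add.commute)
  qed
  \<comment> \<open>At \<open>w[i := b]\<close> the same relation replaces the sum over
    \<open>l\<close> by \<open>t w\<close>, the term restoring position \<open>i\<close>, plus one
    term for each element of \<open>I b\<close>. Summed over \<open>i\<close>, the latter are the
    sums evaluated in \<open>swap\<close>.\<close>
  have trace: "(\<Sum>i\<in>I a. \<Sum>l\<in>I a - {i}. t (w[i := b, l := b])) =
      (of_nat (card (I a)) - of_nat (card (I b))) * t w" if b: "b \<noteq> a" "b < L" for b
  proof -
    have "(\<Sum>l\<in>I a - {i}. t (w[i := b, l := b])) = t w + (\<Sum>l\<in>I b. t (w[l := a, i := b]))"
      if i: "i \<in> I a" for i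
    proof -
      let ?x = "w[i := b]"
      have "{l. l < n \<and> ?x ! l = a} = I a - {i}" "{l. l < n \<and> ?x ! l = b} = insert i (I b)"
        using b i len by (auto simp: I_def nth_list_update split: if_splits)
      then have "(\<Sum>l\<in>I a - {i}. t (?x[l := b])) = (\<Sum>l\<in>insert i (I b). t (?x[l := a]))"
        using OG_invariant_so[OF t(1) a b(2) b(1)[symmetric] words_update[OF w(1) b(2), of i]] by simp
      also have "\<dots> = t w + (\<Sum>l\<in>I b. t (?x[l := a]))"
        using b i fin len by (subst sum.insert) (auto simp: I_def)
      also have "(\<Sum>l\<in>I b. t (?x[l := a])) = (\<Sum>l\<in>I b. t (w[l := a, i := b]))"
        using b i by (intro sum.cong) (auto simp: I_def intro!: arg_cong[of _ _ t] list_update_swap)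
      finally show ?thesis .
    qed
    then have "(\<Sum>i\<in>I a. \<Sum>l\<in>I a - {i}. t (w[i := b, l := b])) =
        of_nat (card (I a)) * t w + (\<Sum>i\<in>I a. \<Sum>l\<in>I b. t (w[l := a, i := b]))"
      by (simp add: sum.distrib)
    also have "(\<Sum>i\<in>I a. \<Sum>l\<in>I b. t (w[l := a, i := b])) = (\<Sum>l\<in>I b. - t w)"
      by (subst sum.swap) (simp add: swap b)
    finally show ?thesis by (simp add: algebra_simps)
  qed
  have same: "(\<Sum>i\<in>I a. \<Sum>l\<in>I a - {i}. t (w[i := a, l := a])) =
      of_nat (card (I a)) * of_nat (card (I a) - 1) * t w"
  proof -
    have "(\<Sum>l\<in>I a - {i}. t (w[i := a, l := a])) = of_nat (card (I a) - 1) * t w" if i: "i \<in> I a" for i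
    proof -
      have id: "w[k := a] = w" if "k \<in> I a" for k
        using that list_update_id[of w k] by (simp add: I_def)
      have "w[i := a, l := a] = w" if "l \<in> I a" for l
        using id[OF i] id[OF that] by simp
      then show ?thesis using i fin by simp
    qed
    then show ?thesis by simp
  qed
  define r where "r = real (card (I a)) * real (card (I a) - 1) +
    (\<Sum>b\<in>{..<L} - {a}. real (card (I a)) - real (card (I b)))"
  have "0 = (\<Sum>i\<in>I a. \<Sum>l\<in>I a - {i}. \<Sum>b<L. t (w[i := b, l := b]))"
    using t(2) w(1) by (intro sum.neutral[symmetric] ballI) (auto simp: traceless_def I_def)
  also have "\<dots> = (\<Sum>i\<in>I a. \<Sum>b<L. \<Sum>l\<in>I a - {i}. t (w[i := b, l := b]))"
    by (intro sum.cong refl sum.swap)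
  also have "\<dots> = (\<Sum>b<L. \<Sum>i\<in>I a. \<Sum>l\<in>I a - {i}. t (w[i := b, l := b]))"
    by (rule sum.swap)
  also have "\<dots> = of_real r * t w"
    using a by (subst sum.remove[of _ a])
      (auto simp: same trace r_def distrib_right sum_distrib_right)
  finally have "r = 0" using w(2) by simp
  moreover have "real (card (I a)) * real (card (I a) - 1) > 0" using two by simp
  moreover have "(\<Sum>b\<in>{..<L} - {a}. real (card (I a)) - real (card (I b))) \<ge> 0"
    using le by (intro sum_nonneg) auto
  ultimately show False unfolding r_def by linarith
qed

text \<open>The coordinates of a tensor power of the invariant form, pairing each even position with
  the next one. The value 0 in odd length lets odd degrees be treated like even ones.\<close>

fun std_pairing :: "nat list \<Rightarrow> complex" where
  "std_pairing [] = 1"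
| "std_pairing [a] = 0"
| "std_pairing (a # b # u) = (if a = b then std_pairing u else 0)"

text \<open>Varying \<open>\<sigma>\<close> produces all perfect matchings of the positions, in
  general each of them several times.\<close>

definition pairing :: "nat \<Rightarrow> nat \<Rightarrow> (nat \<Rightarrow> nat) \<Rightarrow> tensor" where
  "pairing L n \<sigma> = (\<lambda>w. if w \<in> words L n then std_pairing (permute_list \<sigma> w) else 0)"

lemma cnj_std_pairing [simp]: "cnj (std_pairing w) = std_pairing w"
  by (induction w rule: std_pairing.induct) auto

text \<open>Two letters at a time, the sum over a pair of equal column letters is a product of two
  rows of \<open>A\<close>, and the rows are orthonormal.\<close>

lemma sum_mprod_std_pairing:
  assumes "A \<in> OG L" "w \<in> words L n"
  shows "(\<Sum>v\<in>words L n. mprod A w v * std_pairing v) = std_pairing w"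
  using assms(2)
proof (induction w arbitrary: n rule: std_pairing.induct)
  case 1
  then have "n = 0" by (simp add: words_def)
  then show ?case by (simp add: words_0)
next
  case (2 a)
  then have "n = Suc 0" by (simp add: words_def)
  then show ?case by (simp add: sum_words_Suc words_0)
next
  case (3 a b u)
  then obtain m where n: "n = Suc (Suc m)" by (auto simp: words_def)
  with 3 have ab: "a < L" "b < L" and u: "u \<in> words L m" by (auto simp: Cons_in_words)
  have "(\<Sum>v\<in>words L n. mprod A (a # b # u) v * std_pairing v) =
      (\<Sum>c<L. \<Sum>d<L. if d = c then A $$ (a, c) * A $$ (b, c) * (\<Sum>v\<in>words L m. mprod A u v * std_pairing v) else 0)"
    unfolding n sum_words_Suc by (intro sum.cong refl) (auto simp: sum_distrib_left mult_ac)
  also have "\<dots> = (\<Sum>c<L. A $$ (a, c) * A $$ (b, c)) * (\<Sum>v\<in>words L m. mprod A u v * std_pairing v)"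
    by (simp add: sum_distrib_right)
  also have "\<dots> = std_pairing (a # b # u)"
  proof (cases "a = b")
    case True
    then show ?thesis using 3(1)[OF True u] OG_rows[OF assms(1) ab] by simp
  next
    case False
    then show ?thesis using OG_rows[OF assms(1) ab] by simp
  qed
  finally show ?case .
qed

lemma pairing_in_space: "pairing L n \<sigma> \<in> tensor_space L n"
  by (simp add: pairing_def tensor_space_def)

lemma pairing_invariant:
  assumes "\<sigma> permutes {..<n}"
  shows "OG_invariant L n (pairing L n \<sigma>)"
proof -
  have "OG_invariant L n (pairing L n (\<lambda>i. i))"
    unfolding OG_invariant_def
  proof (intro conjI ballI)
    fix A assume A: "A \<in> OG L"
    show "grp_act A (pairing L n (\<lambda>i. i)) = pairing L n (\<lambda>i. i)"
    proof (rule tensor_eqI[OF grp_act_in_space[OF OG_carrier[OF A] pairing_in_space] pairing_in_space])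
      fix w assume "w \<in> words L n"
      then show "grp_act A (pairing L n (\<lambda>i. i)) w = pairing L n (\<lambda>i. i) w"
        using sum_mprod_std_pairing[OF A] by (simp add: grp_act_words[OF OG_carrier[OF A]] pairing_def)
    qed
  qed (rule pairing_in_space)
  from OG_invariant_permute[OF this assms] show ?thesis
    using assms by (simp add: pairing_def words_permute_list cong: if_cong)
qed

text \<open>A contraction of \<open>t\<close> at two positions is invariant of degree two less, and
  it is orthogonal to all pairings, because summing it against one is summing \<open>t\<close>
  against that pairing with the contracted positions added as a pair. By induction all contractions
  vanish, so \<open>t\<close> is traceless and \<open>traceless_invariant_eq_0\<close>
  applies.\<close>

lemma invariant_orthogonal_pairings_eq_0:
  assumes "OG_invariant L n t"
    and "\<And>\<sigma>. \<sigma> permutes {..<n} \<Longrightarrow> (\<Sum>w\<in>words L n. std_pairing (permute_list \<sigma> w) * t w) = 0"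
  shows "t = 0"
  using assms
proof (induction n arbitrary: t rule: less_induct)
  case (less n)
  note inv = less.prems(1) and orth = less.prems(2)
  have space: "t \<in> tensor_space L n" using inv by (simp add: OG_invariant_def)
  show ?case
  proof (cases "n = 0")
    case True
    then have "t [] = 0" using orth[of "\<lambda>i. i"] permutes_id[of "{..<n}"] by (simp add: words_0 id_def)
    then show ?thesis using space True
      by (auto intro!: tensor_eqI[of _ L n] simp: tensor_space_def words_0)
  next
    case False
    have "(\<Sum>a<L. t (w[i := a, j := a])) = 0"
      if ij: "i < n" "j < n" "i \<noteq> j" and w: "w \<in> words L n" for i j w
    proof -
      obtain m where m: "n = Suc (Suc m)" using ij by (cases n; cases "n - 1") auto
      \<comment> \<open>A permutation \<open>\<rho>\<close> with \<open>\<rho> 0 = i\<close> and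
        \<open>\<rho> 1 = j\<close> brings the contracted positions to the front. \<open>j'\<close>
        is the place of \<open>j\<close> after the exchange of 0 and \<open>i\<close>; it is not 0
        since \<open>i \<noteq> j\<close>, so exchanging 1 and \<open>j'\<close> leaves 0
        alone.\<close>
      define j' where "j' = Transposition.transpose 0 i j"
      define \<rho> where "\<rho> = Transposition.transpose 0 i \<circ> Transposition.transpose 1 j'"
      define \<tau> where "\<tau> = inv_into UNIV \<rho>"
      have j': "j' \<noteq> 0" "j' < n" using ij by (auto simp: j'_def Transposition.transpose_def)
      have \<rho>: "\<rho> permutes {..<n}"
        unfolding \<rho>_def using ij j' m by (intro permutes_compose permutes_swap_id) auto
      have \<tau>: "\<tau> permutes {..<n}" unfolding \<tau>_def using \<rho> by (rule permutes_inv)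
      have \<rho>01: "\<rho> 0 = i" "\<rho> 1 = j"
        using j' by (simp_all add: \<rho>_def j'_def)
      define t' where "t' = (\<lambda>w. t (permute_list \<tau> w))"
      have t': "OG_invariant L n t'" unfolding t'_def using inv \<tau> by (rule OG_invariant_permute)
      define \<chi> where "\<chi> = (\<lambda>u. if u \<in> words L m then \<Sum>a<L. t' (a # a # u) else 0)"
      have \<chi>_space: "\<chi> \<in> tensor_space L m" by (simp add: \<chi>_def tensor_space_def)
      have "OG_invariant L m \<chi>"
        unfolding OG_invariant_def
      proof (intro conjI ballI \<chi>_space)
        fix A assume A: "A \<in> OG L"
        note Ac = OG_carrier[OF A]
        show "grp_act A \<chi> = \<chi>"
        proof (rule tensor_eqI[OF grp_act_in_space[OF Ac \<chi>_space] \<chi>_space])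
          fix u assume u: "u \<in> words L m"
          have orthA: "(\<Sum>a<L. A $$ (a, c) * A $$ (a, d)) = of_bool (c = d)" if "c < L" "d < L" for c d
            using A that by (simp add: OG_iff)
          have "\<chi> u = (\<Sum>a<L. t' (a # a # u))" using u by (simp add: \<chi>_def)
          \<comment> \<open>After inserting invariance, the sum over \<open>a\<close> meets only the
            entries of \<open>A\<close> for the first two letters, and orthonormality of the columns
            turns it back into a contraction.\<close>
          also have "\<dots> = (\<Sum>a<L. grp_act A t' (a # a # u))"
            using t' A by (simp add: OG_invariant_def)
          also have "\<dots> = (\<Sum>a<L. \<Sum>c<L. \<Sum>d<L. A $$ (a, c) * A $$ (a, d) *
              (\<Sum>v\<in>words L m. mprod A u v * t' (c # d # v)))"
            using u m by (intro sum.cong refl)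
              (simp add: grp_act_words[OF Ac, of _ n] Cons_in_words sum_words_Suc sum_distrib_left mult_ac)
          also have "\<dots> = (\<Sum>c<L. \<Sum>d<L. (\<Sum>a<L. A $$ (a, c) * A $$ (a, d)) *
              (\<Sum>v\<in>words L m. mprod A u v * t' (c # d # v)))"
            by (subst sum.swap, rule sum.cong[OF refl], subst sum.swap) (simp add: sum_distrib_right)
          also have "\<dots> = (\<Sum>c<L. \<Sum>d<L. if d = c then \<Sum>v\<in>words L m. mprod A u v * t' (c # c # v) else 0)"
            by (intro sum.cong refl) (auto simp: orthA)
          also have "\<dots> = (\<Sum>c<L. \<Sum>v\<in>words L m. mprod A u v * t' (c # c # v))"
            by simp
          also have "\<dots> = grp_act A \<chi> u"
            by (subst sum.swap) (simp add: grp_act_words[OF Ac u] \<chi>_def sum_distrib_left)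
          finally show "grp_act A \<chi> u = \<chi> u" by simp
        qed
      qed
      moreover have "(\<Sum>u\<in>words L m. std_pairing (permute_list \<sigma> u) * \<chi> u) = 0"
        if \<sigma>: "\<sigma> permutes {..<m}" for \<sigma>
      proof -
        \<comment> \<open>Fixing 0 and 1 and shifting \<open>\<sigma>\<close> by two adds the pair
          of the first two positions to the matching.\<close>
        define \<sigma>' where "\<sigma>' = (\<lambda>i. if i < 2 then i else \<sigma> (i - 2) + 2)"
        have "bij_betw \<sigma>' {..<n} {..<n}"
        proof (intro bij_betw_byWitness[where f' = "\<lambda>i. if i < 2 then i else inv_into UNIV \<sigma> (i - 2) + 2"] ballI image_subsetI)
          fix i assume i: "i \<in> {..<n}"
          show "(if \<sigma>' i < 2 then \<sigma>' i else inv_into UNIV \<sigma> (\<sigma>' i - 2) + 2) = i"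
            by (auto simp: \<sigma>'_def permutes_inverses[OF \<sigma>])
          show "\<sigma>' (if i < 2 then i else inv_into UNIV \<sigma> (i - 2) + 2) = i"
            by (auto simp: \<sigma>'_def permutes_inverses[OF \<sigma>])
          have "i - 2 \<in> {..<m}" if "\<not> i < 2" using i that m by auto
          then show "\<sigma>' i \<in> {..<n}" "(if i < 2 then i else inv_into UNIV \<sigma> (i - 2) + 2) \<in> {..<n}"
            using i m permutes_in_image[OF \<sigma>, of "i - 2"] permutes_in_image[OF permutes_inv[OF \<sigma>], of "i - 2"]
            by (auto simp: \<sigma>'_def)
        qed
        moreover have "\<sigma>' i = i" if "i \<notin> {..<n}" for i
          using that m permutes_not_in[OF \<sigma>, of "i - 2"] by (auto simp: \<sigma>'_def)
        ultimately have \<sigma>': "\<sigma>' permutes {..<n}" by (intro bij_imp_permutes)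
        have lift: "permute_list \<sigma>' (a # b # u) = a # b # permute_list \<sigma> u" if "length u = m" for a b u
        proof (rule nth_equalityI)
          fix k assume "k < length (permute_list \<sigma>' (a # b # u))"
          then have k: "k < n" using that m by simp
          have p: "permute_list \<sigma>' (a # b # u) ! k = (a # b # u) ! \<sigma>' k"
            using k that m \<sigma>' by (simp add: permute_list_nth)
          consider "k = 0" | "k = 1" | l where "k = l + 2" "l < m"
            using k m that(1,2) that(3)[of "k - 2"] less_2_cases[of k] by (cases "k < 2") auto
          then show "permute_list \<sigma>' (a # b # u) ! k = (a # b # permute_list \<sigma> u) ! k"
            unfolding p using that \<sigma> by cases (simp_all add: \<sigma>'_def permute_list_nth)
        qed simp
        have "(\<Sum>u\<in>words L m. std_pairing (permute_list \<sigma> u) * \<chi> u) =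
            (\<Sum>a<L. \<Sum>u\<in>words L m. std_pairing (permute_list \<sigma> u) * t' (a # a # u))"
          by (subst sum.swap) (simp add: \<chi>_def sum_distrib_left)
        also have "\<dots> = (\<Sum>a<L. \<Sum>b<L. \<Sum>u\<in>words L m. if b = a then std_pairing (permute_list \<sigma> u) * t' (a # a # u) else 0)"
          by (intro sum.cong refl) (subst sum.swap, simp)
        also have "\<dots> = (\<Sum>w\<in>words L n. std_pairing (permute_list \<sigma>' w) * t' w)"
          unfolding m sum_words_Suc by (intro sum.cong refl) (auto simp: lift words_length)
        also have "\<dots> = (\<Sum>w\<in>words L n. std_pairing (permute_list \<sigma>' (permute_list \<rho> (permute_list \<tau> w))) * t (permute_list \<tau> w))"
        proof (intro sum.cong refl)
          fix w assume "w \<in> words L n"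
          then have "permute_list \<rho> (permute_list \<tau> w) = w"
            using permute_list_compose[of \<rho> w \<tau>] \<rho> permutes_inv_o(2)[OF \<rho>] by (simp add: words_length \<tau>_def)
          then show "std_pairing (permute_list \<sigma>' w) * t' w =
              std_pairing (permute_list \<sigma>' (permute_list \<rho> (permute_list \<tau> w))) * t (permute_list \<tau> w)"
            by (simp add: t'_def)
        qed
        also have "\<dots> = (\<Sum>w\<in>words L n. std_pairing (permute_list \<sigma>' (permute_list \<rho> w)) * t w)"
          by (rule sum_words_permute[OF \<tau>])
        also have "\<dots> = (\<Sum>w\<in>words L n. std_pairing (permute_list (\<rho> \<circ> \<sigma>') w) * t w)"
          using \<sigma>' by (intro sum.cong refl) (simp add: permute_list_compose words_length)
        also have "\<dots> = 0"
          using \<rho> \<sigma>' by (intro orth permutes_compose)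
        finally show ?thesis .
      qed
      moreover have "m < n" using m by simp
      ultimately have \<chi>0: "\<chi> = 0" using less.IH[of m \<chi>] by blast
      define u where "u = drop 2 (permute_list \<rho> w)"
      have u: "u \<in> words L m"
        using w \<rho> m words_permute_list[OF \<rho>, of w L] set_drop_subset[of 2 "permute_list \<rho> w"]
        by (auto simp: u_def words_def)
      have "t (w[i := a, j := a]) = t' (a # a # u)" if "a < L" for a
      proof -
        let ?w = "w[i := a, j := a]"
        have len: "length w = n" using w by (rule words_length)
        have "permute_list \<rho> ?w = a # a # u"
        proof (rule nth_equalityI)
          fix k assume "k < length (permute_list \<rho> ?w)"
          then have k: "k < n" using len by simp
          have p: "permute_list \<rho> ?w ! k = ?w ! \<rho> k"
            using k len \<rho> by (simp add: permute_list_nth)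
          consider "k = 0" | "k = 1" | l where "k = l + 2" "l < m"
            using k m that(1,2) that(3)[of "k - 2"] less_2_cases[of k] by (cases "k < 2") auto
          then show "permute_list \<rho> ?w ! k = (a # a # u) ! k"
          proof cases
            case 3
            then have "\<rho> k \<noteq> i" "\<rho> k \<noteq> j"
              unfolding \<rho>01[symmetric] inj_eq[OF permutes_inj[OF \<rho>]] by simp_all
            then show ?thesis
              unfolding p using 3 len \<rho> k by (simp add: u_def permute_list_nth)
          qed (use p \<rho>01 ij len in \<open>simp_all add: nth_list_update\<close>)
        qed (use len m in \<open>simp add: u_def\<close>)
        moreover have "permute_list \<tau> (permute_list \<rho> ?w) = ?w"
          using permute_list_compose[of \<tau> ?w \<rho>] \<tau> permutes_inv_o(1)[OF \<rho>] len by (simp add: \<tau>_def)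
        ultimately show ?thesis by (simp add: t'_def)
      qed
      then have "(\<Sum>a<L. t (w[i := a, j := a])) = \<chi> u" using u by (simp add: \<chi>_def)
      then show ?thesis using \<chi>0 by simp
    qed
    then have "t \<in> traceless L n" using space by (simp add: traceless_def)
    with inv False show ?thesis using traceless_invariant_eq_0 by blast
  qed
qed

text \<open>The first fundamental theorem for the orthogonal group. Subtracting the orthogonal
  projection to the span of the pairings leaves an invariant tensor orthogonal to all of them.
  Pairings have real coordinates, so Hermitian and bilinear orthogonality to them agree.\<close>

theorem invariant_in_span_pairings:
  assumes "OG_invariant L n t"
  shows "t \<in> tensor.span (pairing L n ` {\<sigma>. \<sigma> permutes {..<n}})" (is "_ \<in> ?D")
proof -
  have "?D \<subseteq> tensor_space L n"
    by (intro tensor.span_minimal tensor_subspace_space) (auto simp: pairing_in_space)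
  then obtain d where d: "d \<in> ?D" "\<And>y. y \<in> ?D \<Longrightarrow> ip L n (t - d) y = 0"
    using orthogonal_decomposition[OF tensor.subspace_span, of _ L n t] by blast
  have "?D \<subseteq> {t. OG_invariant L n t}"
    by (intro tensor.span_minimal OG_invariant_subspace) (auto simp: pairing_invariant)
  with d(1) assms have "OG_invariant L n (t - d)"
    using tensor.subspace_diff[OF OG_invariant_subspace[of L n]] by blast
  moreover have "(\<Sum>w\<in>words L n. std_pairing (permute_list \<sigma> w) * (t - d) w) = 0"
    if "\<sigma> permutes {..<n}" for \<sigma>
  proof -
    have "ip L n (t - d) (pairing L n \<sigma>) = 0"
      using that by (intro d(2) tensor.span_base) auto
    then show ?thesis by (simp add: ip_def pairing_def mult.commute)
  qed
  ultimately have "t - d = 0" by (rule invariant_orthogonal_pairings_eq_0)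
  with d(1) show ?thesis by simp
qed

section \<open>Equivariant maps out of traceless tensors\<close>

lemma mprod_transpose:
  assumes "A \<in> carrier_mat L L" "v \<in> words L n" "w \<in> words L n"
  shows "mprod A\<^sup>T v w = mprod A w v"
  using assms unfolding mprod_def by (intro prod.cong) (auto simp: words_length words_nth)

lemma mprod_conj:
  assumes "A \<in> carrier_mat L L" "v \<in> words L n" "w \<in> words L n"
  shows "mprod (map_mat cnj A) v w = cnj (mprod A v w)"
  using assms by (auto simp: mprod_def words_length words_nth intro!: prod.cong)

lemma ip_grp_act:
  assumes A: "A \<in> carrier_mat L L"
  shows "ip L n (grp_act A x) y = ip L n x (grp_act (map_mat cnj A\<^sup>T) y)"
proof -
  have A': "map_mat cnj A\<^sup>T \<in> carrier_mat L L" using A by simp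
  have "ip L n (grp_act A x) y = (\<Sum>w\<in>words L n. \<Sum>v\<in>words L n. mprod A w v * x v * cnj (y w))"
    by (simp add: ip_def grp_act_words[OF A] sum_distrib_right)
  also have "\<dots> = (\<Sum>v\<in>words L n. \<Sum>w\<in>words L n. x v * cnj (mprod (map_mat cnj A\<^sup>T) v w * y w))"
    using A by (subst sum.swap) (simp add: mprod_conj mprod_transpose mult_ac)
  also have "\<dots> = ip L n x (grp_act (map_mat cnj A\<^sup>T) y)"
    by (simp add: ip_def grp_act_words[OF A'] sum_distrib_left)
  finally show ?thesis .
qed

lemma linear_map_on_0:
  assumes "linear_map_on tscale tscale V U f" "tensor.subspace V"
  shows "f 0 = 0"
proof -
  have "f (tscale 0 0) = tscale 0 (f 0)"
    using assms tensor.subspace_0 unfolding linear_map_on_def by blast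
  then show ?thesis by (simp only: tensor.scale_zero_left)
qed

text \<open>The orthogonal projection commutes with the group because the adjoint of an orthogonal
  matrix is orthogonal and hence maps \<open>W\<close> to itself. This substitutes for a complement
  of \<open>W\<close>.\<close>

lemma equivariant_projection:
  assumes W: "tensor.subspace W" "W \<subseteq> tensor_space M m"
    and inv: "\<And>A t. A \<in> OG M \<Longrightarrow> t \<in> W \<Longrightarrow> grp_act A t \<in> W"
  obtains P where "\<And>x. P x \<in> W" "\<And>x y. P (x + y) = P x + P y" "\<And>c x. P (tscale c x) = tscale c (P x)"
    "\<And>t. t \<in> W \<Longrightarrow> P t = t" "\<And>A x. A \<in> OG M \<Longrightarrow> P (grp_act A x) = grp_act A (P x)"
proof -
  obtain P where P: "\<And>x. P x \<in> W" "\<And>x y. y \<in> W \<Longrightarrow> ip M m (x - P x) y = 0"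
    using orthogonal_decomposition[OF W] by metis
  \<comment> \<open>Definiteness makes the projection unique. Each property of \<open>P\<close> is
    then checked by showing that the candidate lies in \<open>W\<close> and differs from the
    argument by something orthogonal to \<open>W\<close>.\<close>
  have uniq: "P x = u" if u: "u \<in> W" "\<And>y. y \<in> W \<Longrightarrow> ip M m (x - u) y = 0" for x u
  proof -
    have d: "u - P x \<in> W" using W(1) u(1) P(1) by (rule tensor.subspace_diff)
    have "u - P x = (x - P x) - (x - u)" by simp
    then have "ip M m (u - P x) (u - P x) = ip M m (x - P x) (u - P x) - ip M m (x - u) (u - P x)"
      by (metis ip_diff_left)
    also have "\<dots> = 0" unfolding P(2)[OF d] u(2)[OF d] by simp
    finally have "u - P x = 0" using ip_self_eq_0D d W(2) by blast
    then show ?thesis by simp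
  qed
  show thesis
  proof (rule that)
    show "P x \<in> W" for x by (rule P(1))
    show "P (x + y) = P x + P y" for x y
    proof (rule uniq)
      show "P x + P y \<in> W" using W(1) P(1) by (intro tensor.subspace_add)
      fix z assume z: "z \<in> W"
      have eq: "(x + y) - (P x + P y) = (x - P x) + (y - P y)" by simp
      show "ip M m ((x + y) - (P x + P y)) z = 0"
        unfolding eq ip_add_left P(2)[OF z] by simp
    qed
    show "P (tscale c x) = tscale c (P x)" for c x
    proof (rule uniq)
      show "tscale c (P x) \<in> W" using W(1) P(1) by (intro tensor.subspace_scale)
      fix z assume z: "z \<in> W"
      show "ip M m (tscale c x - tscale c (P x)) z = 0"
        unfolding tensor.scale_right_diff_distrib[symmetric] ip_scale_left P(2)[OF z] by simp
    qed
    show "P t = t" if "t \<in> W" for t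
      using that by (intro uniq) (simp_all add: ip_def)
    show "P (grp_act A x) = grp_act A (P x)" if A: "A \<in> OG M" for A x
    proof (rule uniq)
      show "grp_act A (P x) \<in> W" using inv A P(1) by simp
      fix z assume z: "z \<in> W"
      have "map_mat cnj A\<^sup>T \<in> OG M" using A by (intro OG_conj OG_transpose)
      then have z': "grp_act (map_mat cnj A\<^sup>T) z \<in> W" using inv z by simp
      show "ip M m (grp_act A x - grp_act A (P x)) z = 0"
        unfolding grp_act_diff[symmetric] ip_grp_act[OF OG_carrier[OF A]] P(2)[OF z'] ..
    qed
  qed
qed

text \<open>Composition with the projection extends \<open>g\<close> to all tensors of degree
  \<open>m\<close>. The matrix of the extension, read as a tensor of degree \<open>k + m\<close>, is
  invariant since the invariant form identifies the tensor space with its dual. This brings maps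
  under the theorem on invariant tensors.\<close>

lemma equivariant_map_kernel:
  assumes W: "tensor.subspace W" "W \<subseteq> tensor_space M m"
    and inv: "\<And>A t. A \<in> OG M \<Longrightarrow> t \<in> W \<Longrightarrow> grp_act A t \<in> W"
    and lin: "linear_map_on tscale tscale W (tensor_space M k) g"
    and equi: "\<And>A t. A \<in> OG M \<Longrightarrow> t \<in> W \<Longrightarrow> g (grp_act A t) = grp_act A (g t)"
  obtains \<phi> where "OG_invariant M (k + m) \<phi>"
    "\<And>t w. t \<in> W \<Longrightarrow> w \<in> words M k \<Longrightarrow> g t w = (\<Sum>v\<in>words M m. \<phi> (w @ v) * t v)"
proof -
  obtain P where P: "\<And>x. P x \<in> W" "\<And>x y. P (x + y) = P x + P y" "\<And>c x. P (tscale c x) = tscale c (P x)"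
    "\<And>t. t \<in> W \<Longrightarrow> P t = t" "\<And>A x. A \<in> OG M \<Longrightarrow> P (grp_act A x) = grp_act A (P x)"
    by (rule equivariant_projection[OF W], (rule inv; assumption), (rule that; assumption))
  define G where "G = (\<lambda>x. g (P x))"
  have G_add: "G (x + y) = G x + G y" for x y
    using lin P(1) by (simp add: G_def P(2) linear_map_on_def)
  have G_scale: "G (tscale c x) = tscale c (G x)" for c x
    using lin P(1) by (simp add: G_def P(3) linear_map_on_def)
  have G_zero: "G 0 = 0"
    unfolding G_def P(4)[OF tensor.subspace_0[OF W(1)]] by (rule linear_map_on_0[OF lin W(1)])
  have G_sum: "G (\<Sum>i\<in>I. tscale (c i) (x i)) = (\<Sum>i\<in>I. tscale (c i) (G (x i)))"
    for I :: "nat list set" and c x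
  proof (induction I rule: infinite_finite_induct)
    case (infinite I)
    show ?case unfolding sum.infinite[OF infinite] by (rule G_zero)
  next
    case empty
    show ?case unfolding sum.empty by (rule G_zero)
  next
    case (insert i I)
    show ?case unfolding sum.insert[OF insert(1,2)] G_add G_scale insert(3) ..
  qed
  have G_space: "G x \<in> tensor_space M k" for x
    using lin P(1) by (auto simp: G_def linear_map_on_def)
  have G_act: "G (grp_act A x) = grp_act A (G x)" if "A \<in> OG M" for A x
    using that by (simp add: G_def P(5) equi P(1))
  \<comment> \<open>The first \<open>k\<close> letters index the value, the last \<open>m\<close>
    letters the argument.\<close>
  define \<phi> where "\<phi> = (\<lambda>x. if x \<in> words M (k + m) then G (unit_tensor (drop k x)) (take k x) else 0)"
  have \<phi>: "\<phi> (w @ v) = G (unit_tensor v) w" if "w \<in> words M k" "v \<in> words M m" for w v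
    using that by (simp add: \<phi>_def words_append words_length)
  show thesis
  proof (rule that)
    show "OG_invariant M (k + m) \<phi>"
      unfolding OG_invariant_def
    proof (intro conjI ballI)
      show sp: "\<phi> \<in> tensor_space M (k + m)" by (simp add: \<phi>_def tensor_space_def)
      fix A assume A: "A \<in> OG M"
      note Ac = OG_carrier[OF A]
      show "grp_act A \<phi> = \<phi>"
      proof (rule tensor_eqI[OF grp_act_in_space[OF Ac sp] sp])
        fix x assume x: "x \<in> words M (k + m)"
        define w v where "w = take k x" and "v = drop k x"
        have wv: "x = w @ v" "w \<in> words M k" "v \<in> words M m"
          using x set_take_subset[of k x] set_drop_subset[of k x] by (auto simp: w_def v_def words_def)
        \<comment> \<open>The tensor power of \<open>A * A\<^sup>T = 1\<^sub>m M\<close> in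
          coordinates; it moves the action on the argument letters of the kernel into the argument
          of \<open>G\<close>.\<close>
        have e: "(\<Sum>v'\<in>words M m. tscale (mprod A v v') (grp_act A (unit_tensor v'))) = unit_tensor v"
        proof (rule tensor_eqI)
          show "(\<Sum>v'\<in>words M m. tscale (mprod A v v') (grp_act A (unit_tensor v'))) \<in> tensor_space M m"
            using Ac by (intro tensor.subspace_sum tensor.subspace_scale tensor_subspace_space
                grp_act_in_space unit_tensor_in_space)
          show "unit_tensor v \<in> tensor_space M m" using wv by (simp add: unit_tensor_in_space)
          fix y assume y: "y \<in> words M m"
          have "(\<Sum>v'\<in>words M m. tscale (mprod A v v') (grp_act A (unit_tensor v'))) y =
              (\<Sum>v'\<in>words M m. mprod A v v' * mprod A\<^sup>T v' y)"
            unfolding sum_tensor_apply tscale_def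
          proof (intro sum.cong refl arg_cong2[of _ _ _ _ "(*)"])
            fix v' assume v': "v' \<in> words M m"
            have "grp_act A (unit_tensor v') y = (\<Sum>z\<in>words M m. if z = v' then mprod A y z else 0)"
              unfolding grp_act_words[OF Ac y] unit_tensor_def by (intro sum.cong) auto
            also have "\<dots> = mprod A\<^sup>T v' y"
              using v' y Ac by (simp add: mprod_transpose)
            finally show "grp_act A (unit_tensor v') y = mprod A\<^sup>T v' y" .
          qed
          also have "\<dots> = mprod (A * A\<^sup>T) v y"
            using Ac wv(3) y by (intro mprod_mult) auto
          also have "\<dots> = unit_tensor v y"
            unfolding OG_mult_transpose[OF A] mprod_one[OF wv(3) y] by (auto simp: unit_tensor_def)
          finally show "(\<Sum>v'\<in>words M m. tscale (mprod A v v') (grp_act A (unit_tensor v'))) y = unit_tensor v y" .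
        qed
        have "grp_act A \<phi> x = (\<Sum>w'\<in>words M k. \<Sum>v'\<in>words M m. mprod A v v' * (mprod A w w' * G (unit_tensor v') w'))"
          unfolding grp_act_words[OF Ac x] sum_words_add
          using wv by (intro sum.cong refl) (simp add: mprod_append words_length \<phi>)
        also have "\<dots> = (\<Sum>v'\<in>words M m. mprod A v v' * grp_act A (G (unit_tensor v')) w)"
          by (subst sum.swap) (simp add: grp_act_words[OF Ac wv(2)] sum_distrib_left)
        also have "\<dots> = (\<Sum>v'\<in>words M m. tscale (mprod A v v') (G (grp_act A (unit_tensor v')))) w"
          by (simp add: sum_tensor_apply tscale_def G_act[OF A])
        also have "\<dots> = G (unit_tensor v) w"
          unfolding G_sum[symmetric] e ..
        also have "\<dots> = \<phi> x" using \<phi> wv by simp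
        finally show "grp_act A \<phi> x = \<phi> x" .
      qed
    qed
    fix t w assume t: "t \<in> W" and w: "w \<in> words M k"
    have "g t = G t" using t P(4) by (simp add: G_def)
    also have "\<dots> = G (\<Sum>v\<in>words M m. tscale (t v) (unit_tensor v))"
      using tensor_expansion[of t M m] t W(2) by auto
    finally have "g t w = (\<Sum>v\<in>words M m. tscale (t v) (G (unit_tensor v))) w"
      by (simp only: G_sum)
    then show "g t w = (\<Sum>v\<in>words M m. \<phi> (w @ v) * t v)"
      using w by (simp add: sum_tensor_apply tscale_def \<phi> mult.commute)
  qed
qed

section \<open>Pairings as fixed-point-free involutions of the positions\<close>

definition flip :: "nat \<Rightarrow> nat" where
  "flip i = (if even i then Suc i else i - 1)"

lemma flip_Suc_Suc: "flip (Suc (Suc i)) = Suc (Suc (flip i))"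
  by (cases i) (auto simp: flip_def)

lemma flip_props: "flip i \<noteq> i" "flip (flip i) = i" "even n \<Longrightarrow> i < n \<Longrightarrow> flip i < n"
  by (auto simp: flip_def elim!: evenE oddE)

lemma std_pairing_even:
  "even (length w) \<Longrightarrow> std_pairing w = of_bool (\<forall>i<length w. w ! flip i = w ! i)"
  by (induction w rule: std_pairing.induct)
    (auto simp: All_less_Suc2 flip_Suc_Suc, auto simp: flip_def)

lemma std_pairing_odd: "odd (length w) \<Longrightarrow> std_pairing w = 0"
  by (induction w rule: std_pairing.induct) auto

text \<open>The matched pairs are the orbits of the involution conjugate to \<open>flip\<close>
  under \<open>\<sigma>\<close>, and the coordinate tests whether \<open>w\<close> is constant on
  them. With an odd number of positions one letter stays unpaired and the pairing is 0.\<close>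

lemma pairing_cases:
  assumes "\<sigma> permutes {..<n}"
  obtains (zero) "pairing L n \<sigma> = 0"
  | (matching) \<pi> where "\<And>i. i < n \<Longrightarrow> \<pi> i < n" "\<And>i. \<pi> i \<noteq> i" "\<And>i. \<pi> (\<pi> i) = i"
      "\<And>w. w \<in> words L n \<Longrightarrow> pairing L n \<sigma> w = of_bool (\<forall>i<n. w ! \<pi> i = w ! i)"
proof (cases "even n")
  case True
  define \<pi> where "\<pi> = (\<lambda>i. \<sigma> (flip (inv_into UNIV \<sigma> i)))"
  have s: "\<sigma> i < n \<longleftrightarrow> i < n" "inv_into UNIV \<sigma> i < n \<longleftrightarrow> i < n" for i
    using permutes_in_image[OF assms, of i] permutes_in_image[OF permutes_inv[OF assms], of i] by auto
  show thesis
  proof (rule matching)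
    show "\<pi> i < n" if "i < n" for i using that True by (simp add: \<pi>_def s flip_props)
    show "\<pi> i \<noteq> i" for i
      using flip_props(1)[of "inv_into UNIV \<sigma> i"] permutes_inverses[OF assms] unfolding \<pi>_def by metis
    show "\<pi> (\<pi> i) = i" for i by (simp add: \<pi>_def permutes_inverses[OF assms] flip_props)
    fix w assume w: "w \<in> words L n"
    then have len: "length w = n" by (rule words_length)
    have "(\<forall>i<n. permute_list \<sigma> w ! flip i = permute_list \<sigma> w ! i) \<longleftrightarrow> (\<forall>i<n. w ! \<sigma> (flip i) = w ! \<sigma> i)"
      using True assms len by (simp add: permute_list_nth flip_props)
    also have "\<dots> \<longleftrightarrow> (\<forall>i<n. w ! \<pi> i = w ! i)"
      unfolding \<pi>_def using s permutes_inverses[OF assms] by metis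
    finally show "pairing L n \<sigma> w = of_bool (\<forall>i<n. w ! \<pi> i = w ! i)"
      using w len True by (simp add: pairing_def std_pairing_even)
  qed
next
  case False
  then have "pairing L n \<sigma> = 0"
    by (auto simp: pairing_def std_pairing_odd words_length fun_eq_iff)
  then show thesis by (rule zero)
qed

text \<open>Grouping the words by their letters outside \<open>i\<close> and \<open>j\<close> writes
  the sum as a combination of contractions of \<open>t\<close>.\<close>

lemma traceless_sum_eq_0:
  assumes t: "t \<in> traceless M m" and ij: "i < m" "j < m" "i \<noteq> j"
    and c: "\<And>v a. v \<in> words M m \<Longrightarrow> v ! i = v ! j \<Longrightarrow> a < M \<Longrightarrow> c (v[i := a, j := a]) = c v"
    and supp: "\<And>v. v \<in> words M m \<Longrightarrow> v ! i \<noteq> v ! j \<Longrightarrow> c v = 0"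
  shows "(\<Sum>v\<in>words M m. c v * t v) = 0"
proof -
  \<comment> \<open>\<open>?V\<close> contains one representative of each group, the word with
    letter 0 at both places; a contraction overwrites these two letters.\<close>
  let ?V = "{v \<in> words M m. v ! i = 0 \<and> v ! j = 0}" and ?D = "{v \<in> words M m. v ! i = v ! j}"
  have "(\<Sum>v\<in>words M m. c v * t v) = (\<Sum>v\<in>?D. c v * t v)"
    using supp by (intro sum.mono_neutral_right) auto
  also have "\<dots> = (\<Sum>(v, a)\<in>?V \<times> {..<M}. c (v[i := a, j := a]) * t (v[i := a, j := a]))"
  proof (rule sum.reindex_bij_witness[where j = "\<lambda>v. (v[i := 0, j := 0], v ! i)"
        and i = "\<lambda>(v, a). v[i := a, j := a]"])
    fix v assume v: "v \<in> ?D"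
    then have M: "0 < M" using ij words_nth[of v M m i] by auto
    have restore: "v[i := 0, j := 0, i := v ! i, j := v ! i] = v"
      using v ij by (auto simp: list_eq_iff_nth_eq nth_list_update words_length)
    then show "(case (v[i := 0, j := 0], v ! i) of (v, a) \<Rightarrow> v[i := a, j := a]) = v" by simp
    show "(v[i := 0, j := 0], v ! i) \<in> ?V \<times> {..<M}"
      using v ij M by (auto simp: words_update words_nth words_length nth_list_update)
    show "(case (v[i := 0, j := 0], v ! i) of (v, a) \<Rightarrow> c (v[i := a, j := a]) * t (v[i := a, j := a])) = c v * t v"
      using restore by simp
  next
    fix va assume va: "va \<in> ?V \<times> {..<M}"
    obtain v a where eq: "va = (v, a)" by (cases va)
    have len: "length v = m" using va words_length by (auto simp: eq)
    have "v[i := a, j := a, i := 0, j := 0] = v"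
      using va ij by (auto simp: eq list_eq_iff_nth_eq nth_list_update words_length)
    then show "((case va of (v, a) \<Rightarrow> v[i := a, j := a])[i := 0, j := 0], (case va of (v, a) \<Rightarrow> v[i := a, j := a]) ! i) = va"
      using va ij len by (simp add: eq nth_list_update)
    show "(case va of (v, a) \<Rightarrow> v[i := a, j := a]) \<in> ?D"
      using va ij by (auto simp: eq words_update words_length nth_list_update)
  qed
  also have "\<dots> = (\<Sum>v\<in>?V. c v * (\<Sum>a<M. t (v[i := a, j := a])))"
    unfolding sum.cartesian_product[symmetric] sum_distrib_left
    by (intro sum.cong refl) (simp add: c)
  also have "\<dots> = 0"
    using t ij by (intro sum.neutral) (auto simp: traceless_def)
  finally show ?thesis .
qed


text \<open>\<open>e\<close> embeds the positions of \<open>v\<close> into those of the larger word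
  \<open>x v\<close>, whose other letters are constant, so that one argument covers both halves of a
  concatenation. If the involution pairs two embedded positions, the indicator forces equal letters
  there and does not depend on their common value.\<close>

lemma traceless_pairing_sum_eq_0:
  assumes t: "t \<in> traceless M m" and ij: "i < m" "j < m" "i \<noteq> j"
    and \<pi>: "\<And>l. l < n \<Longrightarrow> \<pi> l < n" "\<And>l. \<pi> (\<pi> l) = l"
    and e: "inj_on e {..<m}" "\<And>l. l < m \<Longrightarrow> e l < n"
    and pair: "\<pi> (e i) = e j"
    and x: "\<And>v l. v \<in> words M m \<Longrightarrow> l < m \<Longrightarrow> x v ! e l = v ! l"
      "\<And>v v' l. v \<in> words M m \<Longrightarrow> v' \<in> words M m \<Longrightarrow> l < n \<Longrightarrow> l \<notin> e ` {..<m} \<Longrightarrow> x v ! l = x v' ! l"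
  shows "(\<Sum>v\<in>words M m. of_bool (\<forall>l<n. x v ! \<pi> l = x v ! l) * t v) = 0"
proof (rule traceless_sum_eq_0[OF t ij])
  have pair': "\<pi> (e j) = e i" using pair \<pi>(2) by metis
  fix v assume v: "v \<in> words M m"
  show "of_bool (\<forall>l<n. x v ! \<pi> l = x v ! l) = 0" if "v ! i \<noteq> v ! j"
    using that x(1)[OF v ij(1)] x(1)[OF v ij(2)] e(2)[OF ij(1)] pair by force
  fix a assume vij: "v ! i = v ! j" and a: "a < M"
  let ?v = "v[i := a, j := a]"
  have v': "?v \<in> words M m" using v a by (simp add: words_update)
  have len: "length v = m" using v by (rule words_length)
  have other: "x ?v ! l = x v ! l" if l: "l < n" "l \<noteq> e i" "l \<noteq> e j" for l
  proof (cases "l \<in> e ` {..<m}")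
    case True
    then obtain k where "k < m" "l = e k" by auto
    then show ?thesis using x(1)[OF v] x(1)[OF v'] l by (cases "k = i"; cases "k = j") auto
  qed (use x(2) v v' l in blast)
  have vals: "x v ! e i = v ! i" "x v ! e j = v ! j" "x ?v ! e i = a" "x ?v ! e j = a"
    using x(1)[OF v] x(1)[OF v'] ij len by (auto simp: nth_list_update)
  have "x ?v ! \<pi> l = x ?v ! l \<longleftrightarrow> x v ! \<pi> l = x v ! l" if l: "l < n" for l
  proof (cases "l = e i \<or> l = e j")
    case True
    then show ?thesis using vals vij pair pair' by auto
  next
    case False
    then have "\<pi> l \<noteq> e i" "\<pi> l \<noteq> e j" using pair pair' \<pi>(2) by metis+
    then show ?thesis using False other[OF l] other[OF \<pi>(1)[OF l]] by simp
  qed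
  then show "(of_bool (\<forall>l<n. x ?v ! \<pi> l = x ?v ! l) :: complex) = of_bool (\<forall>l<n. x v ! \<pi> l = x v ! l)"
    by simp
qed

lemma pairing_contract_right_eq_0:
  assumes t: "t \<in> traceless M m" and w: "w \<in> words M k"
    and \<pi>: "\<And>l. l < k + m \<Longrightarrow> \<pi> l < k + m" "\<And>l. \<pi> l \<noteq> l" "\<And>l. \<pi> (\<pi> l) = l"
    and i: "i < m" "k \<le> \<pi> (k + i)"
  shows "(\<Sum>v\<in>words M m. of_bool (\<forall>l<k + m. (w @ v) ! \<pi> l = (w @ v) ! l) * t v) = 0"
proof (rule traceless_pairing_sum_eq_0[where e = "\<lambda>l. k + l" and i = i and j = "\<pi> (k + i) - k", OF t i(1)])
  show "\<pi> (k + i) - k < m" using \<pi>(1)[of "k + i"] i by simp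
  show "i \<noteq> \<pi> (k + i) - k" using \<pi>(2)[of "k + i"] i by auto
  show "(w @ v) ! l = (w @ v') ! l" if "l < k + m" "l \<notin> (+) k ` {..<m}" for v v' l
  proof -
    have "l < k" using that by (metis add_diff_inverse_nat image_eqI lessThan_iff nat_add_left_cancel_less)
    then show ?thesis using w by (simp add: nth_append words_length)
  qed
qed (use \<pi> i w in \<open>auto simp: nth_append words_length\<close>)

lemma pairing_contract_left_eq_0:
  assumes t: "t \<in> traceless M k" and v: "v \<in> words M m"
    and \<pi>: "\<And>l. l < k + m \<Longrightarrow> \<pi> l < k + m" "\<And>l. \<pi> l \<noteq> l" "\<And>l. \<pi> (\<pi> l) = l"
    and i: "i < k" "\<pi> i < k"
  shows "(\<Sum>w\<in>words M k. of_bool (\<forall>l<k + m. (w @ v) ! \<pi> l = (w @ v) ! l) * t w) = 0"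
proof (rule traceless_pairing_sum_eq_0[where e = "\<lambda>l. l" and i = i and j = "\<pi> i", OF t i])
  show "i \<noteq> \<pi> i" using \<pi>(2)[of i] by simp
  show "(w @ v) ! l = (w' @ v) ! l" if "w \<in> words M k" "w' \<in> words M k" "l \<notin> (\<lambda>l. l) ` {..<k}" for w w' l
    using that by (auto simp: nth_append words_length)
qed (use \<pi> i in \<open>auto simp: nth_append words_length\<close>)

lemma span_pairings_induct [consumes 1, case_names subspace matching]:
  assumes \<phi>: "\<phi> \<in> tensor.span (pairing L n ` {\<sigma>. \<sigma> permutes {..<n}})"
    and sub: "tensor.subspace {\<phi>. Q \<phi>}"
    and match: "\<And>\<phi> \<pi>. (\<And>i. i < n \<Longrightarrow> \<pi> i < n) \<Longrightarrow> (\<And>i. \<pi> i \<noteq> i) \<Longrightarrow> (\<And>i. \<pi> (\<pi> i) = i) \<Longrightarrow>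
      (\<And>w. w \<in> words L n \<Longrightarrow> \<phi> w = of_bool (\<forall>i<n. w ! \<pi> i = w ! i)) \<Longrightarrow> Q \<phi>"
  shows "Q \<phi>"
  using \<phi>
proof (induction rule: tensor.span_induct)
  case base
  show ?case by (rule sub)
next
  case (step x)
  then obtain \<sigma> where \<sigma>: "\<sigma> permutes {..<n}" "x = pairing L n \<sigma>" by auto
  from \<sigma>(1) show ?case
  proof (cases rule: pairing_cases[where L = L])
    case zero
    show ?thesis unfolding \<sigma>(2) zero using tensor.subspace_0[OF sub] by blast
  next
    case (matching \<pi>)
    then show ?thesis using match \<sigma>(2) by metis
  qed
qed

section \<open>Equivariant maps according to the degree of their values\<close>

locale equivariant_map =
  fixes M m k :: nat and W :: "tensor set" and g :: "tensor \<Rightarrow> tensor"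
  assumes W: "tensor.subspace W" "W \<subseteq> traceless M m"
    and W_inv: "\<And>A t. A \<in> OG M \<Longrightarrow> t \<in> W \<Longrightarrow> grp_act A t \<in> W"
    and lin: "linear_map_on tscale tscale W (tensor_space M k) g"
    and equi: "\<And>A t. A \<in> OG M \<Longrightarrow> t \<in> W \<Longrightarrow> g (grp_act A t) = grp_act A (g t)"
begin

lemma kernel:
  obtains \<phi> where "\<phi> \<in> tensor.span (pairing M (k + m) ` {\<sigma>. \<sigma> permutes {..<k + m}})"
    "\<And>t w. t \<in> W \<Longrightarrow> w \<in> words M k \<Longrightarrow> g t w = (\<Sum>v\<in>words M m. \<phi> (w @ v) * t v)"
proof -
  have sp: "W \<subseteq> tensor_space M m" using W(2) by (auto simp: traceless_def)
  obtain \<phi> where "OG_invariant M (k + m) \<phi>"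
      "\<And>t w. t \<in> W \<Longrightarrow> w \<in> words M k \<Longrightarrow> g t w = (\<Sum>v\<in>words M m. \<phi> (w @ v) * t v)"
    by (rule equivariant_map_kernel[OF W(1) sp], (rule W_inv; assumption), rule lin,
        (rule equi; assumption), (rule that; assumption))
  then show thesis using invariant_in_span_pairings that by blast
qed

text \<open>More than half of the \<open>k + m\<close> positions of the kernel belong to the
  argument, so every matching pairs two of them and contracts the traceless
  \<open>t\<close>.\<close>

lemma eq_0_if_less:
  assumes "k < m" "t \<in> W"
  shows "g t = 0"
proof -
  obtain \<phi> where \<phi>: "\<phi> \<in> tensor.span (pairing M (k + m) ` {\<sigma>. \<sigma> permutes {..<k + m}})"
    "\<And>t w. t \<in> W \<Longrightarrow> w \<in> words M k \<Longrightarrow> g t w = (\<Sum>v\<in>words M m. \<phi> (w @ v) * t v)"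
    using kernel by metis
  have tr: "t \<in> traceless M m" using W(2) assms(2) by blast
  have "\<forall>w\<in>words M k. (\<Sum>v\<in>words M m. \<phi> (w @ v) * t v) = 0"
    using \<phi>(1)
  proof (induction rule: span_pairings_induct)
    show "tensor.subspace {\<phi>. \<forall>w\<in>words M k. (\<Sum>v\<in>words M m. \<phi> (w @ v) * t v) = 0}"
      by (auto simp: tensor.subspace_def tscale_def distrib_right sum.distrib mult.assoc
          simp flip: sum_distrib_left)
  next
    fix \<phi> :: tensor and \<pi> :: "nat \<Rightarrow> nat"
    assume \<pi>: "\<And>i. i < k + m \<Longrightarrow> \<pi> i < k + m" "\<And>i. \<pi> i \<noteq> i" "\<And>i. \<pi> (\<pi> i) = i"
      and \<phi>: "\<And>w. w \<in> words M (k + m) \<Longrightarrow> \<phi> w = of_bool (\<forall>i<k + m. w ! \<pi> i = w ! i)"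
    have "\<exists>i<m. k \<le> \<pi> (k + i)"
    proof (rule ccontr)
      assume "\<not> ?thesis"
      then have "(\<lambda>i. \<pi> (k + i)) ` {..<m} \<subseteq> {..<k}" by auto
      moreover have "inj_on (\<lambda>i. \<pi> (k + i)) {..<m}" by (rule inj_onI) (metis \<pi>(3) add_left_cancel)
      ultimately have "m \<le> k" using card_inj_on_le[of "\<lambda>i. \<pi> (k + i)" "{..<m}" "{..<k}"] by simp
      with assms(1) show False by simp
    qed
    then show "\<forall>w\<in>words M k. (\<Sum>v\<in>words M m. \<phi> (w @ v) * t v) = 0"
      using pairing_contract_right_eq_0[OF tr, of _ k \<pi>] \<pi> by (auto simp: \<phi> words_append)
  qed
  then have "g t w = 0" if "w \<in> words M k" for w
    using \<phi>(2) assms(2) that by simp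
  moreover have "g t \<in> tensor_space M k" using lin assms(2) by (auto simp: linear_map_on_def)
  ultimately show ?thesis by (auto intro!: tensor_eqI[of _ M k] simp: tensor_space_def)
qed

text \<open>Every matching now pairs two positions of the value. Summing the kernel against the
  conjugate of \<open>g t\<close>, which is traceless like \<open>g t\<close>, therefore gives 0,
  and this computes \<open>ip M k (g t) (g t)\<close>.\<close>

lemma eq_0_if_greater:
  assumes "m < k" "t \<in> W" and tr: "g t \<in> traceless M k"
  shows "g t = 0"
proof -
  obtain \<phi> where \<phi>: "\<phi> \<in> tensor.span (pairing M (k + m) ` {\<sigma>. \<sigma> permutes {..<k + m}})"
    "\<And>t w. t \<in> W \<Longrightarrow> w \<in> words M k \<Longrightarrow> g t w = (\<Sum>v\<in>words M m. \<phi> (w @ v) * t v)"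
    using kernel by metis
  let ?s = "\<lambda>w. cnj (g t w)"
  have tr': "?s \<in> traceless M k"
    using tr by (auto simp: traceless_def tensor_space_def simp flip: cnj_sum)
  have \<phi>0: "\<forall>v\<in>words M m. (\<Sum>w\<in>words M k. \<phi> (w @ v) * ?s w) = 0"
    using \<phi>(1)
  proof (induction rule: span_pairings_induct)
    show "tensor.subspace {\<phi>. \<forall>v\<in>words M m. (\<Sum>w\<in>words M k. \<phi> (w @ v) * ?s w) = 0}"
      by (auto simp: tensor.subspace_def tscale_def distrib_right sum.distrib mult.assoc
          simp flip: sum_distrib_left)
  next
    fix \<phi> :: tensor and \<pi> :: "nat \<Rightarrow> nat"
    assume \<pi>: "\<And>i. i < k + m \<Longrightarrow> \<pi> i < k + m" "\<And>i. \<pi> i \<noteq> i" "\<And>i. \<pi> (\<pi> i) = i"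
      and \<phi>: "\<And>w. w \<in> words M (k + m) \<Longrightarrow> \<phi> w = of_bool (\<forall>i<k + m. w ! \<pi> i = w ! i)"
    have "\<exists>i<k. \<pi> i < k"
    proof (rule ccontr)
      assume "\<not> ?thesis"
      then have "\<pi> ` {..<k} \<subseteq> {k..<k + m}" using \<pi>(1) by force
      moreover have "inj_on \<pi> {..<k}" by (rule inj_onI) (metis \<pi>(3))
      ultimately have "k \<le> m" using card_inj_on_le[of \<pi> "{..<k}" "{k..<k + m}"] by simp
      with assms(1) show False by simp
    qed
    then show "\<forall>v\<in>words M m. (\<Sum>w\<in>words M k. \<phi> (w @ v) * ?s w) = 0"
      using pairing_contract_left_eq_0[OF tr', of _ m \<pi>] \<pi> by (auto simp: \<phi> words_append)
  qed
  have "ip M k (g t) (g t) = (\<Sum>w\<in>words M k. \<Sum>v\<in>words M m. t v * (\<phi> (w @ v) * ?s w))"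
    unfolding ip_def
  proof (intro sum.cong refl)
    fix w assume "w \<in> words M k"
    then have "g t w * ?s w = (\<Sum>v\<in>words M m. \<phi> (w @ v) * t v) * ?s w"
      by (intro arg_cong2[of _ _ _ _ "(*)"] \<phi>(2) assms(2) refl)
    also have "\<dots> = (\<Sum>v\<in>words M m. t v * (\<phi> (w @ v) * ?s w))"
      unfolding sum_distrib_right by (intro sum.cong refl) (simp only: mult_ac)
    finally show "g t w * ?s w = (\<Sum>v\<in>words M m. t v * (\<phi> (w @ v) * ?s w))" .
  qed
  also have "\<dots> = (\<Sum>v\<in>words M m. t v * (\<Sum>w\<in>words M k. \<phi> (w @ v) * ?s w))"
    by (subst sum.swap) (simp add: sum_distrib_left)
  also have "\<dots> = 0" using \<phi>0 by simp
  finally show ?thesis using tr ip_self_eq_0D by (auto simp: traceless_def)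
qed

end

text \<open>A matching of \<open>m + m\<close> positions either pairs two argument positions, and
  contributes nothing on traceless tensors, or pairs every argument position with a value position,
  and acts as a permutation of the factors.\<close>

lemma equivariant_map_permutations:
  assumes "equivariant_map M m m W g"
  shows "\<exists>c. \<forall>t\<in>W. \<forall>w\<in>words M m. g t w = (\<Sum>\<rho> | \<rho> permutes {..<m}. c \<rho> * t (permute_list \<rho> w))"
proof -
  interpret equivariant_map M m m W g by fact
  obtain \<phi> where \<phi>: "\<phi> \<in> tensor.span (pairing M (m + m) ` {\<sigma>. \<sigma> permutes {..<m + m}})"
    "\<And>t w. t \<in> W \<Longrightarrow> w \<in> words M m \<Longrightarrow> g t w = (\<Sum>v\<in>words M m. \<phi> (w @ v) * t v)"
    using kernel by metis
  let ?R = "{\<rho>. \<rho> permutes {..<m}}"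
  have fin: "finite ?R" by (simp add: finite_permutations)
  \<comment> \<open>One family of coefficients has to serve all tensors and words, so
    \<open>c\<close> is chosen before \<open>t\<close> and \<open>w\<close> in the property carried
    through the span.\<close>
  let ?Q = "\<lambda>\<phi> c. \<forall>t\<in>traceless M m. \<forall>w\<in>words M m.
    (\<Sum>v\<in>words M m. \<phi> (w @ v) * t v) = (\<Sum>\<rho>\<in>?R. c \<rho> * t (permute_list \<rho> w))"
  have "\<exists>c. ?Q \<phi> c"
    using \<phi>(1)
  proof (induction rule: span_pairings_induct)
    show "tensor.subspace {\<phi>. \<exists>c. ?Q \<phi> c}"
      unfolding tensor.subspace_def
    proof (intro conjI ballI allI)
      have "?Q 0 (\<lambda>_. 0)" by simp
      then show "0 \<in> {\<phi>. \<exists>c. ?Q \<phi> c}"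
        unfolding mem_Collect_eq by (rule exI[where x = "\<lambda>_. 0"])
      fix \<phi> assume "\<phi> \<in> {\<phi>. \<exists>c. ?Q \<phi> c}"
      then obtain c where c: "?Q \<phi> c" by blast
      show "tscale z \<phi> \<in> {\<phi>. \<exists>c. ?Q \<phi> c}" for z
      proof -
        have "?Q (tscale z \<phi>) (\<lambda>\<rho>. z * c \<rho>)"
          using c by (simp add: tscale_def mult.assoc flip: sum_distrib_left)
        then show ?thesis
          unfolding mem_Collect_eq by (rule exI[where x = "\<lambda>\<rho>. z * c \<rho>"])
      qed
      fix \<phi>' assume "\<phi>' \<in> {\<phi>. \<exists>c. ?Q \<phi> c}"
      then obtain c' where "?Q \<phi>' c'" by blast
      then have "?Q (\<phi> + \<phi>') (\<lambda>\<rho>. c \<rho> + c' \<rho>)"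
        using c by (simp add: distrib_right sum.distrib)
      then show "\<phi> + \<phi>' \<in> {\<phi>. \<exists>c. ?Q \<phi> c}"
        unfolding mem_Collect_eq by (rule exI[where x = "\<lambda>\<rho>. c \<rho> + c' \<rho>"])
    qed
  next
    fix \<phi> :: tensor and \<pi> :: "nat \<Rightarrow> nat"
    assume \<pi>: "\<And>i. i < m + m \<Longrightarrow> \<pi> i < m + m" "\<And>i. \<pi> i \<noteq> i" "\<And>i. \<pi> (\<pi> i) = i"
      and \<phi>: "\<And>w. w \<in> words M (m + m) \<Longrightarrow> \<phi> w = of_bool (\<forall>i<m + m. w ! \<pi> i = w ! i)"
    show "\<exists>c. ?Q \<phi> c"
    proof (cases "\<exists>i<m. m \<le> \<pi> (m + i)")
      case True
      then have "?Q \<phi> (\<lambda>_. 0)"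
        using pairing_contract_right_eq_0[of _ M m _ m \<pi>] \<pi> by (auto simp: \<phi> words_append)
      then show ?thesis by (rule exI[where x = "\<lambda>_. 0"])
    next
      case False
      \<comment> \<open>The value position paired with the argument position \<open>m + i\<close>;
        being injective on a finite set, this is a permutation.\<close>
      define \<rho> where "\<rho> = (\<lambda>i. if i < m then \<pi> (m + i) else i)"
      have inj: "inj_on \<rho> {..<m}"
        by (rule inj_onI) (metis \<pi>(3) \<rho>_def add_left_cancel lessThan_iff)
      have "\<rho> ` {..<m} \<subseteq> {..<m}" using False by (auto simp: \<rho>_def)
      then have bij: "bij_betw \<rho> {..<m} {..<m}"
        using inj by (simp add: bij_betw_def endo_inj_surj)
      then have \<rho>: "\<rho> permutes {..<m}"
        by (rule bij_imp_permutes) (simp add: \<rho>_def)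
      have "(\<Sum>v\<in>words M m. \<phi> (w @ v) * t v) = t (permute_list \<rho> w)" if w: "w \<in> words M m" for t w
      proof -
        have len: "length w = m" using w by (rule words_length)
        have "\<phi> (w @ v) = of_bool (v = permute_list \<rho> w)" if v: "v \<in> words M m" for v
        proof -
          have lenv: "length v = m" using v by (rule words_length)
          have "(\<forall>l<m + m. (w @ v) ! \<pi> l = (w @ v) ! l) \<longleftrightarrow> (\<forall>i<m. v ! i = w ! \<rho> i)"
          proof (intro iffI allI impI)
            fix i assume a: "\<forall>l<m + m. (w @ v) ! \<pi> l = (w @ v) ! l" and i: "i < m"
            from i have "(w @ v) ! \<pi> (m + i) = (w @ v) ! (m + i)" using a by simp
            moreover have "\<pi> (m + i) < m" using False i by auto
            ultimately show "v ! i = w ! \<rho> i" using i len by (simp add: \<rho>_def nth_append)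
          next
            fix l assume a: "\<forall>i<m. v ! i = w ! \<rho> i" and l: "l < m + m"
            show "(w @ v) ! \<pi> l = (w @ v) ! l"
            proof (cases "l < m")
              case True
              then obtain i where i: "i < m" "l = \<rho> i"
                using bij by (metis bij_betw_iff_bijections lessThan_iff)
              then have "l = \<pi> (m + i)" "\<pi> l = m + i" using \<pi>(3) by (auto simp: \<rho>_def)
              then show ?thesis using a i True len by (simp add: nth_append)
            next
              case lm: False
              then obtain i where i: "l = m + i" "i < m" using l by (metis add_diff_inverse_nat nat_add_left_cancel_less)
              moreover have "\<pi> (m + i) < m" using False i by auto
              ultimately show ?thesis using a len by (simp add: nth_append \<rho>_def)
            qed
          qed
          also have "\<dots> \<longleftrightarrow> v = permute_list \<rho> w"
            using \<rho> len lenv by (auto simp: list_eq_iff_nth_eq permute_list_nth)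
          finally show ?thesis using \<phi> w v by (simp add: words_append)
        qed
        then have "(\<Sum>v\<in>words M m. \<phi> (w @ v) * t v) = (\<Sum>v\<in>words M m. if v = permute_list \<rho> w then t v else 0)"
          by (intro sum.cong) auto
        then show ?thesis using w \<rho> by (simp add: words_permute_list)
      qed
      moreover have "(\<Sum>\<rho>'\<in>?R. of_bool (\<rho>' = \<rho>) * t (permute_list \<rho>' w)) = t (permute_list \<rho> w)"
        for t :: tensor and w
        using \<rho> fin by (simp add: of_bool_def if_distrib[of "\<lambda>x. x * _"] cong: if_cong)
      ultimately have "?Q \<phi> (\<lambda>\<rho>'. of_bool (\<rho>' = \<rho>))" by simp
      then show ?thesis by (rule exI[where x = "\<lambda>\<rho>'. of_bool (\<rho>' = \<rho>)"])
    qed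
  qed
  then obtain c where c: "?Q \<phi> c" by (rule exE)
  have "\<forall>t\<in>W. \<forall>w\<in>words M m. g t w = (\<Sum>\<rho>\<in>?R. c \<rho> * t (permute_list \<rho> w))"
  proof (intro ballI)
    fix t w assume t: "t \<in> W" and w: "w \<in> words M m"
    have "t \<in> traceless M m" using W(2) t by blast
    with c w have "(\<Sum>v\<in>words M m. \<phi> (w @ v) * t v) = (\<Sum>\<rho>\<in>?R. c \<rho> * t (permute_list \<rho> w))"
      by blast
    then show "g t w = (\<Sum>\<rho>\<in>?R. c \<rho> * t (permute_list \<rho> w))"
      using \<phi>(2)[OF t w] by simp
  qed
  then show ?thesis by (rule exI[where x = c])
qed

section \<open>Submodules and block diagonal matrices\<close>

lemma traceless_subspace: "tensor.subspace (traceless L n)"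
  unfolding tensor.subspace_def traceless_def
  by (auto simp: tensor_space_def tscale_def sum.distrib simp flip: sum_distrib_left)

text \<open>In a contraction of the image, orthonormality of the columns of \<open>A\<close> forces
  \<open>v ! i = v ! j\<close>, and the remaining factors do not involve these letters: a
  combination of contractions of \<open>t\<close>.\<close>

lemma traceless_grp_act:
  assumes A: "A \<in> OG L" and t: "t \<in> traceless L n"
  shows "grp_act A t \<in> traceless L n"
proof -
  note Ac = OG_carrier[OF A]
  have sp: "grp_act A t \<in> tensor_space L n"
    using t Ac by (auto simp: traceless_def intro: grp_act_in_space)
  have "(\<Sum>a<L. grp_act A t (w[i := a, j := a])) = 0"
    if ij: "i < n" "j < n" "i \<noteq> j" and w: "w \<in> words L n" for i j w
  proof -
    define r where "r = (\<lambda>v. \<Prod>l\<in>{..<n} - {i} - {j}. A $$ (w ! l, v ! l))"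
    have m: "mprod A (w[i := a, j := a]) v = (A $$ (a, v ! i) * A $$ (a, v ! j)) * r v" for a v
    proof -
      have len: "length w = n" using w by (rule words_length)
      have "mprod A (w[i := a, j := a]) v =
          A $$ (a, v ! i) * (A $$ (a, v ! j) * (\<Prod>l\<in>{..<n} - {i} - {j}. A $$ (w[i := a, j := a] ! l, v ! l)))"
        unfolding mprod_def using ij len
        by (subst prod.remove[of _ i], simp, simp, subst prod.remove[of _ j]) auto
      also have "(\<Prod>l\<in>{..<n} - {i} - {j}. A $$ (w[i := a, j := a] ! l, v ! l)) = r v"
        unfolding r_def by (intro prod.cong) auto
      finally show ?thesis by (simp add: mult.assoc)
    qed
    have "(\<Sum>a<L. grp_act A t (w[i := a, j := a])) =
        (\<Sum>a<L. \<Sum>v\<in>words L n. (A $$ (a, v ! i) * A $$ (a, v ! j)) * r v * t v)"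
    proof (intro sum.cong refl)
      fix a assume "a \<in> {..<L}"
      then have "w[i := a, j := a] \<in> words L n" using w by (simp add: words_update)
      then show "grp_act A t (w[i := a, j := a]) =
          (\<Sum>v\<in>words L n. (A $$ (a, v ! i) * A $$ (a, v ! j)) * r v * t v)"
        by (simp add: grp_act_words[OF Ac] m)
    qed
    also have "\<dots> = (\<Sum>v\<in>words L n. (of_bool (v ! i = v ! j) * r v) * t v)"
    proof (subst sum.swap, intro sum.cong refl)
      fix v assume "v \<in> words L n"
      then have "(\<Sum>a<L. A $$ (a, v ! i) * A $$ (a, v ! j)) = of_bool (v ! i = v ! j)"
        using A ij by (simp add: OG_iff words_nth)
      then show "(\<Sum>a<L. A $$ (a, v ! i) * A $$ (a, v ! j) * r v * t v) = of_bool (v ! i = v ! j) * r v * t v"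
        by (simp flip: sum_distrib_right)
    qed
    also have "\<dots> = 0"
    proof (rule traceless_sum_eq_0[OF t ij])
      fix v a assume v: "v \<in> words L n" "v ! i = v ! j"
      have "length v = n" using v(1) by (rule words_length)
      moreover have "r (v[i := a, j := a]) = r v" unfolding r_def by (intro prod.cong) auto
      ultimately show "of_bool (v[i := a, j := a] ! i = v[i := a, j := a] ! j) * r (v[i := a, j := a]) =
          of_bool (v ! i = v ! j) * r v"
        using v ij by (simp add: nth_list_update)
    qed simp
    finally show ?thesis .
  qed
  then show ?thesis using sp by (simp add: traceless_def)
qed

section \<open>Invertible matrices; polynomial and differential arguments inside submodules\<close>

lemma GL_iff: "A \<in> GL L \<longleftrightarrow> A \<in> carrier_mat L L \<and> (\<exists>B\<in>carrier_mat L L. A * B = 1\<^sub>m L \<and> B * A = 1\<^sub>m L)"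
proof
  assume A: "A \<in> GL L"
  then obtain B where B: "A * B = 1\<^sub>m (dim_row A)" "B * A = 1\<^sub>m (dim_row B)"
    by (auto simp: GL_def invertible_mat_def inverts_mat_def)
  have Ac: "A \<in> carrier_mat L L" using A by (simp add: GL_def)
  have "dim_col (A * B) = L" "dim_col (B * A) = dim_row B" unfolding B using Ac by simp_all
  then have "B \<in> carrier_mat L L" using Ac by (auto intro: carrier_matI)
  then show "A \<in> carrier_mat L L \<and> (\<exists>B\<in>carrier_mat L L. A * B = 1\<^sub>m L \<and> B * A = 1\<^sub>m L)"
    using Ac B by auto
next
  assume "A \<in> carrier_mat L L \<and> (\<exists>B\<in>carrier_mat L L. A * B = 1\<^sub>m L \<and> B * A = 1\<^sub>m L)"
  then show "A \<in> GL L"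
    by (auto simp: GL_def invertible_mat_def inverts_mat_def)
qed

lemma GL_carrier: "A \<in> GL L \<Longrightarrow> A \<in> carrier_mat L L"
  by (simp add: GL_def)

lemma GL_if_det:
  assumes "A \<in> carrier_mat L L" "det A \<noteq> 0"
  shows "A \<in> GL L"
  using det_non_zero_imp_unit[OF assms] assms(1)
  by (auto simp: Units_def ring_mat_def GL_iff)

lemma diagonal_GL:
  assumes "\<And>i. i < L \<Longrightarrow> d i \<noteq> 0"
  shows "diagonal L d \<in> GL L"
proof -
  have idx: "diagonal L a $$ (i, j) = (if i = j then a i else 0)" if "i < L" "j < L" for a i j
    using that by (simp add: diagonal_def)
  have "diagonal L a * diagonal L b = 1\<^sub>m L" if ab: "\<And>i. i < L \<Longrightarrow> a i * b i = 1" for a b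
  proof (rule eq_matI)
    fix i j assume "i < dim_row (1\<^sub>m L)" "j < dim_col (1\<^sub>m L :: complex mat)"
    then have ij: "i < L" "j < L" by simp_all
    have "(diagonal L a * diagonal L b) $$ (i, j) = (\<Sum>k<L. diagonal L a $$ (i, k) * diagonal L b $$ (k, j))"
      using ij by (rule mult_mat_entry[OF diagonal_carrier diagonal_carrier])
    also have "\<dots> = (\<Sum>k<L. if i = k then a i * (if i = j then b i else 0) else 0)"
      using ij by (intro sum.cong) (auto simp: idx)
    also have "\<dots> = 1\<^sub>m L $$ (i, j)" using ij ab by simp
    finally show "(diagonal L a * diagonal L b) $$ (i, j) = 1\<^sub>m L $$ (i, j)" .
  qed (simp_all add: diagonal_def)
  from this[of d "\<lambda>i. inverse (d i)"] this[of "\<lambda>i. inverse (d i)" d] assms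
  show ?thesis by (auto simp: GL_iff diagonal_carrier intro!: bexI[of _ "diagonal L (\<lambda>i. inverse (d i))"])
qed

lemma ip_commute: "ip L n x y = cnj (ip L n y x)"
  by (simp add: ip_def mult.commute)

text \<open>A subspace is its own double orthogonal complement. Membership thus becomes a family of
  scalar equations, to which root counting and derivatives apply.\<close>

lemma orthogonal_complement_test:
  assumes V: "tensor.subspace V" "V \<subseteq> tensor_space L n" and y: "y \<in> tensor_space L n"
    and test: "\<And>z. (\<And>v. v \<in> V \<Longrightarrow> ip L n v z = 0) \<Longrightarrow> ip L n y z = 0"
  shows "y \<in> V"
proof -
  obtain u where u: "u \<in> V" "\<And>v. v \<in> V \<Longrightarrow> ip L n (y - u) v = 0"
    using orthogonal_decomposition[OF V, of y] by blast
  have z: "ip L n v (y - u) = 0" if "v \<in> V" for v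
    using u(2)[OF that] ip_commute[of L n v "y - u"] by (simp only: complex_cnj_zero)
  have "ip L n y (y - u) = 0" by (rule test) (rule z)
  then have "ip L n (y - u) (y - u) = 0"
    unfolding ip_diff_left[of L n y u "y - u"] z[OF u(1)] by simp
  moreover have "y - u \<in> tensor_space L n"
    using u(1) V(2) y tensor.subspace_diff[OF tensor_subspace_space] by blast
  ultimately have "y - u = 0" using ip_self_eq_0D by blast
  with u(1) show ?thesis by simp
qed

lemma ip_sum_left: "ip L n (\<Sum>i\<in>I. tscale (c i) (x i)) z = (\<Sum>i\<in>I. c i * ip L n (x i) z)"
proof (induction I rule: infinite_finite_induct)
  case (insert i I)
  show ?case unfolding sum.insert[OF insert(1,2)] ip_add_left ip_scale_left insert(3) ..
qed (simp_all add: ip_def)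

text \<open>Paired with a tensor orthogonal to \<open>V\<close>, the curve is a scalar polynomial
  with infinitely many roots, so all its coefficients vanish.\<close>

lemma polynomial_curve_in_subspace:
  assumes V: "tensor.subspace V" "V \<subseteq> tensor_space L n"
    and x: "\<And>k. x k \<in> tensor_space L n"
    and S: "infinite S" "\<And>z. z \<in> S \<Longrightarrow> (\<Sum>k\<le>d. tscale (z ^ k) (x k)) \<in> V"
    and k: "k \<le> d"
  shows "x k \<in> V"
proof (rule orthogonal_complement_test[OF V x])
  fix y assume y: "\<And>v. v \<in> V \<Longrightarrow> ip L n v y = 0"
  have "(\<Sum>k\<le>d. ip L n (x k) y * z ^ k) = 0" if "z \<in> S" for z
    using y[OF S(2)[OF that]] by (simp add: ip_sum_left mult.commute)
  then have "S \<subseteq> {z. (\<Sum>k\<le>d. ip L n (x k) y * z ^ k) = 0}" by blast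
  then have "infinite {z. (\<Sum>k\<le>d. ip L n (x k) y * z ^ k) = 0}"
    using S(1) finite_subset by blast
  then show "ip L n (x k) y = 0"
    using k polyfun_finite_roots[of "\<lambda>k. ip L n (x k) y" d] by blast
qed

lemma lie_act_in_space:
  assumes "X \<in> carrier_mat L L" "t \<in> tensor_space L n"
  shows "lie_act X t \<in> tensor_space L n"
proof -
  have "lie_act X t w = 0" if "w \<notin> words L n" for w
  proof (cases "set w \<subseteq> {..<L}")
    case True
    with that have "length w \<noteq> n" by (auto simp: words_def)
    then have "t (w[i := a]) = 0" for i a
      using assms(2) by (auto simp: tensor_space_def words_def)
    then show ?thesis using assms(1) by (auto simp: lie_act_def)
  next
    case False
    then show ?thesis using assms(1) by (auto simp: lie_act_def)
  qed
  then show ?thesis by (simp add: tensor_space_def)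
qed

text \<open>Near the identity \<open>1\<^sub>m L + \<theta> \<cdot>\<^sub>m X\<close> is invertible
  by continuity of the determinant. A functional vanishing on \<open>V\<close> is then 0 along this
  curve applied to \<open>t\<close>, and so is its derivative. This links irreducibility under the
  group with maps of the Lie algebra.\<close>

lemma GL_submodule_lie_act:
  assumes V: "GL_submodule L V" "V \<subseteq> tensor_space L n" and X: "X \<in> carrier_mat L L" and t: "t \<in> V"
  shows "lie_act X t \<in> V"
proof (rule orthogonal_complement_test[OF _ V(2)])
  show sub: "tensor.subspace V" using V(1) by (simp add: GL_submodule_def)
  show "lie_act X t \<in> tensor_space L n" using X V(2) t lie_act_in_space by blast
  fix z assume z: "\<And>v. v \<in> V \<Longrightarrow> ip L n v z = 0"
  define R where "R = (\<lambda>\<theta>. 1\<^sub>m L + \<theta> \<cdot>\<^sub>m X)"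
  have Rc: "R \<theta> \<in> carrier_mat L L" for \<theta> using X by (simp add: R_def)
  have R0: "R 0 = 1\<^sub>m L" using X by (intro eq_matI) (auto simp: R_def)
  have ent: "((\<lambda>\<theta>. R \<theta> $$ (i, j)) has_field_derivative X $$ (i, j)) (at 0)" if "i < L" "j < L" for i j
    using that X by (auto simp: R_def intro!: derivative_eq_intros)
  have "((\<lambda>\<theta>. ip L n (grp_act (R \<theta>) t) z) has_field_derivative ip L n (lie_act X t) z) (at 0)"
    unfolding ip_def
    by (intro DERIV_sum DERIV_cmult_right grp_act_derivative[OF Rc R0 X ent])
  moreover have "\<forall>\<^sub>F \<theta> in nhds 0. ip L n (grp_act (R \<theta>) t) z = 0"
  proof -
    have "isCont (\<lambda>\<theta>. det (R \<theta>)) 0"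
      unfolding det_def'[OF Rc]
      by (intro continuous_intros DERIV_isCont[OF ent]) (auto dest: permutes_in_image)
    then have "((\<lambda>\<theta>. det (R \<theta>)) \<longlongrightarrow> det (R 0)) (nhds 0)"
      using tendsto_at_iff_tendsto_nhds[of "\<lambda>\<theta>. det (R \<theta>)" 0] by (simp add: isCont_def)
    moreover have "det (R 0) \<noteq> 0" by (simp add: R0)
    ultimately have "\<forall>\<^sub>F \<theta> in nhds 0. det (R \<theta>) \<noteq> 0"
      by (rule tendsto_imp_eventually_ne)
    then show ?thesis
    proof eventually_elim
      case (elim \<theta>)
      then have "R \<theta> \<in> GL L" using Rc GL_if_det by blast
      then show ?case using V(1) t z by (simp add: GL_submodule_def)
    qed
  qed
  ultimately have "((\<lambda>\<theta>. 0) has_field_derivative ip L n (lie_act X t) z) (at 0)"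
    using DERIV_cong_ev[of 0 0 "\<lambda>\<theta>. ip L n (grp_act (R \<theta>) t) z" "\<lambda>_. 0"] by blast
  then show "ip L n (lie_act X t) z = 0"
    by (rule DERIV_unique) (rule DERIV_const)
qed

section \<open>Block diagonal matrices\<close>

lemma block_diag_carrier:
  "A \<in> carrier_mat N N \<Longrightarrow> B \<in> carrier_mat M M \<Longrightarrow> block_diag A B \<in> carrier_mat (N + M) (N + M)"
  by (auto simp: block_diag_def)

lemma block_diag_index:
  assumes "A \<in> carrier_mat N N" "B \<in> carrier_mat M M" "i < N + M" "j < N + M"
  shows "block_diag A B $$ (i, j) =
    (if i < N then if j < N then A $$ (i, j) else 0 else if j < N then 0 else B $$ (i - N, j - N))"
  using assms by (auto simp: block_diag_def)

lemma block_diag_mult: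
  assumes "A \<in> carrier_mat N N" "A' \<in> carrier_mat N N" "B \<in> carrier_mat M M" "B' \<in> carrier_mat M M"
  shows "block_diag A B * block_diag A' B' = block_diag (A * A') (B * B')"
  using assms unfolding block_diag_def
  by (subst mult_four_block_mat[of _ N N _ M _ M _ _ N _ M]) auto

lemma block_diag_one: "block_diag (1\<^sub>m N) (1\<^sub>m M) = 1\<^sub>m (N + M)"
  by (auto simp: block_diag_def)

lemma block_diag_GL:
  assumes "A \<in> GL N" "B \<in> GL M"
  shows "block_diag A B \<in> GL (N + M)"
proof -
  obtain A' B' where "A' \<in> carrier_mat N N" "A * A' = 1\<^sub>m N" "A' * A = 1\<^sub>m N"
      "B' \<in> carrier_mat M M" "B * B' = 1\<^sub>m M" "B' * B = 1\<^sub>m M"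
    using assms by (auto simp: GL_iff)
  then show ?thesis using assms
    by (auto simp: GL_iff block_diag_carrier block_diag_mult block_diag_one
        intro!: bexI[of _ "block_diag A' B'"])
qed

lemma sum_lessThan_add: "(\<Sum>c<N + M. f c) = (\<Sum>c<N. f c) + (\<Sum>d<M. f (N + d :: nat))"
  for f :: "nat \<Rightarrow> 'a::comm_monoid_add"
  by (induction M) (simp_all add: add.assoc)

lemma block_diag_OG:
  assumes A: "A \<in> OG N" and B: "B \<in> OG M"
  shows "block_diag A B \<in> OG (N + M)"
proof -
  note c = OG_carrier[OF A] OG_carrier[OF B]
  have "(\<Sum>k<N + M. block_diag A B $$ (k, i) * block_diag A B $$ (k, j)) = of_bool (i = j)"
    if ij: "i < N + M" "j < N + M" for i j
  proof -
    have "(\<Sum>k<N + M. block_diag A B $$ (k, i) * block_diag A B $$ (k, j)) =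
        (if i < N \<and> j < N then \<Sum>k<N. A $$ (k, i) * A $$ (k, j) else 0) +
        (if i < N \<or> j < N then 0 else \<Sum>k<M. B $$ (k, i - N) * B $$ (k, j - N))"
      unfolding sum_lessThan_add using ij
      by (cases "i < N"; cases "j < N") (simp_all add: block_diag_index[OF c])
    also have "\<dots> = of_bool (i = j)"
      using A B ij unfolding OG_iff by (cases "i < N"; cases "j < N") auto
    finally show ?thesis .
  qed
  then show ?thesis using c by (simp add: OG_iff block_diag_carrier)
qed

lemma one_OG: "1\<^sub>m L \<in> OG L"
  by (auto simp: OG_iff if_distrib[of "\<lambda>x. x * _"] cong: if_cong)

section \<open>Slices of a tensor by its letters below \<open>N\<close>\<close>

definition upper :: "nat \<Rightarrow> nat list \<Rightarrow> nat list" where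
  "upper N w = map (\<lambda>x. x - N) (filter (\<lambda>x. N \<le> x) w)"

text \<open>\<open>q\<close> is only a pattern, consisting of its letters below \<open>N\<close> and
  the places of the others, and \<open>u\<close> supplies the latter renumbered from 0. Meaningful
  when \<open>u\<close> is as long as \<open>upper N q\<close>.\<close>

fun fill :: "nat \<Rightarrow> nat list \<Rightarrow> nat list \<Rightarrow> nat list" where
  "fill N [] u = []"
| "fill N (x # q) u = (if x < N then x # fill N q u else (N + hd u) # fill N q (tl u))"

text \<open>The place in \<open>q\<close> of its \<open>i\<close>-th letter not below
  \<open>N\<close>, counting from 0. It translates an update of \<open>u\<close> into an update of
  \<open>fill N q u\<close>.\<close>

fun slot :: "nat \<Rightarrow> nat list \<Rightarrow> nat \<Rightarrow> nat" where
  "slot N [] i = 0"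
| "slot N (x # q) i = (if x < N then Suc (slot N q i)
     else case i of 0 \<Rightarrow> 0 | Suc j \<Rightarrow> Suc (slot N q j))"

lemma upper_Nil [simp]: "upper N [] = []"
  by (simp add: upper_def)

lemma upper_Cons [simp]: "upper N (x # w) = (if x < N then upper N w else (x - N) # upper N w)"
  by (auto simp: upper_def)

lemma fill_upper: "fill N w (upper N w) = w"
  by (induction w) auto

lemma upper_fill: "length u = length (upper N q) \<Longrightarrow> upper N (fill N q u) = u"
proof (induction q arbitrary: u)
  case (Cons x q)
  then show ?case by (cases u; cases "x < N") auto
qed simp

lemma fill_fill: "fill N (fill N q u) v = fill N q v"
  by (induction N q u arbitrary: v rule: fill.induct) auto

lemma upper_words: "w \<in> words (N + M) n \<Longrightarrow> upper N w \<in> words M (length (upper N w))"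
  by (auto simp: words_def upper_def subset_iff less_diff_conv2 add.commute)

lemma fill_words:
  "q \<in> words (N + M) n \<Longrightarrow> u \<in> words M (length (upper N q)) \<Longrightarrow> fill N q u \<in> words (N + M) n"
proof (induction q arbitrary: n u)
  case (Cons x q)
  then obtain n' where n: "n = Suc n'" by (cases n) (auto simp: words_def)
  with Cons.prems have q: "x < N + M" "q \<in> words (N + M) n'" by (auto simp: Cons_in_words)
  show ?case
  proof (cases "x < N")
    case True
    then show ?thesis using Cons q n by (simp add: Cons_in_words)
  next
    case False
    with Cons.prems obtain a u' where "u = a # u'" by (cases u) (auto simp: words_def)
    with False show ?thesis using Cons q n by (simp add: Cons_in_words)
  qed
qed (simp add: words_def)

text \<open>Writing \<open>N\<close> for all letters not below \<open>N\<close> is a normal form of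
  patterns: words with equal \<open>map (min N)\<close> have the same fillings.\<close>

lemma fill_min: "fill N (map (min N) q) u = fill N q u"
  by (induction N q u rule: fill.induct) auto

lemma map_min_fill: "map (min N) (fill N q u) = map (min N) q"
  by (induction N q u rule: fill.induct) auto

lemma slot_fill:
  assumes "i < length (upper N q)" "length u = length (upper N q)"
  shows "slot N q i < length q \<and> fill N q u ! slot N q i = N + u ! i \<and>
    fill N q (u[i := a]) = (fill N q u)[slot N q i := N + a]"
  using assms
proof (induction q arbitrary: u i)
  case (Cons x q)
  then show ?case
  proof (cases "x < N")
    case False
    with Cons.prems obtain b u' where "u = b # u'" by (cases u) auto
    with False Cons show ?thesis by (cases i) auto
  qed auto
qed simp

lemma slot_inj:
  assumes "i < length (upper N q)" "j < length (upper N q)" "i \<noteq> j"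
  shows "slot N q i \<noteq> slot N q j"
  using assms
proof (induction q arbitrary: i j)
  case (Cons x q)
  then show ?case by (cases i; cases j) (auto split: if_splits)
qed simp

lemma length_upper_update:
  "p < length w \<Longrightarrow> N \<le> w ! p \<Longrightarrow> c < N \<Longrightarrow> Suc (length (upper N (w[p := c]))) = length (upper N w)"
proof (induction w arbitrary: p)
  case (Cons x w)
  then show ?case by (cases p) auto
qed simp

text \<open>The identity block fixes the letters below \<open>N\<close>, so only words with the
  pattern of \<open>w\<close> contribute.\<close>

lemma sum_block_diag_one:
  assumes B: "B \<in> carrier_mat M M" and w: "w \<in> words (N + M) n"
  shows "(\<Sum>v\<in>words (N + M) n. mprod (block_diag (1\<^sub>m N) B) w v * y v) =
    (\<Sum>u\<in>words M (length (upper N w)). mprod B (upper N w) u * y (fill N w u))"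
  using w
proof (induction w arbitrary: n y)
  case Nil
  then have "n = 0" by (simp add: words_def)
  then show ?case by (simp add: words_0)
next
  case (Cons x w)
  then obtain n' where n: "n = Suc n'" by (cases n) (auto simp: words_def)
  with Cons.prems have x: "x < N + M" and w: "w \<in> words (N + M) n'" by (auto simp: Cons_in_words)
  let ?D = "block_diag (1\<^sub>m N) B"
  let ?S = "\<lambda>c. \<Sum>v\<in>words (N + M) n'. mprod ?D w v * y (c # v)"
  have D: "?D $$ (x, c) = (if x < N then of_bool (c = x) else if c < N then 0 else B $$ (x - N, c - N))"
    if "c < N + M" for c
    using x that B by (auto simp: block_diag_index[OF one_carrier_mat])
  have "(\<Sum>v\<in>words (N + M) n. mprod ?D (x # w) v * y v) = (\<Sum>c<N + M. ?D $$ (x, c) * ?S c)"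
    by (simp add: n sum_words_Suc sum_distrib_left mult.assoc)
  also have "\<dots> = (\<Sum>u\<in>words M (length (upper N (x # w))). mprod B (upper N (x # w)) u * y (fill N (x # w) u))"
  proof (cases "x < N")
    case True
    have "(\<Sum>c<N + M. ?D $$ (x, c) * ?S c) = (\<Sum>c<N + M. if c = x then ?S c else 0)"
      using True by (intro sum.cong) (auto simp: D)
    also have "\<dots> = ?S x" using x by simp
    also have "\<dots> = (\<Sum>u\<in>words M (length (upper N w)). mprod B (upper N w) u * y (x # fill N w u))"
      by (rule Cons.IH[OF w])
    finally show ?thesis using True by simp
  next
    case False
    have "(\<Sum>c<N + M. ?D $$ (x, c) * ?S c) = (\<Sum>d<M. B $$ (x - N, d) * ?S (N + d))"
      unfolding sum_lessThan_add using False by (simp add: D)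
    also have "\<dots> = (\<Sum>d<M. B $$ (x - N, d) *
        (\<Sum>u\<in>words M (length (upper N w)). mprod B (upper N w) u * y ((N + d) # fill N w u)))"
      by (intro sum.cong refl arg_cong2[of _ _ _ _ "(*)"] Cons.IH[OF w])
    finally show ?thesis using False by (simp add: sum_words_Suc sum_distrib_left mult.assoc)
  qed
  finally show ?case .
qed

text \<open>The infinitesimal counterpart of \<open>sum_block_diag_one\<close>: the constant
  identity block differentiates to the zero block.\<close>

lemma sum_lie_block_diag_zero:
  assumes X: "X \<in> carrier_mat M M" and w: "w \<in> words (N + M) n"
  shows "(\<Sum>i<n. \<Sum>a<N + M. block_diag (0\<^sub>m N N) X $$ (w ! i, a) * y (w[i := a])) =
    (\<Sum>i<length (upper N w). \<Sum>a<M. X $$ (upper N w ! i, a) * y (fill N w ((upper N w)[i := a])))"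
  using w
proof (induction w arbitrary: n y)
  case Nil
  then have "n = 0" by (simp add: words_def)
  then show ?case by simp
next
  case (Cons x w)
  then obtain n' where n: "n = Suc n'" by (cases n) (auto simp: words_def)
  with Cons.prems have x: "x < N + M" and w: "w \<in> words (N + M) n'" by (auto simp: Cons_in_words)
  let ?D = "block_diag (0\<^sub>m N N) X"
  have D: "?D $$ (x, c) = (if x < N \<or> c < N then 0 else X $$ (x - N, c - N))"
    if "c < N + M" for c
    using x that X by (auto simp: block_diag_index[OF zero_carrier_mat])
  have "(\<Sum>i<n. \<Sum>a<N + M. ?D $$ ((x # w) ! i, a) * y ((x # w)[i := a])) =
      (\<Sum>a<N + M. ?D $$ (x, a) * y (a # w)) + (\<Sum>i<n'. \<Sum>a<N + M. ?D $$ (w ! i, a) * y (x # w[i := a]))"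
    unfolding n by (subst sum.lessThan_Suc_shift) simp
  also have "(\<Sum>i<n'. \<Sum>a<N + M. ?D $$ (w ! i, a) * y (x # w[i := a])) =
      (\<Sum>i<length (upper N w). \<Sum>a<M. X $$ (upper N w ! i, a) * y (x # fill N w ((upper N w)[i := a])))"
    by (rule Cons.IH[OF w])
  also have "(\<Sum>a<N + M. ?D $$ (x, a) * y (a # w)) =
      (if x < N then 0 else \<Sum>a<M. X $$ (x - N, a) * y ((N + a) # w))"
    unfolding sum_lessThan_add by (simp add: D)
  finally show ?case
    by (cases "x < N")
      (simp_all add: fill_upper sum.lessThan_Suc_shift del: sum.lessThan_Suc)
qed

lemma mprod_block_diag_nonzero:
  assumes A: "A \<in> carrier_mat N N" and B: "B \<in> carrier_mat M M"
    and "w \<in> words (N + M) n" "v \<in> words (N + M) n" "mprod (block_diag A B) w v \<noteq> 0"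
  shows "length (upper N v) = length (upper N w)"
  using assms(3-)
proof (induction n arbitrary: w v)
  case 0
  then show ?case by (simp add: words_0)
next
  case (Suc n)
  then obtain a w' b v' where eq: "w = a # w'" "v = b # v'"
    by (metis words_length length_Suc_conv)
  with Suc.prems have "a < N + M" "b < N + M" "w' \<in> words (N + M) n" "v' \<in> words (N + M) n"
      "block_diag A B $$ (a, b) \<noteq> 0" "mprod (block_diag A B) w' v' \<noteq> 0"
    by (auto simp: Cons_in_words)
  then show ?case
    using Suc.IH[of w' v'] unfolding eq by (auto simp: block_diag_index[OF A B] split: if_splits)
qed

section \<open>Components by the number of letters not below \<open>N\<close>\<close>

lemma length_upper_le: "length (upper N w) \<le> length w"
  by (simp add: upper_def)

definition degree_part :: "nat \<Rightarrow> nat \<Rightarrow> tensor \<Rightarrow> tensor" where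
  "degree_part N m y = (\<lambda>w. if length (upper N w) = m then y w else 0)"

lemma degree_part_in_space: "y \<in> tensor_space L n \<Longrightarrow> degree_part N m y \<in> tensor_space L n"
  by (simp add: degree_part_def tensor_space_def)

text \<open>The diagonal matrix with 1 at coordinates below \<open>N\<close> and \<open>z\<close>
  elsewhere multiplies the component with \<open>k\<close> large letters by \<open>z ^ k\<close>.
  The image of \<open>y\<close> is a polynomial curve in \<open>z\<close> lying in \<open>V\<close>
  for all nonzero \<open>z\<close>, so its coefficients lie in \<open>V\<close>.\<close>

lemma degree_part_in_submodule:
  assumes V: "GL_submodule (N + M) V" "V \<subseteq> tensor_space (N + M) n" and y: "y \<in> V"
  shows "degree_part N m y \<in> V"
proof (cases "m \<le> n")
  case True
  have ysp: "y \<in> tensor_space (N + M) n" using V y by blast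
  show ?thesis
  proof (rule polynomial_curve_in_subspace[where x = "\<lambda>k. degree_part N k y" and S = "- {0}" and d = n, OF _ V(2)])
    show "tensor.subspace V" using V by (simp add: GL_submodule_def)
    show "degree_part N k y \<in> tensor_space (N + M) n" for k using ysp by (rule degree_part_in_space)
    show "infinite (- {0 :: complex})" by (simp add: Compl_eq_Diff_UNIV infinite_UNIV_char_0)
    fix z :: complex assume z: "z \<in> - {0}"
    let ?D = "diagonal (N + M) (\<lambda>i. if i < N then 1 else z)"
    have prod: "(\<Prod>i<length w. if w ! i < N then 1 else z) = z ^ length (upper N w)" for w
      by (induction w) (simp_all add: prod.lessThan_Suc_shift del: prod.lessThan_Suc)
    have "(\<Sum>k\<le>n. tscale (z ^ k) (degree_part N k y)) = grp_act ?D y"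
    proof (rule tensor_eqI)
      show "(\<Sum>k\<le>n. tscale (z ^ k) (degree_part N k y)) \<in> tensor_space (N + M) n"
        using ysp by (intro tensor.subspace_sum tensor.subspace_scale tensor_subspace_space degree_part_in_space)
      show "grp_act ?D y \<in> tensor_space (N + M) n"
        using ysp by (intro grp_act_in_space diagonal_carrier)
      fix w assume w: "w \<in> words (N + M) n"
      then have "length (upper N w) \<le> n" using length_upper_le[of N w] by (simp add: words_length)
      then have "(\<Sum>k\<le>n. tscale (z ^ k) (degree_part N k y)) w = z ^ length (upper N w) * y w"
        by (simp add: sum_tensor_apply tscale_def degree_part_def if_distrib[of "\<lambda>x. _ * x"] cong: if_cong)
      then show "(\<Sum>k\<le>n. tscale (z ^ k) (degree_part N k y)) w = grp_act ?D y w"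
        using prod[of w] w by (simp add: grp_act_diagonal[OF w] words_length)
    qed
    also have "\<dots> \<in> V"
    proof -
      have "?D \<in> GL (N + M)" using z by (intro diagonal_GL) auto
      then show ?thesis using V(1) y by (simp add: GL_submodule_def)
    qed
    finally show "(\<Sum>k\<le>n. tscale (z ^ k) (degree_part N k y)) \<in> V" .
  qed (rule True)
next
  case False
  have "degree_part N m y w = 0" for w
  proof (cases "w \<in> words (N + M) n")
    case True
    then show ?thesis using False length_upper_le[of N w] by (simp add: degree_part_def words_length)
  next
    case w: False
    then show ?thesis using V y by (auto simp: degree_part_def tensor_space_def)
  qed
  then have "degree_part N m y = 0" by (simp add: fun_eq_iff)
  then show ?thesis using V(1) tensor.subspace_0 by (simp add: GL_submodule_def)
qed

lemma degree_part_grp_act: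
  assumes A: "A \<in> carrier_mat N N" and B: "B \<in> carrier_mat M M" and y: "y \<in> tensor_space (N + M) n"
  shows "degree_part N m (grp_act (block_diag A B) y) = grp_act (block_diag A B) (degree_part N m y)"
proof (rule tensor_eqI)
  note D = block_diag_carrier[OF A B]
  show "degree_part N m (grp_act (block_diag A B) y) \<in> tensor_space (N + M) n"
    "grp_act (block_diag A B) (degree_part N m y) \<in> tensor_space (N + M) n"
    using D y by (auto intro: degree_part_in_space grp_act_in_space)
  fix w assume w: "w \<in> words (N + M) n"
  have "(if length (upper N w) = m then mprod (block_diag A B) w v * y v else 0) =
      mprod (block_diag A B) w v * degree_part N m y v" if "v \<in> words (N + M) n" for v
    using mprod_block_diag_nonzero[OF A B w that]
    by (cases "mprod (block_diag A B) w v = 0") (auto simp: degree_part_def)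
  then have "(\<Sum>v\<in>words (N + M) n. if length (upper N w) = m then mprod (block_diag A B) w v * y v else 0) =
      (\<Sum>v\<in>words (N + M) n. mprod (block_diag A B) w v * degree_part N m y v)"
    by (intro sum.cong refl)
  then show "degree_part N m (grp_act (block_diag A B) y) w = grp_act (block_diag A B) (degree_part N m y) w"
    unfolding grp_act_words[OF D w] by (auto simp: degree_part_def grp_act_words[OF D w])
qed

section \<open>Slices and their tracelessness\<close>

definition slice :: "nat \<Rightarrow> nat \<Rightarrow> nat list \<Rightarrow> tensor \<Rightarrow> tensor" where
  "slice N M q y = (\<lambda>u. if u \<in> words M (length (upper N q)) then y (fill N q u) else 0)"

lemma slice_in_space: "slice N M q y \<in> tensor_space M (length (upper N q))"
  by (simp add: slice_def tensor_space_def)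

lemma slice_grp_act:
  assumes B: "B \<in> carrier_mat M M" and q: "q \<in> words (N + M) n"
  shows "slice N M q (grp_act (block_diag (1\<^sub>m N) B) y) = grp_act B (slice N M q y)"
proof (rule tensor_eqI[OF slice_in_space grp_act_in_space[OF B slice_in_space]])
  fix u assume u: "u \<in> words M (length (upper N q))"
  then have len: "length u = length (upper N q)" by (simp add: words_length)
  have f: "fill N q u \<in> words (N + M) n" using q u by (rule fill_words)
  have "slice N M q (grp_act (block_diag (1\<^sub>m N) B) y) u = grp_act (block_diag (1\<^sub>m N) B) y (fill N q u)"
    using u by (simp add: slice_def)
  also have "\<dots> = (\<Sum>v\<in>words (N + M) n. mprod (block_diag (1\<^sub>m N) B) (fill N q u) v * y v)"
    using B f by (intro grp_act_words block_diag_carrier) auto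
  also have "\<dots> = (\<Sum>v\<in>words M (length (upper N q)). mprod B u v * y (fill N q v))"
    using sum_block_diag_one[OF B f] by (simp add: upper_fill[OF len] fill_fill len)
  also have "\<dots> = grp_act B (slice N M q y) u"
    unfolding grp_act_words[OF B u] by (simp add: slice_def)
  finally show "slice N M q (grp_act (block_diag (1\<^sub>m N) B) y) u = grp_act B (slice N M q y) u" .
qed

text \<open>A contraction over all \<open>N + M\<close> letters is the contraction of the slice plus terms having two
  letters \<open>\<ge> N\<close> fewer.\<close>

lemma slice_traceless:
  assumes y: "y \<in> traceless (N + M) n" and q: "q \<in> words (N + M) n"
    and vanish: "\<And>w. w \<in> words (N + M) n \<Longrightarrow> length (upper N w) + 2 = length (upper N q) \<Longrightarrow> y w = 0"
  shows "slice N M q y \<in> traceless M (length (upper N q))"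
proof -
  let ?k = "length (upper N q)"
  have "(\<Sum>a<M. slice N M q y (u[i := a, j := a])) = 0"
    if ij: "i < ?k" "j < ?k" "i \<noteq> j" and u: "u \<in> words M ?k" for i j u
  proof -
    have len: "length u = ?k" using u by (rule words_length)
    have x: "fill N q u \<in> words (N + M) n" using q u by (rule fill_words)
    define x where "x = fill N q u"
    define p p' where "p = slot N q i" and "p' = slot N q j"
    have lx: "length x = n" "length q = n" using x q by (auto simp: x_def words_length)
    have pp: "p < n" "p' < n" "p \<noteq> p'"
      using slot_fill[OF ij(1) len] slot_fill[OF ij(2) len] slot_inj[OF ij] lx by (auto simp: p_def p'_def)
    have big: "N \<le> x ! p" "N \<le> x ! p'"
      using slot_fill[OF ij(1) len] slot_fill[OF ij(2) len] by (auto simp: p_def p'_def x_def)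
    have "slice N M q y (u[i := a, j := a]) = y (x[p := N + a, p' := N + a])" if "a < M" for a
    proof -
      have "u[i := a, j := a] \<in> words M ?k" using u that by (simp add: words_update)
      moreover have "fill N q (u[i := a, j := a]) = x[p := N + a, p' := N + a]"
        using slot_fill[of j N q "u[i := a]" a] slot_fill[of i N q u a] ij len
        by (simp add: x_def p_def p'_def)
      ultimately show ?thesis by (simp add: slice_def)
    qed
    then have "(\<Sum>a<M. slice N M q y (u[i := a, j := a])) = (\<Sum>a<M. y (x[p := N + a, p' := N + a]))"
      by simp
    also have "\<dots> = (\<Sum>c<N. y (x[p := c, p' := c])) + (\<Sum>a<M. y (x[p := N + a, p' := N + a]))"
    proof -
      have "y (x[p := c, p' := c]) = 0" if c: "c < N" for c
      proof (rule vanish)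
        show "x[p := c, p' := c] \<in> words (N + M) n"
          using x c unfolding x_def by (intro words_update) auto
        have "Suc (length (upper N (x[p := c]))) = length (upper N x)"
          using pp lx big c by (intro length_upper_update) auto
        moreover have "Suc (length (upper N (x[p := c, p' := c]))) = length (upper N (x[p := c]))"
          using pp lx big c by (intro length_upper_update) auto
        moreover have "length (upper N x) = ?k" unfolding x_def upper_fill[OF len] by (rule len)
        ultimately show "length (upper N (x[p := c, p' := c])) + 2 = ?k" by simp
      qed
      then show ?thesis by simp
    qed
    also have "\<dots> = (\<Sum>c<N + M. y (x[p := c, p' := c]))"
      by (simp add: sum_lessThan_add)
    also have "\<dots> = 0"
      using y pp x unfolding x_def traceless_def by blast
    finally show ?thesis .
  qed
  then show ?thesis using slice_in_space by (simp add: traceless_def)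
qed

section \<open>The extension map\<close>

lemma lie_act_permute:
  assumes X: "X \<in> carrier_mat L L" and \<sigma>: "\<sigma> permutes {..<n}" and w: "w \<in> words L n"
  shows "lie_act X t (permute_list \<sigma> w) = lie_act X (\<lambda>v. t (permute_list \<sigma> v)) w"
proof -
  have len: "length w = n" using w by (rule words_length)
  have pw: "permute_list \<sigma> w \<in> words L n" using \<sigma> w by (simp add: words_permute_list)
  have upd: "(permute_list \<sigma> w)[i := a] = permute_list \<sigma> (w[\<sigma> i := a])" if "i < n" for i a
    using \<sigma> len permutes_inj[OF \<sigma>] permutes_in_image[OF \<sigma>] that
    by (auto simp: list_eq_iff_nth_eq permute_list_nth nth_list_update inj_eq)
  have "lie_act X t (permute_list \<sigma> w) =
      (\<Sum>i<n. \<Sum>a<L. X $$ (w ! \<sigma> i, a) * t (permute_list \<sigma> (w[\<sigma> i := a])))"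
    unfolding lie_act_words[OF X pw] using \<sigma> len by (simp add: permute_list_nth upd)
  also have "\<dots> = (\<Sum>i<n. \<Sum>a<L. X $$ (w ! i, a) * t (permute_list \<sigma> (w[i := a])))"
    using sum.permute[OF \<sigma>, of "\<lambda>i. \<Sum>a<L. X $$ (w ! i, a) * t (permute_list \<sigma> (w[i := a]))"]
    by (simp add: o_def)
  finally show ?thesis by (simp add: lie_act_words[OF X w])
qed

lemma lie_act_zero: "lie_act X 0 = 0"
  by (auto simp: lie_act_def fun_eq_iff)

text \<open>A combination of permutations of the factors, written into the slices with \<open>m\<close> letters \<open>\<ge> N\<close>;
  the coefficients may depend on the remaining letters.\<close>

definition spread :: "nat \<Rightarrow> nat \<Rightarrow> nat \<Rightarrow> nat \<Rightarrow> (nat list \<Rightarrow> (nat \<Rightarrow> nat) \<Rightarrow> complex) \<Rightarrow> tensor \<Rightarrow> tensor" where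
  "spread N M n m c t = (\<lambda>w. if w \<in> words (N + M) n \<and> length (upper N w) = m
     then \<Sum>\<rho> | \<rho> permutes {..<m}. c (map (min N) w) \<rho> * t (permute_list \<rho> (upper N w)) else 0)"

lemma spread_in_space: "spread N M n m c t \<in> tensor_space (N + M) n"
  by (simp add: spread_def tensor_space_def)

lemma spread_add: "spread N M n m c (s + t) = spread N M n m c s + spread N M n m c t"
  by (auto simp: spread_def fun_eq_iff distrib_left sum.distrib)

lemma spread_scale: "spread N M n m c (tscale a t) = tscale a (spread N M n m c t)"
  by (auto simp: spread_def fun_eq_iff tscale_def sum_distrib_left mult_ac)

lemma spread_fill:
  assumes "w \<in> words (N + M) n" "u \<in> words M (length (upper N w))"
  shows "spread N M n m c t (fill N w u) = (if length (upper N w) = m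
    then \<Sum>\<rho> | \<rho> permutes {..<m}. c (map (min N) w) \<rho> * t (permute_list \<rho> u) else 0)"
proof -
  have "length u = length (upper N w)" using assms(2) by (rule words_length)
  then show ?thesis using assms by (simp add: spread_def fill_words map_min_fill upper_fill)
qed

text \<open>Permutations of the factors commute with the tensor power of every matrix, and the
  coefficients depend only on the pattern, which \<open>block_diag (1\<^sub>m N) B\<close>
  preserves. Here equivariance passes from O_M to all matrices.\<close>

lemma spread_grp_act:
  assumes B: "B \<in> carrier_mat M M"
  shows "spread N M n m c (grp_act B t) = grp_act (block_diag (1\<^sub>m N) B) (spread N M n m c t)"
proof (rule tensor_eqI[OF spread_in_space])
  have D: "block_diag (1\<^sub>m N) B \<in> carrier_mat (N + M) (N + M)" using B by (intro block_diag_carrier) auto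
  show "grp_act (block_diag (1\<^sub>m N) B) (spread N M n m c t) \<in> tensor_space (N + M) n"
    using D by (intro grp_act_in_space spread_in_space)
  fix w assume w: "w \<in> words (N + M) n"
  let ?e = "upper N w" and ?c = "c (map (min N) w)"
  have e: "?e \<in> words M (length ?e)" using w by (rule upper_words)
  have "grp_act (block_diag (1\<^sub>m N) B) (spread N M n m c t) w =
      (\<Sum>u\<in>words M (length ?e). mprod B ?e u * spread N M n m c t (fill N w u))"
    unfolding grp_act_words[OF D w] by (rule sum_block_diag_one[OF B w])
  also have "\<dots> = (\<Sum>u\<in>words M (length ?e). mprod B ?e u * (if length ?e = m
      then \<Sum>\<rho> | \<rho> permutes {..<m}. ?c \<rho> * t (permute_list \<rho> u) else 0))"
    using w by (intro sum.cong refl) (simp add: spread_fill)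
  also have "\<dots> = spread N M n m c (grp_act B t) w"
  proof (cases "length ?e = m")
    case True
    then have e: "?e \<in> words M m" using e by simp
    have "(\<Sum>u\<in>words M m. mprod B ?e u * (\<Sum>\<rho> | \<rho> permutes {..<m}. ?c \<rho> * t (permute_list \<rho> u))) =
        (\<Sum>\<rho> | \<rho> permutes {..<m}. ?c \<rho> * (\<Sum>u\<in>words M m. mprod B ?e u * t (permute_list \<rho> u)))"
      unfolding sum_distrib_left by (subst sum.swap) (simp add: mult_ac)
    also have "\<dots> = (\<Sum>\<rho> | \<rho> permutes {..<m}. ?c \<rho> * grp_act B t (permute_list \<rho> ?e))"
      using e by (intro sum.cong refl) (simp add: grp_act_permute[OF B _ e] grp_act_words[OF B e])
    finally show ?thesis using True w by (simp add: spread_def)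
  qed (simp add: spread_def)
  finally show "spread N M n m c (grp_act B t) w = grp_act (block_diag (1\<^sub>m N) B) (spread N M n m c t) w"
    by simp
qed

lemma spread_lie_act:
  assumes X: "X \<in> carrier_mat M M"
  shows "spread N M n m c (lie_act X t) = lie_act (block_diag (0\<^sub>m N N) X) (spread N M n m c t)"
proof (rule tensor_eqI[OF spread_in_space])
  have D: "block_diag (0\<^sub>m N N) X \<in> carrier_mat (N + M) (N + M)" using X by (intro block_diag_carrier) auto
  show "lie_act (block_diag (0\<^sub>m N N) X) (spread N M n m c t) \<in> tensor_space (N + M) n"
    using D by (intro lie_act_in_space spread_in_space)
  fix w assume w: "w \<in> words (N + M) n"
  let ?e = "upper N w" and ?c = "c (map (min N) w)"
  have e: "?e \<in> words M (length ?e)" using w by (rule upper_words)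
  have "lie_act (block_diag (0\<^sub>m N N) X) (spread N M n m c t) w =
      (\<Sum>i<length ?e. \<Sum>a<M. X $$ (?e ! i, a) * spread N M n m c t (fill N w (?e[i := a])))"
    unfolding lie_act_words[OF D w] by (rule sum_lie_block_diag_zero[OF X w])
  also have "\<dots> = (\<Sum>i<length ?e. \<Sum>a<M. X $$ (?e ! i, a) * (if length ?e = m
      then \<Sum>\<rho> | \<rho> permutes {..<m}. ?c \<rho> * t (permute_list \<rho> (?e[i := a])) else 0))"
    using w e by (intro sum.cong refl) (simp add: spread_fill words_update)
  also have "\<dots> = spread N M n m c (lie_act X t) w"
  proof (cases "length ?e = m")
    case True
    then have e: "?e \<in> words M m" using e by simp
    have "(\<Sum>i<m. \<Sum>a<M. X $$ (?e ! i, a) * (\<Sum>\<rho> | \<rho> permutes {..<m}. ?c \<rho> * t (permute_list \<rho> (?e[i := a])))) =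
        (\<Sum>i<m. \<Sum>\<rho> | \<rho> permutes {..<m}. \<Sum>a<M. ?c \<rho> * (X $$ (?e ! i, a) * t (permute_list \<rho> (?e[i := a]))))"
      unfolding sum_distrib_left by (intro sum.cong refl, subst sum.swap) (simp add: mult_ac)
    also have "\<dots> = (\<Sum>\<rho> | \<rho> permutes {..<m}. ?c \<rho> * (\<Sum>i<m. \<Sum>a<M. X $$ (?e ! i, a) * t (permute_list \<rho> (?e[i := a]))))"
      unfolding sum_distrib_left by (rule sum.swap)
    also have "\<dots> = (\<Sum>\<rho> | \<rho> permutes {..<m}. ?c \<rho> * lie_act X t (permute_list \<rho> ?e))"
      using e by (intro sum.cong refl) (simp add: lie_act_permute[OF X _ e] lie_act_words[OF X e])
    finally show ?thesis using True w by (simp add: spread_def)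
  qed (simp add: spread_def)
  finally show "spread N M n m c (lie_act X t) w = lie_act (block_diag (0\<^sub>m N N) X) (spread N M n m c t) w"
    by simp
qed

section \<open>Spaces of equivariant maps\<close>

lemma Hom_D:
  assumes "f \<in> Hom G \<rho> \<sigma> V W"
  shows "\<And>t. t \<in> V \<Longrightarrow> f t \<in> W" "\<And>s t. s \<in> V \<Longrightarrow> t \<in> V \<Longrightarrow> f (s + t) = f s + f t"
    "\<And>c t. t \<in> V \<Longrightarrow> f (tscale c t) = tscale c (f t)" "\<And>t. t \<notin> V \<Longrightarrow> f t = 0"
    "\<And>g t. g \<in> G \<Longrightarrow> t \<in> V \<Longrightarrow> f (\<rho> g t) = \<sigma> g (f t)"
  using assms by (auto simp: Hom_def linear_map_on_def)

lemma Hom_I: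
  assumes "\<And>t. t \<in> V \<Longrightarrow> f t \<in> W" "\<And>s t. s \<in> V \<Longrightarrow> t \<in> V \<Longrightarrow> f (s + t) = f s + f t"
    "\<And>c t. t \<in> V \<Longrightarrow> f (tscale c t) = tscale c (f t)" "\<And>t. t \<notin> V \<Longrightarrow> f t = 0"
    "\<And>g t. g \<in> G \<Longrightarrow> t \<in> V \<Longrightarrow> f (\<rho> g t) = \<sigma> g (f t)"
  shows "f \<in> Hom G \<rho> \<sigma> V W"
  using assms by (auto simp: Hom_def linear_map_on_def)

lemma Hom_add:
  assumes f: "f \<in> Hom G \<rho> \<sigma> V W" and f': "f' \<in> Hom G \<rho> \<sigma> V W" and W: "tensor.subspace W"
    and \<sigma>: "\<And>g x y. \<sigma> g (x + y) = \<sigma> g x + \<sigma> g y"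
  shows "f + f' \<in> Hom G \<rho> \<sigma> V W"
proof (rule Hom_I)
  fix s t assume st: "s \<in> V" "t \<in> V"
  show "(f + f') (s + t) = (f + f') s + (f + f') t"
    unfolding plus_fun_apply Hom_D(2)[OF f st] Hom_D(2)[OF f' st] by (simp only: add.assoc add.left_commute)
next
  fix c t assume t: "t \<in> V"
  show "(f + f') (tscale c t) = tscale c ((f + f') t)"
    unfolding plus_fun_apply Hom_D(3)[OF f t] Hom_D(3)[OF f' t] tensor.scale_right_distrib ..
qed (use Hom_D[OF f] Hom_D[OF f'] tensor.subspace_add[OF W] \<sigma> in \<open>auto simp: plus_fun_apply\<close>)

lemma Hom_hscale:
  assumes f: "f \<in> Hom G \<rho> \<sigma> V W" and W: "tensor.subspace W"
    and \<sigma>: "\<And>g x. \<sigma> g (tscale c x) = tscale c (\<sigma> g x)"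
  shows "hscale c f \<in> Hom G \<rho> \<sigma> V W"
proof (rule Hom_I)
  fix s t assume st: "s \<in> V" "t \<in> V"
  show "hscale c f (s + t) = hscale c f s + hscale c f t"
    unfolding hscale_def Hom_D(2)[OF f st] tensor.scale_right_distrib ..
next
  fix a t assume t: "t \<in> V"
  show "hscale c f (tscale a t) = tscale a (hscale c f t)"
    unfolding hscale_def Hom_D(3)[OF f t] tensor.scale_scale by (simp only: mult.commute)
next
  fix t assume t: "t \<notin> V"
  show "hscale c f t = 0"
    unfolding hscale_def Hom_D(4)[OF f t] by (rule tensor.scale_zero_right)
qed (use Hom_D[OF f] tensor.subspace_scale[OF W] \<sigma> in \<open>auto simp: hscale_def\<close>)

lemma Hom_zero:
  assumes "tensor.subspace W" "\<And>g. \<sigma> g 0 = 0"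
  shows "0 \<in> Hom G \<rho> \<sigma> V W"
  using assms tensor.subspace_0[OF assms(1)] tensor.scale_zero_right
  by (intro Hom_I) (simp_all only: zero_fun_apply add_0)

section \<open>Extending maps from \<open>W_mu\<close> to \<open>V_mu\<close>\<close>

locale branching =
  fixes N M n m :: nat and V_lam V_mu :: "tensor set"
  assumes V_lam: "GL_submodule (N + M) V_lam" "V_lam \<subseteq> tensor_space (N + M) n"
    and V_mu: "GL_irreducible M V_mu" "V_mu \<subseteq> tensor_space M m"
begin

abbreviation "W_lam \<equiv> V_lam \<inter> traceless (N + M) n"
abbreviation "W_mu \<equiv> V_mu \<inter> traceless M m"
text \<open>Irreducibility of \<open>V_mu\<close> refers to the group, so extensions are
  characterised inside \<open>Hom_GL\<close>; membership in \<open>Hom_gl\<close> is read off their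
  explicit formula.\<close>

abbreviation "Hom_GL \<equiv> Hom (GL M) grp_act (\<lambda>B. grp_act (block_diag (1\<^sub>m N) B)) V_mu V_lam"

lemma V_mu_submodule: "GL_submodule M V_mu"
  using V_mu(1) unfolding GL_irreducible_def by (rule conjunct1)

lemma subspaces:
  "tensor.subspace V_lam" "tensor.subspace V_mu" "tensor.subspace W_lam" "tensor.subspace W_mu"
proof -
  show "tensor.subspace V_lam" "tensor.subspace V_mu"
    using V_lam(1) V_mu_submodule unfolding GL_submodule_def by blast+
  then show "tensor.subspace W_lam" "tensor.subspace W_mu"
    using tensor.subspace_inter traceless_subspace by simp_all
qed

lemma V_mu_GL: "A \<in> GL M \<Longrightarrow> t \<in> V_mu \<Longrightarrow> grp_act A t \<in> V_mu"
  using V_mu_submodule unfolding GL_submodule_def by blast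

lemma V_lam_GL: "A \<in> GL (N + M) \<Longrightarrow> t \<in> V_lam \<Longrightarrow> grp_act A t \<in> V_lam"
  using V_lam(1) unfolding GL_submodule_def by blast

lemma W_mu_OG: "A \<in> OG M \<Longrightarrow> t \<in> W_mu \<Longrightarrow> grp_act A t \<in> W_mu"
  using V_mu_GL[OF OG_GL] traceless_grp_act by blast

text \<open>The form in which irreducibility is used: to spread a property from \<open>W_mu\<close>
  to \<open>V_mu\<close>, once for uniqueness of extensions and once to keep their values in
  \<open>V_lam\<close>.\<close>

lemma irreducible:
  assumes K: "GL_submodule M {t \<in> V_mu. P t}" and "W_mu \<noteq> {0}" "\<And>t. t \<in> W_mu \<Longrightarrow> P t" and t: "t \<in> V_mu"
  shows "P t"
proof -
  let ?K = "{t \<in> V_mu. P t}"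
  obtain s where s: "s \<in> W_mu" "s \<noteq> 0"
    using assms(2) tensor.subspace_0[OF subspaces(4)] by blast
  then have "s \<in> ?K" using assms(3) by simp
  then have "?K \<noteq> {0}" using s(2) by blast
  moreover have "?K \<subseteq> V_mu \<and> GL_submodule M ?K \<longrightarrow> ?K = {0} \<or> ?K = V_mu"
    using V_mu(1) unfolding GL_irreducible_def by (elim conjE) (rule spec)
  ultimately have "?K = V_mu" using K by simp
  with t show ?thesis by blast
qed

lemma slice_equivariant_map:
  assumes f: "f \<in> Hom_OG N M W_mu W_lam" and q: "q \<in> words (N + M) n"
  shows "equivariant_map M m (length (upper N q)) W_mu (\<lambda>t. slice N M q (f t))"
proof
  note f = f[unfolded Hom_OG_def]
  show "tensor.subspace W_mu" by (rule subspaces)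
  show "W_mu \<subseteq> traceless M m" by blast
  show "grp_act A t \<in> W_mu" if "A \<in> OG M" "t \<in> W_mu" for A t using that by (rule W_mu_OG)
  show "linear_map_on tscale tscale W_mu (tensor_space M (length (upper N q))) (\<lambda>t. slice N M q (f t))"
    unfolding linear_map_on_def
  proof (intro conjI ballI allI image_subsetI slice_in_space)
    fix x y assume xy: "x \<in> W_mu" "y \<in> W_mu"
    show "slice N M q (f (x + y)) = slice N M q (f x) + slice N M q (f y)"
      unfolding Hom_D(2)[OF f xy] by (auto simp: slice_def fun_eq_iff)
  next
    fix c x assume x: "x \<in> W_mu"
    show "slice N M q (f (tscale c x)) = tscale c (slice N M q (f x))"
      unfolding Hom_D(3)[OF f x] by (auto simp: slice_def fun_eq_iff tscale_def)
  qed
  show "slice N M q (f (grp_act A t)) = grp_act A (slice N M q (f t))" if "A \<in> OG M" "t \<in> W_mu" for A t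
    unfolding Hom_D(5)[OF f that] using OG_carrier[OF that(1)] q by (rule slice_grp_act)
qed

lemma slice_upper: "w \<in> words (N + M) n \<Longrightarrow> slice N M w y (upper N w) = y w"
  using upper_words by (simp add: slice_def fill_upper)

text \<open>Induction on the number of large letters in a word. Above \<open>m\<close>, the
  induction hypothesis for words with two large letters fewer makes the slice traceless, and
  \<open>eq_0_if_greater\<close> applies.\<close>

lemma determined_by_degree_part:
  assumes f: "f \<in> Hom_OG N M W_mu W_lam" and deg: "\<And>t. t \<in> W_mu \<Longrightarrow> degree_part N m (f t) = 0"
    and t: "t \<in> W_mu"
  shows "f t = 0"
proof -
  have zero: "f t w = 0" if "w \<in> words (N + M) n" for w
    using that
  proof (induction "length (upper N w)" arbitrary: w rule: less_induct)
    case less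
    note w = less.prems
    let ?k = "length (upper N w)"
    interpret equivariant_map M m ?k W_mu "\<lambda>t. slice N M w (f t)"
      using f w by (rule slice_equivariant_map)
    consider "?k = m" | "?k < m" | "m < ?k" by linarith
    then show ?case
    proof cases
      case 1
      then show ?thesis using fun_cong[OF deg[OF t], of w] by (simp add: degree_part_def)
    next
      case 2
      then have "slice N M w (f t) = 0" using t by (rule eq_0_if_less)
      then show ?thesis using slice_upper[OF w, of "f t"] by simp
    next
      case 3
      have "f t \<in> traceless (N + M) n" using Hom_D(1)[OF f[unfolded Hom_OG_def] t] by blast
      then have "slice N M w (f t) \<in> traceless M ?k"
        using w
      proof (rule slice_traceless)
        show "f t v = 0" if "v \<in> words (N + M) n" "length (upper N v) + 2 = ?k" for v
          using that by (intro less.hyps) auto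
      qed
      with 3 t have "slice N M w (f t) = 0" by (rule eq_0_if_greater)
      then show ?thesis using slice_upper[OF w, of "f t"] by simp
    qed
  qed
  have "f t \<in> tensor_space (N + M) n"
    using Hom_D(1)[OF f[unfolded Hom_OG_def] t] V_lam(2) by blast
  then show ?thesis
    using zero by (auto intro!: tensor_eqI[of _ "N + M" n] simp: tensor_space_def)
qed

lemma extension_unique:
  assumes F: "F \<in> Hom_GL" and F': "F' \<in> Hom_GL" and W: "W_mu \<noteq> {0}"
    and eq: "\<And>t. t \<in> W_mu \<Longrightarrow> F t = F' t"
  shows "F = F'"
proof
  fix t
  show "F t = F' t"
  proof (cases "t \<in> V_mu")
    case True
    have "GL_submodule M {t \<in> V_mu. F t = F' t}"
      unfolding GL_submodule_def tensor.subspace_def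
      using Hom_D(2,3,5)[OF F] Hom_D(2,3,5)[OF F'] V_mu_GL subspaces(2)
        tensor.subspace_add[OF subspaces(2)] tensor.subspace_scale[OF subspaces(2)]
        tensor.subspace_0[OF subspaces(4)] eq by auto
    then show ?thesis using W eq True by (rule irreducible)
  next
    case False
    show ?thesis unfolding Hom_D(4)[OF F False] Hom_D(4)[OF F' False] ..
  qed
qed

lemma extension_exists:
  assumes f: "f \<in> Hom_OG N M W_mu W_lam" and W: "W_mu \<noteq> {0}"
  shows "\<exists>F. F \<in> Hom_GL \<and> F \<in> Hom_gl N M V_mu V_lam \<and> (\<forall>t\<in>W_mu. F t = degree_part N m (f t))"
proof -
  let ?R = "{\<rho>. \<rho> permutes {..<m}}"
  \<comment> \<open>Coefficients are chosen once for each pattern \<open>r\<close>, from the slice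
    at one representative: the values of \<open>f t\<close> at all words with this pattern are
    coordinates of that slice.\<close>
  have "\<exists>c. \<forall>q\<in>words (N + M) n. map (min N) q = r \<and> length (upper N q) = m \<longrightarrow>
      (\<forall>t\<in>W_mu. f t q = (\<Sum>\<rho>\<in>?R. c \<rho> * t (permute_list \<rho> (upper N q))))" for r
  proof (cases "\<exists>q\<in>words (N + M) n. map (min N) q = r \<and> length (upper N q) = m")
    case True
    then obtain q where q: "q \<in> words (N + M) n" "map (min N) q = r" "length (upper N q) = m" by blast
    have "equivariant_map M m m W_mu (\<lambda>t. slice N M q (f t))"
      using slice_equivariant_map[OF f q(1)] q(3) by simp
    from equivariant_map_permutations[OF this]
    obtain c where c: "\<forall>t\<in>W_mu. \<forall>u\<in>words M m.
        slice N M q (f t) u = (\<Sum>\<rho>\<in>?R. c \<rho> * t (permute_list \<rho> u))"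
      by (rule exE)
    have "f t q' = (\<Sum>\<rho>\<in>?R. c \<rho> * t (permute_list \<rho> (upper N q')))"
      if q': "q' \<in> words (N + M) n" "map (min N) q' = r" "length (upper N q') = m" and t: "t \<in> W_mu" for q' t
    proof -
      have e: "upper N q' \<in> words M m" using upper_words[OF q'(1)] q'(3) by simp
      have "fill N q (upper N q') = fill N q' (upper N q')"
        using fill_min[of N q] fill_min[of N q'] q(2) q'(2) by metis
      then have "slice N M q (f t) (upper N q') = f t q'"
        using e q(3) by (simp add: slice_def fill_upper)
      then show ?thesis using c t e by simp
    qed
    then show ?thesis by blast
  qed blast
  then have "\<exists>c. \<forall>r. \<forall>q\<in>words (N + M) n. map (min N) q = r \<and> length (upper N q) = m \<longrightarrow>
      (\<forall>t\<in>W_mu. f t q = (\<Sum>\<rho>\<in>?R. c r \<rho> * t (permute_list \<rho> (upper N q))))"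
    by (intro choice allI)
  then obtain c where c: "\<And>q t. q \<in> words (N + M) n \<Longrightarrow> length (upper N q) = m \<Longrightarrow> t \<in> W_mu \<Longrightarrow>
      f t q = (\<Sum>\<rho>\<in>?R. c (map (min N) q) \<rho> * t (permute_list \<rho> (upper N q)))"
    by blast
  let ?T = "spread N M n m c"
  have ext: "?T t = degree_part N m (f t)" if t: "t \<in> W_mu" for t
  proof (rule tensor_eqI[OF spread_in_space degree_part_in_space])
    show "f t \<in> tensor_space (N + M) n"
      using Hom_D(1)[OF f[unfolded Hom_OG_def] t] V_lam(2) by blast
    show "?T t w = degree_part N m (f t) w" if "w \<in> words (N + M) n" for w
      using that c[OF that _ t] by (simp add: spread_def degree_part_def)
  qed
  have T0: "?T 0 = 0" by (auto simp: spread_def fun_eq_iff)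
  have D: "block_diag (1\<^sub>m N) A \<in> GL (N + M)" if "A \<in> GL M" for A
    using that OG_GL[OF one_OG] by (intro block_diag_GL)
  \<comment> \<open>On \<open>W_mu\<close> the values are components of elements of
    \<open>V_lam\<close>; equivariance under GL_M and irreducibility carry this to
    \<open>V_mu\<close>.\<close>
  have V: "?T t \<in> V_lam" if t: "t \<in> V_mu" for t
  proof (rule irreducible[OF _ W _ t])
    show "GL_submodule M {t \<in> V_mu. ?T t \<in> V_lam}"
      unfolding GL_submodule_def tensor.subspace_def
    proof (intro conjI ballI allI CollectI)
      show "0 \<in> V_mu" using subspaces(2) by (rule tensor.subspace_0)
      show "?T 0 \<in> V_lam" unfolding T0 using subspaces(1) by (rule tensor.subspace_0)
      fix s assume s: "s \<in> {t \<in> V_mu. ?T t \<in> V_lam}"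
      then show "tscale a s \<in> V_mu" "?T (tscale a s) \<in> V_lam" for a
        unfolding spread_scale using subspaces(1,2) tensor.subspace_scale by blast+
      show "grp_act A s \<in> V_mu" "?T (grp_act A s) \<in> V_lam" if "A \<in> GL M" for A
        unfolding spread_grp_act[OF GL_carrier[OF that]] using s V_mu_GL[OF that] V_lam_GL[OF D[OF that]]
        by blast+
      fix t assume "t \<in> {t \<in> V_mu. ?T t \<in> V_lam}"
      with s show "s + t \<in> V_mu" "?T (s + t) \<in> V_lam"
        unfolding spread_add using subspaces(1,2) tensor.subspace_add by blast+
    qed
    show "?T t \<in> V_lam" if "t \<in> W_mu" for t
      unfolding ext[OF that] using Hom_D(1)[OF f[unfolded Hom_OG_def] that]
      by (intro degree_part_in_submodule[OF V_lam]) blast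
  qed
  define F where "F = (\<lambda>t. if t \<in> V_mu then ?T t else 0)"
  have lie: "lie_act X t \<in> V_mu" if "X \<in> carrier_mat M M" "t \<in> V_mu" for X t
    using GL_submodule_lie_act[OF V_mu_submodule V_mu(2) that] .
  \<comment> \<open>Stated for arbitrary actions, to be used once for the group and once for the Lie
    algebra.\<close>
  have "F \<in> Hom G \<rho> \<sigma> V_mu V_lam"
    if "\<And>g t. g \<in> G \<Longrightarrow> t \<in> V_mu \<Longrightarrow> \<rho> g t \<in> V_mu \<and> ?T (\<rho> g t) = \<sigma> g (?T t)" for G :: "complex mat set" and \<rho> \<sigma>
    using that V subspaces(2)
    by (intro Hom_I) (simp_all add: F_def spread_add spread_scale tensor.subspace_add tensor.subspace_scale)
  then have "F \<in> Hom_GL" "F \<in> Hom_gl N M V_mu V_lam"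
    unfolding Hom_gl_def using V_mu_GL lie by (simp_all add: spread_grp_act GL_carrier spread_lie_act)
  moreover have "\<forall>t\<in>W_mu. F t = degree_part N m (f t)"
    using ext by (simp add: F_def)
  ultimately show ?thesis by blast
qed

lemma block_commute:
  assumes "A \<in> carrier_mat N N" "B \<in> carrier_mat M M"
  shows "grp_act (block_diag A (1\<^sub>m M)) (grp_act (block_diag (1\<^sub>m N) B) t) =
    grp_act (block_diag (1\<^sub>m N) B) (grp_act (block_diag A (1\<^sub>m M)) t)"
proof -
  let ?A = "block_diag A (1\<^sub>m M)" and ?B = "block_diag (1\<^sub>m N) B"
  have c: "?A \<in> carrier_mat (N + M) (N + M)" "?B \<in> carrier_mat (N + M) (N + M)"
    using assms by (simp_all add: block_diag_carrier)
  have "?A * ?B = ?B * ?A"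
    using assms by (simp add: block_diag_mult[of _ N _ _ M])
  then show ?thesis
    unfolding grp_act_mult[OF c, symmetric] grp_act_mult[OF c(2,1), symmetric] by simp
qed

lemma hom_act_Hom:
  assumes f: "f \<in> Hom G \<rho> (\<lambda>B. grp_act (block_diag (1\<^sub>m N) B)) V U" and A: "A \<in> carrier_mat N N"
    and G: "G \<subseteq> carrier_mat M M" and U: "\<And>t. t \<in> U \<Longrightarrow> grp_act (block_diag A (1\<^sub>m M)) t \<in> U"
  shows "hom_act M A f \<in> Hom G \<rho> (\<lambda>B. grp_act (block_diag (1\<^sub>m N) B)) V U"
proof (rule Hom_I)
  show "hom_act M A f t \<in> U" if "t \<in> V" for t
    unfolding hom_act_def by (rule U) (rule Hom_D(1)[OF f that])
  show "hom_act M A f (s + t) = hom_act M A f s + hom_act M A f t" if "s \<in> V" "t \<in> V" for s t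
    unfolding hom_act_def Hom_D(2)[OF f that] by (rule grp_act_add)
  show "hom_act M A f (tscale c t) = tscale c (hom_act M A f t)" if "t \<in> V" for c t
    unfolding hom_act_def Hom_D(3)[OF f that] by (rule grp_act_scale)
  show "hom_act M A f t = 0" if "t \<notin> V" for t
    unfolding hom_act_def Hom_D(4)[OF f that] by (rule grp_act_zero)
  show "hom_act M A f (\<rho> B t) = grp_act (block_diag (1\<^sub>m N) B) (hom_act M A f t)" if "B \<in> G" "t \<in> V" for B t
    unfolding hom_act_def Hom_D(5)[OF f that] using G that A by (intro block_commute) auto
qed

lemma Hom_OG_zero:
  assumes "W_mu = {0}" "f \<in> Hom_OG N M W_mu W_lam"
  shows "f = 0"
proof
  fix t
  note f = assms(2)[unfolded Hom_OG_def]
  have lin: "linear_map_on tscale tscale W_mu W_lam f" using f by (simp add: Hom_def)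
  show "f t = 0 t"
  proof (cases "t \<in> W_mu")
    case True
    then have "t = 0" using assms(1) by blast
    then show ?thesis using linear_map_on_0[OF lin subspaces(4)] by simp
  next
    case False
    then show ?thesis using Hom_D(4)[OF f] by simp
  qed
qed

text \<open>A description by uniqueness avoids a choice of coefficients. For
  \<open>W_mu = {0}\<close> the condition would hold for every element of \<open>Hom_GL\<close>, so
  the value 0 is prescribed.\<close>

definition extend :: "(tensor \<Rightarrow> tensor) \<Rightarrow> tensor \<Rightarrow> tensor" where
  "extend f = (if W_mu = {0} then 0
     else THE F. F \<in> Hom_GL \<and> (\<forall>t\<in>W_mu. F t = degree_part N m (f t)))"

lemma extend_eqI:
  assumes "W_mu \<noteq> {0}" "F \<in> Hom_GL" "\<And>t. t \<in> W_mu \<Longrightarrow> F t = degree_part N m (f t)"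
  shows "extend f = F"
proof -
  have "(THE F. F \<in> Hom_GL \<and> (\<forall>t\<in>W_mu. F t = degree_part N m (f t))) = F"
  proof (rule the_equality)
    show "F' = F" if "F' \<in> Hom_GL \<and> (\<forall>t\<in>W_mu. F' t = degree_part N m (f t))" for F'
      using that assms by (intro extension_unique) auto
  qed (use assms in blast)
  then show ?thesis using assms(1) by (simp add: extend_def)
qed

lemma extend:
  assumes "f \<in> Hom_OG N M W_mu W_lam" "W_mu \<noteq> {0}"
  shows "extend f \<in> Hom_GL" "extend f \<in> Hom_gl N M V_mu V_lam"
    "\<And>t. t \<in> W_mu \<Longrightarrow> extend f t = degree_part N m (f t)"
proof -
  obtain F where F: "F \<in> Hom_GL" "F \<in> Hom_gl N M V_mu V_lam" "\<And>t. t \<in> W_mu \<Longrightarrow> F t = degree_part N m (f t)"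
    using extension_exists[OF assms] by blast
  have "extend f = F" using assms(2) F(1,3) by (rule extend_eqI)
  then show "extend f \<in> Hom_GL" "extend f \<in> Hom_gl N M V_mu V_lam"
    "\<And>t. t \<in> W_mu \<Longrightarrow> extend f t = degree_part N m (f t)" using F by simp_all
qed

text \<open>Sums and multiples of extensions satisfy the conditions that characterise the extensions
  of sums and multiples.\<close>

lemma extend_linear: "linear_map_on hscale hscale (Hom_OG N M W_mu W_lam) (Hom_gl N M V_mu V_lam) extend"
proof (cases "W_mu = {0}")
  case True
  have "0 \<in> Hom_gl N M V_mu V_lam"
    unfolding Hom_gl_def using subspaces(1) lie_act_zero by (rule Hom_zero)
  moreover have "extend f = 0" for f using True by (simp add: extend_def)
  moreover have "hscale c 0 = 0" for c by (auto simp: hscale_def fun_eq_iff tscale_def)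
  ultimately show ?thesis unfolding linear_map_on_def by (simp only: image_subset_iff add_0) blast
next
  case False
  show ?thesis
    unfolding linear_map_on_def
  proof (intro conjI ballI allI image_subsetI)
    fix f assume f: "f \<in> Hom_OG N M W_mu W_lam"
    show "extend f \<in> Hom_gl N M V_mu V_lam" by (rule extend[OF f False])
    show "extend (hscale c f) = hscale c (extend f)" for c
    proof (rule extend_eqI[OF False])
      show "hscale c (extend f) \<in> Hom_GL"
        using extend(1)[OF f False] subspaces(1) grp_act_scale by (rule Hom_hscale)
      show "hscale c (extend f) t = degree_part N m (hscale c f t)" if "t \<in> W_mu" for t
        unfolding hscale_def extend(3)[OF f False that] by (auto simp: degree_part_def tscale_def fun_eq_iff)
    qed
    fix f' assume f': "f' \<in> Hom_OG N M W_mu W_lam"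
    show "extend (f + f') = extend f + extend f'"
    proof (rule extend_eqI[OF False])
      show "extend f + extend f' \<in> Hom_GL"
        using extend(1)[OF f False] extend(1)[OF f' False] subspaces(1) grp_act_add by (rule Hom_add)
      show "(extend f + extend f') t = degree_part N m ((f + f') t)" if "t \<in> W_mu" for t
        unfolding plus_fun_apply extend(3)[OF f False that] extend(3)[OF f' False that]
        by (auto simp: degree_part_def fun_eq_iff)
    qed
  qed
qed

lemma extend_inj: "inj_on extend (Hom_OG N M W_mu W_lam)"
proof (cases "W_mu = {0}")
  case True
  show ?thesis
  proof (rule inj_onI)
    fix f g assume f: "f \<in> Hom_OG N M W_mu W_lam" and g: "g \<in> Hom_OG N M W_mu W_lam"
    show "f = g" unfolding Hom_OG_zero[OF True f] Hom_OG_zero[OF True g] ..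
  qed
next
  case False
  show ?thesis
  proof (rule inj_onI)
    fix f g assume f: "f \<in> Hom_OG N M W_mu W_lam" and g: "g \<in> Hom_OG N M W_mu W_lam"
      and eq: "extend f = extend g"
    \<comment> \<open>The difference, written with the operations under which the space of maps is
      closed; its component with \<open>m\<close> large letters vanishes on
      \<open>W_mu\<close>.\<close>
    let ?h = "f + hscale (- 1) g"
    have h: "?h \<in> Hom_OG N M W_mu W_lam"
      using f g unfolding Hom_OG_def
      by (intro Hom_add Hom_hscale subspaces grp_act_add grp_act_scale)
    have ht: "?h t = f t - g t" for t
      by (auto simp: hscale_def tscale_def fun_eq_iff)
    have deg: "degree_part N m (?h t) = 0" if t: "t \<in> W_mu" for t
    proof -
      have eq': "degree_part N m (f t) = degree_part N m (g t)"
        using extend(3)[OF f False t] extend(3)[OF g False t] eq by simp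
      have "f t w = g t w" if "length (upper N w) = m" for w
        using fun_cong[OF eq', of w] that by (simp add: degree_part_def)
      then have "degree_part N m (f t - g t) w = 0" for w
        by (cases "length (upper N w) = m") (simp_all add: degree_part_def)
      then show ?thesis unfolding ht by (intro ext) simp
    qed
    have z: "?h t = 0" if "t \<in> W_mu" for t
      by (rule determined_by_degree_part[OF h], rule deg, assumption, rule that)
    show "f = g"
    proof
      fix t
      show "f t = g t"
      proof (cases "t \<in> W_mu")
        case True
        show ?thesis using z[OF True] unfolding ht by (simp only: right_minus_eq)
      next
        case False
        show ?thesis
          unfolding Hom_D(4)[OF f[unfolded Hom_OG_def] False] Hom_D(4)[OF g[unfolded Hom_OG_def] False] ..
      qed
    qed
  qed
qed

text \<open>O_N commutes with GL_M and preserves the number of large letters, so acting on the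
  extension of \<open>f\<close> gives a map with the defining properties of the extension of
  \<open>hom_act M A f\<close>.\<close>

lemma extend_hom_act:
  assumes A: "A \<in> OG N" and f: "f \<in> Hom_OG N M W_mu W_lam"
  shows "extend (hom_act M A f) = hom_act M A (extend f)"
proof (cases "W_mu = {0}")
  case True
  then show ?thesis by (auto simp: extend_def hom_act_def grp_act_def fun_eq_iff)
next
  case False
  note Ac = OG_carrier[OF A]
  have "hom_act M A (extend f) \<in> Hom_GL"
    using extend(1)[OF f False] Ac
  proof (rule hom_act_Hom)
    show "GL M \<subseteq> carrier_mat M M" using GL_carrier by blast
    have "block_diag A (1\<^sub>m M) \<in> GL (N + M)"
      using A one_OG by (intro OG_GL block_diag_OG)
    then show "grp_act (block_diag A (1\<^sub>m M)) t \<in> V_lam" if "t \<in> V_lam" for t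
      using that by (rule V_lam_GL)
  qed
  moreover have "hom_act M A (extend f) t = degree_part N m (hom_act M A f t)" if t: "t \<in> W_mu" for t
  proof -
    have "f t \<in> tensor_space (N + M) n"
      using Hom_D(1)[OF f[unfolded Hom_OG_def] t] V_lam(2) by blast
    then show ?thesis
      unfolding hom_act_def extend(3)[OF f False t]
      using degree_part_grp_act[OF Ac one_carrier_mat, of "f t" M n m] by simp
  qed
  ultimately show ?thesis using False by (intro extend_eqI)
qed

end

theorem mainTheorem5:
  fixes N M :: nat and lam mu :: "nat \<Rightarrow> nat" and V_lam V_mu :: "tensor set"
  assumes "N \<ge> 1"
    and "is_partition lam" and "is_partition mu"
    and "conj_partition lam 0 + conj_partition lam 1 \<le> N + M"
    and "conj_partition mu 0 + conj_partition mu 1 \<le> M"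
    and "is_V (N + M) lam V_lam" and "is_V M mu V_mu"
  defines "W_lam \<equiv> W_of (N + M) lam V_lam" and "W_mu \<equiv> W_of M mu V_mu"
  shows "\<exists>\<Phi>. linear_map_on hscale hscale (Hom_OG N M W_mu W_lam) (Hom_gl N M V_mu V_lam) \<Phi> \<and>
             inj_on \<Phi> (Hom_OG N M W_mu W_lam) \<and>
             (\<forall>A \<in> OG N. \<forall>f \<in> Hom_OG N M W_mu W_lam. \<Phi> (hom_act M A f) = hom_act M A (\<Phi> f))"
proof -
  interpret branching N M "psize lam" "psize mu" V_lam V_mu
    using assms(6,7) by unfold_locales (simp_all add: is_V_def GL_irreducible_def)
  show ?thesis
    unfolding W_lam_def W_mu_def W_of_def
    using extend_linear extend_inj extend_hom_act by blast
qed

end
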